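(* Let $\hat K\in W^{1,\infty}([0,2\pi])$ have the expansion $\hat K(\theta)=\sum_{n=1}^\infty k_n\cos(2n\theta)$ with $k_n<0$ for all $n$ and $k_1<k_2<k_3<\cdots$. For $\lambda>0$ consider the equation $u-\lambda\Gamma[u]=0$ for $u\in Y$, where $$\Gamma[u](\theta)=\left(\int_0^{2\pi}e^{-u(\theta')}\,d\theta'\right)^{-1}\int_0^{2\pi}\hat K(\theta-\theta')\,e^{-u(\theta')}\,d\theta'.$$ Then: (a) for $0<\lambda<\lambda_0:=\|\hat K\|_\infty^{-1}$ the equation has the unique trivial solution $u\equiv 0$; (b) for every $n\ge 1$, two solutions bifurcate from the trivial solution at $\lambda_n:=-\frac{2}{k_n}$; (c) the trivial solution is stable for $0<\lambda<\lambda_1$ and unstable for $\lambda>\lambda_1$.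
   Context: $\hat K$ is extended to $\mathbb{R}$ by the ($\pi$-periodic) cosine series. The space $Y$ is the closed subspace of $W^{1,2}([0,2\pi])$ $$Y=\Big\{u\in W^{1,2}([0,2\pi]):\ u(\theta)=u(\pi+\theta)\ \text{a.e.},\ u(\theta)=u(2\pi-\theta)\ \text{a.e.},\ \int_0^{2\pi}u(\theta)\,d\theta=0\Big\},$$ functions being extended $2\pi$-periodically. Note $\Gamma[0]=0$, so $u\equiv0$ solves the equation for every $\lambda$. $D\Gamma[0]$ is the derivative of $\Gamma:Y\to Y$ at $0$. "Two solutions bifurcate from the trivial solution at $\lambda_n$" means: $\ker(\mathrm{Id}-\lambda_nD\Gamma[0])$ is spanned by some $v\ne0$, and there are $\delta>0$ and continuous functions $\mu:(-\delta,\delta)\to\mathbb{R}$ and $z:(-\delta,\delta)\to Z$, where $Z$ is a closed complement of $\mathrm{span}\{v\}$ in $Y$, with $\mu(0)=0$, $z(0)=0$, such that in a neighbourhood of $(\lambda_n,0)$ in $\mathbb{R}\times Y$ the solutions $(\lambda,u)$ with $u\neq0$ are exactly those of the form $(\lambda_n+\mu(t),\,tv+tz(t))$, $0<|t|<\delta$ (the two solutions corresponding to the two half-branches $t>0$ and $t<0$). Stability is linear stability: the trivial solution is stable at $\lambda$ if the linearization $\mathrm{Id}-\lambda D\Gamma[0]$ on $Y$ has all its eigenvalues positive, and unstable if it has a negative eigenvalue. *)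

theory Defs
  imports "HOL-Probability.Probability" "HOL-Library.Real_Mod"
begin

abbreviation (input) leb2pi :: "real measure"
  where "leb2pi \<equiv> lebesgue_on {0..2*pi}"

text \<open>Functions on \<open>[0,2\<pi>]\<close> are total functions whose values outside the interval are irrelevant.
  Sobolev functions are defined by weak derivatives on the open interval, tested against
  continuously differentiable functions with compact support in it.\<close>

definition test_fun :: "(real \<Rightarrow> real) \<Rightarrow> bool" where
  "test_fun \<phi> \<longleftrightarrow> \<phi> C1_differentiable_on UNIV \<and> compact (closure {x. \<phi> x \<noteq> 0})
     \<and> closure {x. \<phi> x \<noteq> 0} \<subseteq> {0<..<2*pi}"

definition has_weak_deriv :: "(real \<Rightarrow> real) \<Rightarrow> (real \<Rightarrow> real) \<Rightarrow> bool" where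
  "has_weak_deriv u g \<longleftrightarrow>
     (\<forall>\<phi>. test_fun \<phi> \<longrightarrow> (\<integral>x. u x * deriv \<phi> x \<partial>leb2pi) = - (\<integral>x. g x * \<phi> x \<partial>leb2pi))"

definition L2 :: "(real \<Rightarrow> real) set" where
  "L2 = {u. u \<in> borel_measurable leb2pi \<and> integrable leb2pi (\<lambda>x. (u x)\<^sup>2)}"

definition W12 :: "(real \<Rightarrow> real) set" where
  "W12 = {u. u \<in> L2 \<and> (\<exists>g\<in>L2. has_weak_deriv u g)}"

definition Linf_norm :: "(real \<Rightarrow> real) \<Rightarrow> ereal" where
  "Linf_norm u = esssup leb2pi (\<lambda>x. ereal \<bar>u x\<bar>)"

definition Linf :: "(real \<Rightarrow> real) set" where
  "Linf = {u. u \<in> borel_measurable leb2pi \<and> Linf_norm u < \<infinity>}"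

definition W1inf :: "(real \<Rightarrow> real) set" where
  "W1inf = {u. u \<in> Linf \<and> (\<exists>g\<in>Linf. has_weak_deriv u g)}"

text \<open>Reduction modulo \<open>2\<pi>\<close> implements the \<open>2\<pi>\<close>-periodic extension.\<close>

definition Yfun :: "(real \<Rightarrow> real) set" where
  "Yfun = {u. u \<in> W12
     \<and> (AE x in leb2pi. u x = u ((pi + x) rmod (2*pi)))
     \<and> (AE x in leb2pi. u x = u ((2*pi - x) rmod (2*pi)))
     \<and> (\<integral>x. u x \<partial>leb2pi) = 0}"

lemma L2_integrable_mult:
  assumes "u \<in> L2" "v \<in> L2" shows "integrable leb2pi (\<lambda>x. u x * v x)"
proof (rule Bochner_Integration.integrable_bound)
  show "integrable leb2pi (\<lambda>x. (u x)\<^sup>2 + (v x)\<^sup>2)"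
    using assms by (auto simp: L2_def)
  show "(\<lambda>x. u x * v x) \<in> borel_measurable leb2pi"
    using assms by (auto simp: L2_def)
  have "\<bar>a * b\<bar> \<le> a\<^sup>2 + b\<^sup>2" for a b :: real
  proof -
    have "2 * (\<bar>a\<bar> * \<bar>b\<bar>) \<le> a\<^sup>2 + b\<^sup>2"
      using sum_squares_bound[of "\<bar>a\<bar>" "\<bar>b\<bar>"] by (simp add: mult.assoc)
    moreover have "0 \<le> \<bar>a\<bar> * \<bar>b\<bar>" by simp
    ultimately show ?thesis unfolding abs_mult by linarith
  qed
  then show "AE x in leb2pi. norm (u x * v x) \<le> norm ((u x)\<^sup>2 + (v x)\<^sup>2)"
    by simp
qed

lemma finite_measure_leb2pi: "finite_measure leb2pi"
  by (rule finite_measureI) (simp add: emeasure_restrict_space)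

lemma bounded_meas_L2:
  assumes "u \<in> borel_measurable leb2pi" "\<And>x. \<bar>u x\<bar> \<le> C" shows "u \<in> L2"
proof -
  interpret finite_measure leb2pi by (rule finite_measure_leb2pi)
  have "(\<lambda>x. (u x)\<^sup>2) \<in> borel_measurable leb2pi"
    using assms(1) by (rule borel_measurable_power)
  moreover have "norm ((u x)\<^sup>2) \<le> C\<^sup>2" for x
    using power_mono[OF assms(2)[of x] abs_ge_zero, of 2] by simp
  ultimately have "integrable leb2pi (\<lambda>x. (u x)\<^sup>2)"
    using integrable_const_bound AE_I2 by metis
  with assms(1) show ?thesis unfolding L2_def by blast
qed

lemma L2_integrable: "u \<in> L2 \<Longrightarrow> integrable leb2pi u"
  using L2_integrable_mult[of u "\<lambda>_. 1"] bounded_meas_L2[of "\<lambda>_. 1" 1] by simp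

lemma L2_add: "u \<in> L2 \<Longrightarrow> v \<in> L2 \<Longrightarrow> (\<lambda>x. u x + v x) \<in> L2"
  using L2_integrable_mult[of u v] by (auto simp: L2_def power2_sum mult.assoc)

lemma L2_scale: "u \<in> L2 \<Longrightarrow> (\<lambda>x. c * u x) \<in> L2"
  unfolding L2_def mem_Collect_eq power_mult_distrib
  by (intro conjI borel_measurable_times borel_measurable_const Bochner_Integration.integrable_mult_right; elim conjE; assumption)

lemma continuous_compact_support_bounded:
  fixes f :: "real \<Rightarrow> real"
  assumes "continuous_on UNIV f" "compact K" "\<And>x. x \<notin> K \<Longrightarrow> f x = 0"
  obtains C where "\<And>x. \<bar>f x\<bar> \<le> C"
proof -
  have "bounded (f ` K)"
    by (intro compact_imp_bounded compact_continuous_image continuous_on_subset[OF assms(1)] assms(2)) simp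
  then obtain C where C: "\<And>x. x \<in> K \<Longrightarrow> \<bar>f x\<bar> \<le> C"
    by (auto simp: bounded_iff)
  have "\<bar>f x\<bar> \<le> max C 0" for x
    using C[of x] assms(3)[of x] by (cases "x \<in> K") auto
  then show ?thesis using that by blast
qed

lemma continuous_leb2pi_measurable:
  "continuous_on UNIV f \<Longrightarrow> (f :: real \<Rightarrow> real) \<in> borel_measurable leb2pi"
  using borel_measurable_continuous_onI[of f]
  by (intro measurable_restrict_space1 measurable_completion) simp

lemma test_fun_L2: assumes "test_fun \<phi>" shows "\<phi> \<in> L2" "deriv \<phi> \<in> L2"
proof -
  let ?K = "closure {x. \<phi> x \<noteq> 0}"
  from assms have C1: "\<phi> C1_differentiable_on UNIV" and K: "compact ?K"
    unfolding test_fun_def by blast+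
  from C1 obtain D where D: "\<forall>x\<in>UNIV. (\<phi> has_vector_derivative D x) (at x)" "continuous_on UNIV D"
    unfolding C1_differentiable_on_def by blast
  have D1: "(\<phi> has_vector_derivative D x) (at x)" for x
    using D(1) by (rule bspec) simp
  have DD: "deriv \<phi> = D"
    using D1 by (intro ext DERIV_imp_deriv) (simp add: has_real_derivative_iff_has_vector_derivative)
  have cont: "continuous_on UNIV \<phi>"
    by (rule C1_differentiable_imp_continuous_on[OF C1])
  have out: "\<phi> x = 0" if "x \<notin> ?K" for x
    using that subsetD[OF closure_subset, of x "{x. \<phi> x \<noteq> 0}"] by fast
  have Dout: "D x = 0" if x: "x \<notin> ?K" for x
  proof -
    have "((\<lambda>_. 0) has_vector_derivative D x) (at x)"
    proof (rule has_vector_derivative_transform_within_open[OF D1[of x]])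
      show "open (- ?K)" by (rule open_Compl[OF closed_closure])
      show "x \<in> - ?K" using x unfolding Compl_iff .
      show "\<phi> y = 0" if "y \<in> - ?K" for y using that unfolding Compl_iff by (rule out)
    qed
    from vector_derivative_unique_at[OF this has_vector_derivative_const] show ?thesis .
  qed
  obtain C where "\<And>x. \<bar>D x\<bar> \<le> C"
    using continuous_compact_support_bounded[OF D(2) K Dout] by blast
  then show "deriv \<phi> \<in> L2"
    unfolding DD by (intro bounded_meas_L2 continuous_leb2pi_measurable D(2))
  obtain C where "\<And>x. \<bar>\<phi> x\<bar> \<le> C"
    using continuous_compact_support_bounded[OF cont K out] by blast
  then show "\<phi> \<in> L2"
    by (intro bounded_meas_L2 continuous_leb2pi_measurable cont)
qed

lemma has_weak_deriv_add:
  assumes "u \<in> L2" "v \<in> L2" "g \<in> L2" "h \<in> L2" "has_weak_deriv u g" "has_weak_deriv v h"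
  shows "has_weak_deriv (\<lambda>x. u x + v x) (\<lambda>x. g x + h x)"
  using assms test_fun_L2 unfolding has_weak_deriv_def
  by (simp add: distrib_right L2_integrable_mult)

lemma has_weak_deriv_scale:
  assumes "has_weak_deriv u g"
  shows "has_weak_deriv (\<lambda>x. c * u x) (\<lambda>x. c * g x)"
  using assms unfolding has_weak_deriv_def by (simp add: mult.assoc)

lemma has_weak_deriv_cong_AE:
  assumes "AE x in leb2pi. u x = v x" "u \<in> L2" "v \<in> L2"
  shows "has_weak_deriv u g \<longleftrightarrow> has_weak_deriv v g"
proof -
  have "(\<integral>x. u x * deriv \<phi> x \<partial>leb2pi) = (\<integral>x. v x * deriv \<phi> x \<partial>leb2pi)" if "test_fun \<phi>" for \<phi>
    by (rule integral_cong_AE) (use assms test_fun_L2[OF that] in \<open>auto simp: L2_def\<close>)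
  then show ?thesis by (auto simp: has_weak_deriv_def)
qed

text \<open>Bumps with support \<open>[a,b]\<close>; \<open>n * bump / (1 + n * bump)\<close> increases to the indicator of
  \<open>(a,b)\<close>, which yields uniqueness of weak derivatives up to null sets.\<close>

definition bump :: "real \<Rightarrow> real \<Rightarrow> real \<Rightarrow> real" where
  "bump a b x = (max 0 ((x - a) * (b - x)))\<^sup>2"

lemma sq_pos_part_deriv:
  "((\<lambda>y::real. (max 0 y)\<^sup>2) has_real_derivative 2 * max 0 y) (at y)"
proof -
  consider "y < 0" | "y > 0" | "y = 0" by linarith
  then show ?thesis
  proof cases
    case 1
    have "((\<lambda>_::real. 0::real) has_real_derivative 0) (at y)" by simp
    then have "((\<lambda>y::real. (max 0 y)\<^sup>2) has_real_derivative 0) (at y)"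
      by (rule has_field_derivative_transform_within_open[of _ _ _ "{..<0}"]) (use 1 in auto)
    with 1 show ?thesis by simp
  next
    case 2
    have "((\<lambda>y::real. y\<^sup>2) has_real_derivative 2 * y) (at y)"
      by (auto intro!: derivative_eq_intros)
    then have "((\<lambda>y::real. (max 0 y)\<^sup>2) has_real_derivative 2 * y) (at y)"
      by (rule has_field_derivative_transform_within_open[of _ _ _ "{0<..}"]) (use 2 in auto)
    with 2 show ?thesis by simp
  next
    case 3
    have eq: "(max 0 h)\<^sup>2 / h = max 0 h" for h :: real
      by (auto simp: max_def power2_eq_square)
    have "((\<lambda>h::real. max 0 h) \<longlongrightarrow> max 0 0) (at 0)"
      by (intro tendsto_intros)
    then show ?thesis using 3 by (simp add: DERIV_def eq)
  qed
qed

lemma bump_deriv: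
  "(bump a b has_real_derivative 2 * max 0 ((x - a) * (b - x)) * (a + b - 2 * x)) (at x)"
proof -
  have "((\<lambda>x. (x - a) * (b - x)) has_real_derivative (a + b - 2 * x)) (at x)"
    by (auto intro!: derivative_eq_intros)
  from DERIV_chain2[OF sq_pos_part_deriv this] show ?thesis
    by (simp add: bump_def[abs_def])
qed

lemma bump_pos_iff: assumes "a < b" shows "bump a b x > 0 \<longleftrightarrow> a < x \<and> x < b"
proof -
  have "(max 0 y)\<^sup>2 > 0 \<longleftrightarrow> y > 0" for y :: real
    by (auto simp: max_def)
  then have "bump a b x > 0 \<longleftrightarrow> (x - a) * (b - x) > 0"
    unfolding bump_def .
  also have "\<dots> \<longleftrightarrow> a < x \<and> x < b"
    unfolding zero_less_mult_iff using assms by linarith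
  finally show ?thesis .
qed

lemma bump_nonneg: "bump a b x \<ge> 0"
  by (simp add: bump_def)

lemma test_fun_bump:
  assumes "0 < a" "a < b" "b < 2*pi"
  shows "test_fun (\<lambda>x. real n * bump a b x / (1 + real n * bump a b x))"
proof -
  let ?f = "\<lambda>x. real n * bump a b x / (1 + real n * bump a b x)"
  let ?B = "\<lambda>x. 2 * max 0 ((x - a) * (b - x)) * (a + b - 2 * x)"
  have pos: "1 + real n * bump a b x > 0" for x
    using bump_nonneg[of a b x] by (simp add: add_pos_nonneg)
  have D: "(?f has_real_derivative (real n * ?B x / (1 + real n * bump a b x)\<^sup>2)) (at x)" for x
    using pos[of x]
    by (auto intro!: derivative_eq_intros bump_deriv simp: power2_eq_square field_simps)
  have cb: "continuous_on UNIV (bump a b)"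
    unfolding bump_def[abs_def] by (intro continuous_intros)
  have "continuous_on UNIV (\<lambda>x. real n * ?B x / (1 + real n * bump a b x)\<^sup>2)"
    by (intro continuous_intros cb) (use pos in \<open>auto simp: less_imp_neq[symmetric]\<close>)
  then have "?f C1_differentiable_on UNIV"
    unfolding C1_differentiable_on_def
    by (intro exI[where x="\<lambda>x. real n * ?B x / (1 + real n * bump a b x)\<^sup>2"] conjI ballI
          D[unfolded has_real_derivative_iff_has_vector_derivative])
  moreover have sub: "closure {x. ?f x \<noteq> 0} \<subseteq> {a..b}"
  proof (rule closure_minimal)
    show "{x. ?f x \<noteq> 0} \<subseteq> {a..b}"
    proof
      fix x assume "x \<in> {x. ?f x \<noteq> 0}"
      then have "bump a b x \<noteq> 0" by force
      then have "bump a b x > 0" using bump_nonneg[of a b x] by linarith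
      then show "x \<in> {a..b}" unfolding bump_pos_iff[OF assms(2)] by simp
    qed
  qed simp
  moreover have "compact (closure {x. ?f x \<noteq> 0})"
    using compact_Int_closed[OF compact_Icc closed_closure[of "{x. ?f x \<noteq> 0}"], of a b] sub
    by (simp only: Int_absorb1)
  moreover have "{a..b} \<subseteq> {0<..<2*pi}" using assms by auto
  ultimately show ?thesis
    unfolding test_fun_def using order.trans by blast
qed

lemma ratio_lim:
  assumes "c > (0::real)" shows "(\<lambda>n. real n * c / (1 + real n * c)) \<longlonglongrightarrow> 1"
proof -
  have "filterlim (\<lambda>n. 1 + real n * c) at_top sequentially"
    by (intro filterlim_tendsto_add_at_top[OF tendsto_const]
        filterlim_at_top_mult_tendsto_pos[OF tendsto_const assms] filterlim_real_sequentially)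
  then have "(\<lambda>n. inverse (1 + real n * c)) \<longlonglongrightarrow> 0"
    by (rule tendsto_inverse_0_at_top)
  then have "(\<lambda>n. 1 - inverse (1 + real n * c)) \<longlonglongrightarrow> 1 - 0"
    by (intro tendsto_intros)
  moreover have "1 - inverse (1 + real n * c) = real n * c / (1 + real n * c)" for n
  proof -
    have "1 + real n * c > 0" using assms by (simp add: add_pos_nonneg)
    then show ?thesis by (simp add: field_simps)
  qed
  ultimately show ?thesis by simp
qed

lemma weak_zero_interval:
  assumes g: "g \<in> L2" and 0: "\<And>\<phi>. test_fun \<phi> \<Longrightarrow> (\<integral>x. g x * \<phi> x \<partial>leb2pi) = 0"
    and ab: "0 < a" "a < b" "b < 2*pi"
  shows "(\<integral>x. g x * indicator {a<..<b} x \<partial>leb2pi) = 0"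
proof -
  let ?f = "\<lambda>n x. real n * bump a b x / (1 + real n * bump a b x)"
  have gm: "g \<in> borel_measurable leb2pi" using g by (simp add: L2_def)
  have fm: "?f n \<in> borel_measurable leb2pi" for n
    using test_fun_L2(1)[OF test_fun_bump[OF ab]] by (simp add: L2_def)
  have "(\<lambda>n. \<integral>x. g x * ?f n x \<partial>leb2pi) \<longlonglongrightarrow> (\<integral>x. g x * indicator {a<..<b} x \<partial>leb2pi)"
  proof (rule integral_dominated_convergence)
    show "integrable leb2pi (\<lambda>x. \<bar>g x\<bar>)" using L2_integrable[OF g] by simp
    have "(indicator {a<..<b} :: real \<Rightarrow> real) \<in> borel_measurable leb2pi"
      by (intro measurable_restrict_space1 borel_measurable_indicator) simp
    with gm show "(\<lambda>x. g x * indicator {a<..<b} x) \<in> borel_measurable leb2pi"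
      by (rule borel_measurable_times)
    show "(\<lambda>x. g x * ?f n x) \<in> borel_measurable leb2pi" for n
      using gm fm by (intro borel_measurable_times)
    have "(\<lambda>n. ?f n x) \<longlonglongrightarrow> indicator {a<..<b} x" for x
    proof (cases "bump a b x > 0")
      case True
      then have "(\<lambda>n. ?f n x) \<longlonglongrightarrow> 1" by (rule ratio_lim)
      moreover have "indicator {a<..<b} x = (1::real)"
        using True unfolding bump_pos_iff[OF ab(2)] by (simp add: indicator_def)
      ultimately show ?thesis by simp
    next
      case False
      then have "bump a b x = 0" using bump_nonneg[of a b x] by simp
      moreover have "indicator {a<..<b} x = (0::real)"
        using False unfolding bump_pos_iff[OF ab(2)] by (simp add: indicator_def)
      ultimately show ?thesis by simp
    qed
    then show "AE x in leb2pi. (\<lambda>n. g x * ?f n x) \<longlonglongrightarrow> g x * indicator {a<..<b} x"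
      by (intro AE_I2 tendsto_mult tendsto_const)
    have bnd: "\<bar>?f n x\<bar> \<le> 1" for n x
    proof -
      have "0 \<le> real n * bump a b x" by (intro mult_nonneg_nonneg bump_nonneg) simp
      then show ?thesis by (simp add: divide_le_eq)
    qed
    have "norm (g x * ?f n x) \<le> \<bar>g x\<bar>" for n x
      using mult_left_mono[OF bnd[of n x] abs_ge_zero[of "g x"]] unfolding real_norm_def abs_mult mult_1_right .
    then show "AE x in leb2pi. norm (g x * ?f n x) \<le> \<bar>g x\<bar>" for n
      by (intro AE_I2)
  qed
  moreover have "(\<integral>x. g x * ?f n x \<partial>leb2pi) = 0" for n
    by (rule 0[OF test_fun_bump[OF ab]])
  ultimately show ?thesis
    by (simp add: LIMSEQ_const_iff)
qed

lemma weak_zero_Ioo: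
  assumes g: "g \<in> L2" and 0: "\<And>\<phi>. test_fun \<phi> \<Longrightarrow> (\<integral>x. g x * \<phi> x \<partial>leb2pi) = 0"
  shows "(\<integral>x. g x * indicator {a<..<b} x \<partial>leb2pi) = 0"
proof -
  define c d where "c = max a 0" and "d = min b (2*pi)"
  define I where "I n = {c + 1 / real (Suc n) <..< d - 1 / real (Suc n)}" for n
  have gm: "g \<in> borel_measurable leb2pi" using g by (simp add: L2_def)
  have indm: "(indicator {s<..<t} :: real \<Rightarrow> real) \<in> borel_measurable leb2pi" for s t :: real
    by (intro measurable_restrict_space1 borel_measurable_indicator) simp
  have "(\<lambda>n. \<integral>x. g x * indicator (I n) x \<partial>leb2pi) \<longlonglongrightarrow> (\<integral>x. g x * indicator {c<..<d} x \<partial>leb2pi)"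
  proof (rule integral_dominated_convergence)
    show "integrable leb2pi (\<lambda>x. \<bar>g x\<bar>)" using L2_integrable[OF g] by (rule integrable_abs)
    show "(\<lambda>x. g x * indicator {c<..<d} x) \<in> borel_measurable leb2pi"
      using gm indm by (rule borel_measurable_times)
    show "(\<lambda>x. g x * indicator (I n) x) \<in> borel_measurable leb2pi" for n
      unfolding I_def using gm indm by (rule borel_measurable_times)
    have "(\<lambda>n. indicator (I n) x :: real) \<longlonglongrightarrow> indicator {c<..<d} x" for x
    proof (cases "c < x \<and> x < d")
      case True
      have "(\<lambda>n. c + 1 / real (Suc n)) \<longlonglongrightarrow> c + 0" "(\<lambda>n. d - 1 / real (Suc n)) \<longlonglongrightarrow> d - 0"
        by (intro tendsto_intros LIMSEQ_Suc[OF lim_1_over_n])+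
      with True have "\<forall>\<^sub>F n in sequentially. c + 1 / real (Suc n) < x"
         "\<forall>\<^sub>F n in sequentially. x < d - 1 / real (Suc n)"
        using order_tendstoD by fastforce+
      then have "\<forall>\<^sub>F n in sequentially. indicator (I n) x = (1::real)"
        by eventually_elim (simp add: I_def)
      then have "(\<lambda>n. indicator (I n) x :: real) \<longlonglongrightarrow> 1" by (rule tendsto_eventually)
      with True show ?thesis by simp
    next
      case False
      have "x \<notin> I n" for n
      proof
        assume "x \<in> I n"
        moreover have "1 / real (Suc n) > 0" by simp
        ultimately have "c < x \<and> x < d" unfolding I_def greaterThanLessThan_iff by linarith
        with False show False by contradiction
      qed
      with False show ?thesis by (auto simp: indicator_def)
    qed
    then show "AE x in leb2pi. (\<lambda>n. g x * indicator (I n) x) \<longlonglongrightarrow> g x * indicator {c<..<d} x"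
      by (intro AE_I2 tendsto_mult tendsto_const)
    show "AE x in leb2pi. norm (g x * indicator (I n) x) \<le> \<bar>g x\<bar>" for n
      by (intro AE_I2) (simp add: indicator_def)
  qed
  moreover have "(\<integral>x. g x * indicator (I n) x \<partial>leb2pi) = 0" for n
  proof (cases "c + 1 / real (Suc n) < d - 1 / real (Suc n)")
    case True
    have "1 / real (Suc n) > 0" by simp
    then have "0 < c + 1 / real (Suc n)" "d - 1 / real (Suc n) < 2*pi"
      unfolding c_def d_def by linarith+
    from weak_zero_interval[OF g 0 this(1) True this(2)] show ?thesis by (simp add: I_def)
  qed (simp add: I_def)
  ultimately have "(\<integral>x. g x * indicator {c<..<d} x \<partial>leb2pi) = 0"
    by (simp add: LIMSEQ_const_iff)
  also have "(\<integral>x. g x * indicator {c<..<d} x \<partial>leb2pi) = (\<integral>x. g x * indicator {a<..<b} x \<partial>leb2pi)"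
  proof (rule integral_cong_AE)
    have "{0, 2*pi} \<in> null_sets lebesgue"
      by (intro null_sets_completionI finite_imp_null_set_lborel) simp
    then have "AE x in lebesgue. x \<notin> {0, 2*pi}" by (rule AE_not_in)
    then show "AE x in leb2pi. g x * indicator {c<..<d} x = g x * indicator {a<..<b} x"
      by (subst AE_restrict_space_iff, simp, elim eventually_mono)
         (auto simp: c_def d_def indicator_def)
  qed (use gm indm in \<open>rule borel_measurable_times\<close>)+
  finally show ?thesis .
qed

lemma weak_zero_AE:
  assumes g: "g \<in> L2" and 0: "\<And>\<phi>. test_fun \<phi> \<Longrightarrow> (\<integral>x. g x * \<phi> x \<partial>leb2pi) = 0"
  shows "AE x in leb2pi. g x = 0"
proof -
  define G where "G x = indicator {0..2*pi} x *\<^sub>R g x" for x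
  have intG: "integrable lebesgue G"
    using L2_integrable[OF g] unfolding G_def[abs_def] by (simp add: integrable_restrict_space)
  have conv: "(LINT x:A|lebesgue. G x) = (\<integral>x. g x * indicator A x \<partial>leb2pi)" for A
    by (simp add: set_lebesgue_integral_def integral_restrict_space G_def mult_ac)
  have setint: "set_integrable lebesgue A G" if "A \<in> sets lebesgue" for A
    unfolding set_integrable_def by (rule integrable_mult_indicator[OF that intG])
  have borel: "(LINT x:A|lebesgue. G x) = 0" if "A \<in> sets borel" for A :: "real set"
  proof -
    let ?S = "range (\<lambda>(a, b). box a b :: real set)"
    have eq: "sigma_sets UNIV ?S = sets borel"
      unfolding borel_eq_box[where 'a=real] by (rule sets_measure_of[symmetric]) blast
    have leb: "B \<in> sets lebesgue" if "B \<in> sigma_sets UNIV ?S" for B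
      using that unfolding eq by simp
    have "Int_stable ?S"
      by (auto simp: Int_stable_def box_Int_box)
    moreover have "?S \<subseteq> Pow UNIV" by simp
    moreover have "A \<in> sigma_sets UNIV ?S"
      using that unfolding eq .
    ultimately show ?thesis
    proof (induction rule: sigma_sets_induct_disjoint)
      case (basic B)
      then obtain a b where "B = {a<..<b}" by auto
      then show ?case using weak_zero_Ioo[OF g 0, of a b] conv by simp
    next
      case empty
      show ?case unfolding set_lebesgue_integral_def by simp
    next
      case (compl B)
      have "(\<integral>x. g x \<partial>leb2pi) = (\<integral>x. g x * indicator {-1<..<2*pi+1} x \<partial>leb2pi)"
        by (rule Bochner_Integration.integral_cong) (auto simp: space_restrict_space)
      also have "\<dots> = 0" by (rule weak_zero_Ioo[OF g 0])
      finally have "(LINT x:UNIV|lebesgue. G x) = 0" by (simp add: conv)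
      moreover have "(LINT x:B \<union> (UNIV - B)|lebesgue. G x)
          = (LINT x:B|lebesgue. G x) + (LINT x:UNIV - B|lebesgue. G x)"
        using leb[OF compl(1)] by (intro set_integral_Un setint) auto
      ultimately show ?case using compl(2) by simp
    next
      case (union B)
      then have "B i \<in> sets lebesgue" for i using leb by blast
      then have "(LINT x:(\<Union>i. B i)|lebesgue. G x) = (\<Sum>i. LINT x:B i|lebesgue. G x)"
        using union(1) by (intro lebesgue_integral_countable_add setint) (auto simp: disjoint_family_on_def)
      then show ?case using union(3) by simp
    qed
  qed
  have "(LINT x:A|lebesgue. G x) = 0" if A: "A \<in> sets lebesgue" for A
  proof -
    obtain S N N' where A: "A = S \<union> N" "N \<subseteq> N'" "N' \<in> null_sets lborel" "S \<in> sets lborel"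
      using A by (rule sets_completionE)
    have AS: "A \<in> sets lebesgue" "S \<in> sets lebesgue" using that A(4) by auto
    have "(LINT x:A|lebesgue. G x) = (LINT x:S|lebesgue. G x)"
      unfolding set_lebesgue_integral_def
    proof (rule integral_cong_AE)
      have "AE x in lebesgue. x \<notin> N'"
        by (rule AE_not_in[OF null_sets_completionI[OF A(3)]])
      then show "AE x in lebesgue. indicator A x *\<^sub>R G x = indicator S x *\<^sub>R G x"
        by eventually_elim (use A(1,2) in \<open>auto simp: indicator_def\<close>)
    qed (use setint[OF AS(1)] setint[OF AS(2)] in \<open>auto simp: set_integrable_def\<close>)
    also have "\<dots> = 0" using A(4) by (intro borel) simp
    finally show ?thesis .
  qed
  then have "AE x in lebesgue. G x = 0"
    by (intro density_unique_real intG) (simp_all add: set_lebesgue_integral_def)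
  then show ?thesis
    by (subst AE_restrict_space_iff) (auto simp: G_def elim!: eventually_mono)
qed

lemma has_weak_deriv_unique:
  assumes "g \<in> L2" "h \<in> L2" "has_weak_deriv u g" "has_weak_deriv u h"
  shows "AE x in leb2pi. g x = h x"
proof -
  have mh: "(\<lambda>x. - 1 * h x) \<in> L2" by (rule L2_scale[OF assms(2)])
  have "AE x in leb2pi. g x + - 1 * h x = 0"
  proof (rule weak_zero_AE[OF L2_add[OF assms(1) mh]])
    fix \<phi> assume \<phi>: "test_fun \<phi>"
    then have "(\<integral>x. g x * \<phi> x \<partial>leb2pi) = (\<integral>x. h x * \<phi> x \<partial>leb2pi)"
      using assms(3,4) unfolding has_weak_deriv_def by force
    then show "(\<integral>x. (g x + - 1 * h x) * \<phi> x \<partial>leb2pi) = 0"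
      using L2_integrable_mult[OF assms(1) test_fun_L2(1)[OF \<phi>]]
        L2_integrable_mult[OF assms(2) test_fun_L2(1)[OF \<phi>]]
      by (simp add: left_diff_distrib)
  qed
  then show ?thesis by simp
qed

text \<open>The weak derivative is unique only up to null sets; the choice below does not affect
  \<open>W12_inner\<close>.\<close>

definition wderiv :: "(real \<Rightarrow> real) \<Rightarrow> real \<Rightarrow> real" where
  "wderiv u = (SOME g. g \<in> L2 \<and> has_weak_deriv u g)"

definition W12_inner :: "(real \<Rightarrow> real) \<Rightarrow> (real \<Rightarrow> real) \<Rightarrow> real" where
  "W12_inner u v = (\<integral>x. u x * v x \<partial>leb2pi) + (\<integral>x. wderiv u x * wderiv v x \<partial>leb2pi)"

definition eq_Y :: "(real \<Rightarrow> real) \<Rightarrow> (real \<Rightarrow> real) \<Rightarrow> bool" where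
  "eq_Y u v \<longleftrightarrow> u \<in> Yfun \<and> v \<in> Yfun \<and> (AE x in leb2pi. u x = v x)"

lemma wderiv:
  assumes "u \<in> W12" shows wderiv_L2: "wderiv u \<in> L2" and wderiv_weak: "has_weak_deriv u (wderiv u)"
proof -
  obtain g where "g \<in> L2 \<and> has_weak_deriv u g" using assms unfolding W12_def by blast
  then have "wderiv u \<in> L2 \<and> has_weak_deriv u (wderiv u)"
    unfolding wderiv_def by (rule someI[where P="\<lambda>g. g \<in> L2 \<and> has_weak_deriv u g"])
  then show "wderiv u \<in> L2" "has_weak_deriv u (wderiv u)" by blast+
qed

lemma W12_L2: "u \<in> W12 \<Longrightarrow> u \<in> L2"
  unfolding W12_def by blast

lemma Yfun_W12: "u \<in> Yfun \<Longrightarrow> u \<in> W12"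
  unfolding Yfun_def by blast

lemma W12_add: "u \<in> W12 \<Longrightarrow> v \<in> W12 \<Longrightarrow> (\<lambda>x. u x + v x) \<in> W12"
  unfolding W12_def mem_Collect_eq using L2_add has_weak_deriv_add by (elim conjE bexE) blast

lemma W12_scale: "u \<in> W12 \<Longrightarrow> (\<lambda>x. c * u x) \<in> W12"
  unfolding W12_def mem_Collect_eq using L2_scale has_weak_deriv_scale by (elim conjE bexE) blast

lemma Yfun_add:
  assumes "u \<in> Yfun" "v \<in> Yfun" shows "(\<lambda>x. u x + v x) \<in> Yfun"
proof -
  have "(\<integral>x. u x + v x \<partial>leb2pi) = 0"
    using assms L2_integrable[OF W12_L2[OF Yfun_W12[OF assms(1)]]]
      L2_integrable[OF W12_L2[OF Yfun_W12[OF assms(2)]]]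
    by (simp add: Yfun_def)
  moreover have "(\<lambda>x. u x + v x) \<in> W12"
    using assms by (intro W12_add Yfun_W12)
  moreover have sy: "AE x in leb2pi. u x + v x = u (\<rho> x) + v (\<rho> x)"
    if "AE x in leb2pi. u x = u (\<rho> x)" "AE x in leb2pi. v x = v (\<rho> x)" for \<rho>
    using that by eventually_elim simp
  ultimately show ?thesis
    using assms unfolding Yfun_def mem_Collect_eq
    by (elim conjE, intro conjI)
       (assumption | rule sy[where \<rho>="\<lambda>x. (pi + x) rmod (2*pi)"]
         | rule sy[where \<rho>="\<lambda>x. (2*pi - x) rmod (2*pi)"])+
qed

lemma Yfun_scale:
  assumes "u \<in> Yfun" shows "(\<lambda>x. c * u x) \<in> Yfun"
proof -
  have "(\<integral>x. c * u x \<partial>leb2pi) = 0"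
    using assms by (simp add: Yfun_def)
  moreover have "(\<lambda>x. c * u x) \<in> W12"
    using assms by (intro W12_scale Yfun_W12)
  moreover have sy: "AE x in leb2pi. c * u x = c * u (\<rho> x)"
    if "AE x in leb2pi. u x = u (\<rho> x)" for \<rho>
    using that by eventually_elim simp
  ultimately show ?thesis
    using assms unfolding Yfun_def mem_Collect_eq
    by (elim conjE, intro conjI)
       (assumption | rule sy[where \<rho>="\<lambda>x. (pi + x) rmod (2*pi)"]
         | rule sy[where \<rho>="\<lambda>x. (2*pi - x) rmod (2*pi)"])+
qed

lemma Yfun_zero: "(\<lambda>_. 0) \<in> Yfun"
proof -
  have L: "(\<lambda>_. 0) \<in> L2" by (rule bounded_meas_L2[of _ 0]) simp_all
  moreover have "has_weak_deriv (\<lambda>_. 0) (\<lambda>_. 0)" unfolding has_weak_deriv_def by simp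
  ultimately have "(\<lambda>_. 0) \<in> W12" unfolding W12_def by blast
  then show ?thesis unfolding Yfun_def by simp
qed

lemma wderiv_AE_eqI:
  assumes "u \<in> W12" "g \<in> L2" "has_weak_deriv u g" shows "AE x in leb2pi. wderiv u x = g x"
  using assms by (intro has_weak_deriv_unique[of _ _ u] wderiv)

lemma eq_Y_wderiv:
  assumes "eq_Y u v" shows "AE x in leb2pi. wderiv u x = wderiv v x"
proof (rule wderiv_AE_eqI)
  have uv: "u \<in> W12" "v \<in> W12" "AE x in leb2pi. u x = v x"
    using assms Yfun_W12 unfolding eq_Y_def by blast+
  then show "u \<in> W12" "wderiv v \<in> L2" by (auto intro: wderiv)
  show "has_weak_deriv u (wderiv v)"
    using has_weak_deriv_cong_AE[OF uv(3) W12_L2[OF uv(1)] W12_L2[OF uv(2)]] wderiv_weak[OF uv(2)]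
    by blast
qed

lemma L2_measurable: "u \<in> L2 \<Longrightarrow> u \<in> borel_measurable leb2pi"
  unfolding L2_def by blast

lemma integral_mult_cong_AE:
  assumes "u \<in> L2" "u' \<in> L2" "v \<in> L2" "v' \<in> L2"
    "AE x in leb2pi. u x = u' x" "AE x in leb2pi. v x = v' x"
  shows "(\<integral>x. u x * v x \<partial>leb2pi) = (\<integral>x. u' x * v' x \<partial>leb2pi)"
proof (rule integral_cong_AE)
  show "AE x in leb2pi. u x * v x = u' x * v' x"
    using assms(5,6) by eventually_elim simp
qed (intro borel_measurable_times L2_measurable assms)+

lemma W12_inner_cong:
  assumes "eq_Y u u'" "eq_Y v v'" shows "W12_inner u v = W12_inner u' v'"
proof -
  have W: "u \<in> W12" "u' \<in> W12" "v \<in> W12" "v' \<in> W12"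
    and AE: "AE x in leb2pi. u x = u' x" "AE x in leb2pi. v x = v' x"
    using assms Yfun_W12 unfolding eq_Y_def by blast+
  show ?thesis unfolding W12_inner_def
    by (intro arg_cong2[where f="(+)"] integral_mult_cong_AE W12_L2 wderiv_L2 W AE
        eq_Y_wderiv assms)
qed

lemma W12_inner_commute: "W12_inner u v = W12_inner v u"
  unfolding W12_inner_def by (simp only: mult.commute)

lemma W12_inner_add:
  assumes "u \<in> W12" "v \<in> W12" "w \<in> W12"
  shows "W12_inner (\<lambda>x. u x + v x) w = W12_inner u w + W12_inner v w"
proof -
  note L = assms[THEN W12_L2] assms[THEN wderiv_L2]
  have "AE x in leb2pi. wderiv (\<lambda>x. u x + v x) x = wderiv u x + wderiv v x"
    by (intro wderiv_AE_eqI W12_add L2_add has_weak_deriv_add W12_L2 wderiv assms)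
  then have "(\<integral>x. wderiv (\<lambda>x. u x + v x) x * wderiv w x \<partial>leb2pi)
      = (\<integral>x. (wderiv u x + wderiv v x) * wderiv w x \<partial>leb2pi)"
    by (intro integral_mult_cong_AE[OF _ _ _ _ _ AE_I2[OF refl]] L2_add L wderiv_L2 W12_add assms)
  then show ?thesis unfolding W12_inner_def
    by (simp add: distrib_right L2_integrable_mult L)
qed

lemma W12_inner_scale:
  assumes "u \<in> W12" "w \<in> W12"
  shows "W12_inner (\<lambda>x. c * u x) w = c * W12_inner u w"
proof -
  note L = assms[THEN W12_L2] assms[THEN wderiv_L2]
  have "AE x in leb2pi. wderiv (\<lambda>x. c * u x) x = c * wderiv u x"
    by (intro wderiv_AE_eqI W12_scale L2_scale has_weak_deriv_scale W12_L2 wderiv assms)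
  then have "(\<integral>x. wderiv (\<lambda>x. c * u x) x * wderiv w x \<partial>leb2pi)
      = (\<integral>x. (c * wderiv u x) * wderiv w x \<partial>leb2pi)"
    by (intro integral_mult_cong_AE[OF _ _ _ _ _ AE_I2[OF refl]] L2_scale L wderiv_L2 W12_scale assms)
  then show ?thesis unfolding W12_inner_def
    by (simp add: distrib_left mult.assoc)
qed

lemma W12_inner_ge0: "0 \<le> W12_inner u u"
  unfolding W12_inner_def by (intro add_nonneg_nonneg Bochner_Integration.integral_nonneg) simp_all

lemma W12_inner_eq0:
  assumes "u \<in> Yfun"
  shows "W12_inner u u = 0 \<longleftrightarrow> eq_Y u (\<lambda>_. 0)"
proof
  assume "W12_inner u u = 0"
  moreover have "0 \<le> (\<integral>x. u x * u x \<partial>leb2pi)" "0 \<le> (\<integral>x. wderiv u x * wderiv u x \<partial>leb2pi)"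
    by (intro Bochner_Integration.integral_nonneg; simp)+
  ultimately have "(\<integral>x. u x * u x \<partial>leb2pi) = 0"
    unfolding W12_inner_def by linarith
  moreover have "integrable leb2pi (\<lambda>x. u x * u x)"
    using W12_L2[OF Yfun_W12[OF assms]] by (intro L2_integrable_mult)
  ultimately have "AE x in leb2pi. u x * u x = 0"
    by (subst (asm) integral_nonneg_eq_0_iff_AE) simp_all
  then show "eq_Y u (\<lambda>_. 0)"
    using assms Yfun_zero unfolding eq_Y_def by simp
next
  assume *: "eq_Y u (\<lambda>_. 0)"
  have "W12_inner (\<lambda>_. 0) (\<lambda>_. 0) = 0"
    using W12_inner_scale[of "\<lambda>_. 0" "\<lambda>_. 0" 0] Yfun_W12[OF Yfun_zero] by simp
  with W12_inner_cong[OF * *] show "W12_inner u u = 0" by simp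
qed

text \<open>The space of almost-everywhere classes, with the norm inherited from \<open>W12\<close>:
  the square root of \<open>\<integral> u\<^sup>2 + \<integral> u'\<^sup>2\<close> over \<open>[0,2\<pi>]\<close>.\<close>

quotient_type Y = "real \<Rightarrow> real" / partial: eq_Y
proof (rule part_equivpI)
  show "\<exists>u. eq_Y u u" using Yfun_zero unfolding eq_Y_def by auto
  show "symp eq_Y" by (rule sympI) (auto simp: eq_Y_def elim: eventually_mono)
  show "transp eq_Y"
  proof (rule transpI)
    fix u v w assume *: "eq_Y u v" "eq_Y v w"
    then have "AE x in leb2pi. u x = v x" "AE x in leb2pi. v x = w x" unfolding eq_Y_def by blast+
    then have "AE x in leb2pi. u x = w x" by eventually_elim simp
    with * show "eq_Y u w" unfolding eq_Y_def by blast
  qed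
qed

lemma eq_Y_add:
  assumes "eq_Y u u'" "eq_Y v v'" shows "eq_Y (\<lambda>x. u x + v x) (\<lambda>x. u' x + v' x)"
proof -
  have "AE x in leb2pi. u x = u' x" "AE x in leb2pi. v x = v' x"
    using assms unfolding eq_Y_def by blast+
  then have "AE x in leb2pi. u x + v x = u' x + v' x" by eventually_elim simp
  then show ?thesis using assms Yfun_add unfolding eq_Y_def by blast
qed

lemma eq_Y_scale:
  assumes "eq_Y u u'" shows "eq_Y (\<lambda>x. c * u x) (\<lambda>x. c * u' x)"
proof -
  have "AE x in leb2pi. u x = u' x"
    using assms unfolding eq_Y_def by blast
  then have "AE x in leb2pi. c * u x = c * u' x" by eventually_elim simp
  then show ?thesis using assms Yfun_scale unfolding eq_Y_def by blast
qed

lemma eq_Y_uminus: "eq_Y u u' \<Longrightarrow> eq_Y (\<lambda>x. - u x) (\<lambda>x. - u' x)"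
  using eq_Y_scale[of u u' "- 1"] by simp

lemma eq_Y_diff: "eq_Y u u' \<Longrightarrow> eq_Y v v' \<Longrightarrow> eq_Y (\<lambda>x. u x - v x) (\<lambda>x. u' x - v' x)"
  using eq_Y_add[OF _ eq_Y_uminus, of u u' v v'] by simp

lemma eq_Y_Yfun: "eq_Y u v \<Longrightarrow> u \<in> Yfun"
  unfolding eq_Y_def by blast

lemma eq_YI: "u \<in> Yfun \<Longrightarrow> (\<And>x. u x = v x) \<Longrightarrow> eq_Y u v"
  unfolding eq_Y_def by (simp add: ext[of u v])

instantiation Y :: real_inner
begin

lift_definition zero_Y :: Y is "\<lambda>_. 0"
  using Yfun_zero by (simp add: eq_Y_def)

lift_definition plus_Y :: "Y \<Rightarrow> Y \<Rightarrow> Y" is "\<lambda>u v x. u x + v x"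
  by (rule eq_Y_add)

lift_definition minus_Y :: "Y \<Rightarrow> Y \<Rightarrow> Y" is "\<lambda>u v x. u x - v x"
  by (rule eq_Y_diff)

lift_definition uminus_Y :: "Y \<Rightarrow> Y" is "\<lambda>u x. - u x"
  by (rule eq_Y_uminus)

lift_definition scaleR_Y :: "real \<Rightarrow> Y \<Rightarrow> Y" is "\<lambda>c u x. c * u x"
  by (rule eq_Y_scale)

lift_definition inner_Y :: "Y \<Rightarrow> Y \<Rightarrow> real" is W12_inner
  by (rule W12_inner_cong)

definition norm_Y :: "Y \<Rightarrow> real" where "norm_Y u = sqrt (inner u u)"

definition sgn_Y :: "Y \<Rightarrow> Y" where "sgn_Y u = inverse (norm u) *\<^sub>R u"

definition dist_Y :: "Y \<Rightarrow> Y \<Rightarrow> real" where "dist_Y u v = norm (u - v)"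

definition uniformity_Y :: "(Y \<times> Y) filter" where
  "uniformity_Y = (INF e\<in>{0 <..}. principal {(x, y). dist x y < e})"

definition open_Y :: "Y set \<Rightarrow> bool" where
  "open_Y U \<longleftrightarrow> (\<forall>x\<in>U. eventually (\<lambda>(x', y). x' = x \<longrightarrow> y \<in> U) uniformity)"

instance
proof
  fix u v w :: Y and a b :: real
  show "u + v + w = u + (v + w)"
    by transfer (rule eq_YI; (intro Yfun_add eq_Y_Yfun; assumption)?; simp add: add.assoc)
  show "u + v = v + u"
    by transfer (rule eq_YI; (intro Yfun_add eq_Y_Yfun; assumption)?; simp)
  show "0 + u = u"
    by transfer simp
  show "- u + u = 0"
    by transfer (simp add: eq_Y_def Yfun_zero)
  show "u - v = u + - v"
    by transfer (simp add: eq_Y_diff)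
  show "a *\<^sub>R (u + v) = a *\<^sub>R u + a *\<^sub>R v"
    by transfer (rule eq_YI; (intro Yfun_scale Yfun_add eq_Y_Yfun; assumption)?; simp add: distrib_left)
  show "(a + b) *\<^sub>R u = a *\<^sub>R u + b *\<^sub>R u"
    by transfer (rule eq_YI; (intro Yfun_scale eq_Y_Yfun; assumption)?; simp add: distrib_right)
  show "a *\<^sub>R b *\<^sub>R u = (a * b) *\<^sub>R u"
    by transfer (rule eq_YI; (intro Yfun_scale eq_Y_Yfun; assumption)?; simp)
  show "1 *\<^sub>R u = u"
    by transfer simp
  show "dist u v = norm (u - v)" by (rule dist_Y_def)
  show "sgn u = inverse (norm u) *\<^sub>R u" by (rule sgn_Y_def)
  show "uniformity = (INF e\<in>{0 <..}. principal {(x :: Y, y). dist x y < e})"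
    by (rule uniformity_Y_def)
  show "open U \<longleftrightarrow> (\<forall>x\<in>U. eventually (\<lambda>(x', y). x' = x \<longrightarrow> y \<in> U) uniformity)" for U :: "Y set"
    by (rule open_Y_def)
  show "inner u v = inner v u"
    by transfer (rule W12_inner_commute)
  show "inner (u + v) w = inner u w + inner v w"
    by transfer (intro W12_inner_add Yfun_W12 eq_Y_Yfun)
  show "inner (a *\<^sub>R u) v = a * inner u v"
    by transfer (intro W12_inner_scale Yfun_W12 eq_Y_Yfun)
  show "0 \<le> inner u u"
    by transfer (rule W12_inner_ge0)
  show "inner u u = 0 \<longleftrightarrow> u = 0"
    by transfer (intro W12_inner_eq0 eq_Y_Yfun)
  show "norm u = sqrt (inner u u)" by (rule norm_Y_def)
qed

end

text \<open>Integration over \<open>[0,2\<pi>]\<close> only uses \<open>u\<close> there, whereas \<open>K\<close> is evaluated at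
  \<open>\<theta> - t \<in> [-2\<pi>,2\<pi>]\<close>, so \<open>K\<close> has to be given already extended to the real line.\<close>

definition Gamma_fun :: "(real \<Rightarrow> real) \<Rightarrow> (real \<Rightarrow> real) \<Rightarrow> real \<Rightarrow> real" where
  "Gamma_fun K u \<theta> = inverse (\<integral>t. exp (- u t) \<partial>leb2pi) * (\<integral>t. K (\<theta> - t) * exp (- u t) \<partial>leb2pi)"

text \<open>\<open>Gamma_Y\<close> is meaningful only if \<open>Gamma_fun K\<close> maps \<open>Yfun\<close> to itself.  It does not
  depend on the representative, since \<open>Gamma_fun\<close> respects equality almost everywhere.\<close>

definition Gamma_Y :: "(real \<Rightarrow> real) \<Rightarrow> Y \<Rightarrow> Y" where
  "Gamma_Y K u = abs_Y (Gamma_fun K (rep_Y u))"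

text \<open>\<open>frechet_derivative\<close> is unspecified for functions that are not differentiable, so the notions
  below presuppose that \<open>G\<close> is differentiable at 0.\<close>

definition linearization :: "('a::real_normed_vector \<Rightarrow> 'a) \<Rightarrow> real \<Rightarrow> 'a \<Rightarrow> 'a" where
  "linearization G l w = w - l *\<^sub>R frechet_derivative G (at 0) w"

definition eigenvalue :: "('a::real_vector \<Rightarrow> 'a) \<Rightarrow> real \<Rightarrow> bool" where
  "eigenvalue L \<mu> \<longleftrightarrow> (\<exists>w. w \<noteq> 0 \<and> L w = \<mu> *\<^sub>R w)"

definition trivial_stable :: "('a::real_normed_vector \<Rightarrow> 'a) \<Rightarrow> real \<Rightarrow> bool" where
  "trivial_stable G l \<longleftrightarrow> (\<forall>\<mu>. eigenvalue (linearization G l) \<mu> \<longrightarrow> \<mu> > 0)"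

definition trivial_unstable :: "('a::real_normed_vector \<Rightarrow> 'a) \<Rightarrow> real \<Rightarrow> bool" where
  "trivial_unstable G l \<longleftrightarrow> (\<exists>\<mu>. eigenvalue (linearization G l) \<mu> \<and> \<mu> < 0)"

definition closed_complement :: "'a::real_normed_vector set \<Rightarrow> 'a set \<Rightarrow> bool" where
  "closed_complement Z V \<longleftrightarrow> subspace Z \<and> closed Z \<and> Z \<inter> V = {0}
     \<and> (\<forall>u. \<exists>v\<in>V. \<exists>z\<in>Z. u = v + z)"

definition two_solutions_bifurcate :: "('a::real_normed_vector \<Rightarrow> 'a) \<Rightarrow> real \<Rightarrow> bool" where
  "two_solutions_bifurcate G l0 \<longleftrightarrow>
     (\<exists>v. v \<noteq> 0 \<and> {w. linearization G l0 w = 0} = span {v} \<and>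
       (\<exists>Z \<delta> \<mu> z. closed_complement Z (span {v}) \<and> \<delta> > 0 \<and>
          continuous_on {-\<delta><..<\<delta>} \<mu> \<and> continuous_on {-\<delta><..<\<delta>} z \<and>
          z ` {-\<delta><..<\<delta>} \<subseteq> Z \<and> \<mu> 0 = 0 \<and> z 0 = 0 \<and>
          (\<exists>U. open U \<and> (l0, 0) \<in> U \<and>
             {(l, u). (l, u) \<in> U \<and> u \<noteq> 0 \<and> u - l *\<^sub>R G u = 0}
               = {(l0 + \<mu> t, t *\<^sub>R v + t *\<^sub>R z t) | t. 0 < \<bar>t\<bar> \<and> \<bar>t\<bar> < \<delta>})))"

end

theory Submission
  imports Defs
begin

text \<open>Since the \<open>k\<^sub>n\<close> are negative, convergence of the cosine series at \<open>0\<close> makes it absolutely convergent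
  with \<open>\<parallel>K\<parallel>\<^sub>\<infinity> = - K 0\<close>, and monotonicity makes \<open>n k\<^sub>n\<close> bounded.  Hence \<open>\<Gamma> = T \<circ> P\<close>, where
  \<open>T\<close> multiplies the \<open>n\<close>-th cosine coefficient by \<open>a\<^sub>n = - k\<^sub>n / 2\<close> and maps \<open>L\<^sup>2\<close> boundedly into \<open>Y\<close>, and
  \<open>P u = - exp (- u) / mean (exp (- u))\<close> satisfies \<open>P u = u + const + O(u\<^sup>2)\<close> in the supremum norm, which
  the norm of \<open>Y\<close> dominates.  So \<open>D\<Gamma>[0] = T\<close> is diagonal in the modes \<open>cos (2 n \<theta>)\<close> with the simple
  eigenvalues \<open>a\<^sub>n\<close>, which gives (c), and (b) follows by Lyapunov--Schmidt reduction with a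
  contraction argument in the blown-up variable \<open>\<zeta>\<close>, \<open>u = t (v + \<zeta>)\<close>.  For (a), a solution with
  \<open>\<bar>u\<bar> \<le> M\<close> satisfies \<open>\<bar>u\<bar> \<le> \<lambda> \<parallel>K\<parallel>\<^sub>\<infinity> M\<close>.\<close>

section \<open>Bifurcation from a simple eigenvalue\<close>

text \<open>Completeness of \<open>Y\<close> is the obstacle that shapes the argument, and it is
  avoided. A Cauchy sequence of \<open>Y\<close> has an a.e. uniform limit by the Sobolev embedding,
  and a smoothing multiplier turns uniform convergence into convergence in \<open>Y\<close>. In the
  bifurcation argument the iteration is rewritten so that each iterate is expressed through images
  under \<open>A\<close> and \<open>G\<close>, which then converge. The parameter is \<kappa> =
  1/\<lambda>: in \<kappa> u = \<Gamma>[u] it multiplies only the linear term, so the component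
  along the kernel gives \<kappa> explicitly and no separate transversality condition has to be
  solved. Simplicity of the eigenvalues, and the gap around each of them, come from strict
  monotonicity of \<open>k\<close>. The reflection symmetry built into \<open>Y\<close> removes the
  sine terms from the convolution, so that \<Gamma> acts on cosine coefficients alone. For (a), the
  bound proportional to M rests on the zero mean of \<open>K\<close>: only the deviation of exp (-u)
  from its mean enters \<Gamma>[u].\<close>

lemma Cauchy_geometric_half:
  fixes z :: "nat \<Rightarrow> 'a::real_normed_vector"
  assumes "\<And>k. norm (z (Suc k) - z k) \<le> (1/2) ^ k"
  shows "Cauchy z"
proof -
  \<comment> \<open>Keeping the subtracted tail of the geometric series lets the induction close
    exactly; the bare bound \<open>2 * (1/2) ^ m\<close> is not inductive.\<close>
  have tele: "norm (z (m + j) - z m) \<le> 2 * (1/2) ^ m - 2 * (1/2) ^ (m + j)" for m j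
  proof (induction j)
    case (Suc j)
    have "norm (z (m + Suc j) - z m) \<le> norm (z (Suc (m + j)) - z (m + j)) + norm (z (m + j) - z m)"
      using norm_triangle_ineq[of "z (Suc (m + j)) - z (m + j)" "z (m + j) - z m"] by simp
    also have "\<dots> \<le> (1/2) ^ (m + j) + (2 * (1/2) ^ m - 2 * (1/2) ^ (m + j))"
      using assms[of "m + j"] Suc by linarith
    finally show ?case by simp
  qed simp
  show ?thesis
  proof (rule CauchyI')
    fix e :: real assume "e > 0"
    then obtain M where M: "(1/2::real) ^ M < e / 2"
      using real_arch_pow_inv[of "e/2" "1/2"] by auto
    have "dist (z m) (z n) < e" if "m \<ge> M" "n > m" for m n
    proof -
      have "dist (z m) (z n) \<le> 2 * (1/2) ^ m - 2 * (1/2) ^ n"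
        using tele[of m "n - m"] that by (simp add: dist_norm norm_minus_commute)
      also have "\<dots> \<le> 2 * (1/2) ^ m" by simp
      also have "\<dots> \<le> 2 * (1/2) ^ M"
        using power_decreasing[OF that(1), of "1/2::real"] by simp
      finally show ?thesis using M by linarith
    qed
    then show "\<exists>M. \<forall>m\<ge>M. \<forall>n>m. dist (z m) (z n) < e" by blast
  qed
qed

text \<open>Completeness of the space is replaced by the last two assumptions, which suffice for the
  convergence of the fixed point iteration; they hold for smoothing operators on \<open>Y\<close>.\<close>

locale simple_bifurcation =
  fixes G A B :: "'a::real_normed_vector \<Rightarrow> 'a" and c :: "'a \<Rightarrow> real" and v :: 'a and \<kappa>0 C r0 :: real
  assumes blA: "bounded_linear A" and blB: "bounded_linear B" and blc: "bounded_linear c"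
    and cv: "c v = 1" and Av: "A v = \<kappa>0 *\<^sub>R v" and \<kappa>0: "\<kappa>0 > 0"
    and cA: "\<And>u. c (A u) = \<kappa>0 * c u" and cB: "\<And>u. c (B u) = 0"
    and AB: "\<And>u. \<kappa>0 *\<^sub>R B u - A (B u) = u - c u *\<^sub>R v"
    and BA: "\<And>u. B (\<kappa>0 *\<^sub>R u - A u) = u - c u *\<^sub>R v"
    and G0: "G 0 = 0" and C: "C > 0" and r0: "r0 > 0"
    and GA: "\<And>u w. norm u \<le> r0 \<Longrightarrow> norm w \<le> r0 \<Longrightarrow>
       norm ((G u - A u) - (G w - A w)) \<le> C * (norm u + norm w) * norm (u - w)"
    and convA: "\<And>X. Cauchy X \<Longrightarrow> convergent (\<lambda>n. A (X n))"
    and convG: "\<And>X. Cauchy X \<Longrightarrow> convergent (\<lambda>n. G (X n))"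
begin

interpretation A: bounded_linear A by (rule blA)
interpretation B: bounded_linear B by (rule blB)
interpretation c: bounded_linear c by (rule blc)

text \<open>Roles of the locale parameters: \<open>c\<close> is the left eigenfunctional of
  \<open>A\<close> dual to \<open>v\<close>, and \<open>B\<close> is the reduced resolvent, which
  inverts \<open>\<kappa>0 - A\<close> modulo \<open>v\<close> with values in the kernel of
  \<open>c\<close>.\<close>

definition "R u = G u - A u"
definition "V = norm v + 1"
text \<open>As \<open>R\<close> is quadratic, this is of order t. Division by zero yields 0, which
  is the correct limit at t = 0.\<close>

definition "\<rho> t \<zeta> = (1 / t) *\<^sub>R R (t *\<^sub>R (v + \<zeta>))"
definition "F t \<zeta> = B (\<rho> t \<zeta>) - c (\<rho> t \<zeta>) *\<^sub>R B \<zeta>"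

lemma R0: "R 0 = 0" by (simp add: R_def G0 A.zero)

lemma R_lip: "norm u \<le> r0 \<Longrightarrow> norm w \<le> r0 \<Longrightarrow> norm (R u - R w) \<le> C * (norm u + norm w) * norm (u - w)"
  unfolding R_def by (rule GA)

lemma R_quad: "norm u \<le> r0 \<Longrightarrow> norm (R u) \<le> C * norm u * norm u"
  using R_lip[of u 0] R0 r0 by simp

text \<open>\<open>GA\<close> with \<open>w = 0\<close> bounds the remainder by the square of the
  norm.\<close>

lemma has_derivative_G: "(G has_derivative A) (at 0)"
  unfolding has_derivative_at
proof (intro conjI blA)
  have ev: "eventually (\<lambda>y::'a. norm y < r0) (at 0)"
    unfolding eventually_at using r0 by (intro exI[of _ r0]) (simp add: dist_norm)
  show "(\<lambda>h. norm (G (0 + h) - G 0 - A h) / norm h) \<midarrow>0\<rightarrow> 0"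
  proof (rule Lim_null_comparison[where g="\<lambda>y. C * norm y"])
    show "\<forall>\<^sub>F h in at 0. norm (norm (G (0 + h) - G 0 - A h) / norm h) \<le> C * norm h"
      using ev
    proof eventually_elim
      case (elim y)
      have "norm (G y - G 0 - A y) \<le> C * norm y * norm y"
        using R_quad[of y] elim by (simp add: R_def G0)
      then show ?case using C by (cases "y = 0") (simp_all add: divide_le_eq)
    qed
    show "((\<lambda>y::'a. C * norm y) \<longlongrightarrow> 0) (at 0)"
      by (rule tendsto_eq_intros refl | simp)+
  qed
qed

lemma frechet_G: "frechet_derivative G (at 0) = A"
  using has_derivative_G by (metis frechet_derivative_at)

text \<open>After multiplication by \<open>\<kappa>0\<close>, applying \<open>B\<close> turns the
  kernel equation into \<open>w = c w *\<^sub>R v\<close> through \<open>BA\<close>.\<close>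

lemma kernel: "{w. linearization G (1 / \<kappa>0) w = 0} = span {v}"
proof -
  have "w = c w *\<^sub>R v" if "w - (1 / \<kappa>0) *\<^sub>R A w = 0" for w
  proof -
    have "\<kappa>0 *\<^sub>R (w - (1 / \<kappa>0) *\<^sub>R A w) = \<kappa>0 *\<^sub>R w - A w"
      using \<kappa>0 by (simp add: scaleR_diff_right)
    with that have "\<kappa>0 *\<^sub>R w - A w = 0" by simp
    with BA[of w] show ?thesis by (simp add: B.zero)
  qed
  moreover have "k *\<^sub>R v - (1 / \<kappa>0) *\<^sub>R A (k *\<^sub>R v) = 0" for k
    using \<kappa>0 by (simp add: A.scaleR Av)
  ultimately show ?thesis
    unfolding linearization_def frechet_G span_singleton by blast
qed

text \<open>\<open>AB\<close> at \<open>v\<close> shows that \<open>\<kappa>0 - A\<close>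
  annihilates \<open>B v\<close>, while \<open>BA\<close> at \<open>B v\<close> recovers
  \<open>B v\<close> from that image because \<open>c\<close> vanishes on the range of
  \<open>B\<close>.\<close>

lemma Bv: "B v = 0"
proof -
  have "B (\<kappa>0 *\<^sub>R B v - A (B v)) = B v" using BA[of "B v"] by (simp add: cB)
  then show ?thesis using AB[of v] by (simp add: cv B.zero)
qed

lemma norm_v_\<zeta>: "norm \<zeta> \<le> 1 \<Longrightarrow> norm (v + \<zeta>) \<le> V"
  unfolding V_def using norm_triangle_ineq[of v \<zeta>] by linarith

lemma V: "V \<ge> 1" by (simp add: V_def)

lemma norm_arg:
  assumes "norm \<zeta> \<le> 1" "\<bar>t\<bar> * V \<le> r0" shows "norm (t *\<^sub>R (v + \<zeta>)) \<le> \<bar>t\<bar> * V" "norm (t *\<^sub>R (v + \<zeta>)) \<le> r0"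
proof -
  show "norm (t *\<^sub>R (v + \<zeta>)) \<le> \<bar>t\<bar> * V"
    using norm_v_\<zeta>[OF assms(1)] by (simp add: mult_left_mono)
  then show "norm (t *\<^sub>R (v + \<zeta>)) \<le> r0" using assms(2) by linarith
qed

lemma \<rho>_zero: "\<rho> 0 \<zeta> = 0" by (simp add: \<rho>_def)

lemma \<rho>_bound:
  assumes "norm \<zeta> \<le> 1" "\<bar>t\<bar> * V \<le> r0"
  shows "norm (\<rho> t \<zeta>) \<le> C * V\<^sup>2 * \<bar>t\<bar>"
proof (cases "t = 0")
  case False
  have "norm (R (t *\<^sub>R (v + \<zeta>))) \<le> C * (\<bar>t\<bar> * V) * (\<bar>t\<bar> * V)"
    using R_quad[OF norm_arg(2)[OF assms]] norm_arg(1)[OF assms] C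
    by (smt (verit, best) mult_mono norm_ge_zero mult_nonneg_nonneg)
  then show ?thesis using False by (simp add: \<rho>_def field_simps power2_eq_square abs_mult)
qed (simp add: \<rho>_zero)

lemma \<rho>_lip_\<zeta>:
  assumes "norm \<zeta> \<le> 1" "norm \<xi> \<le> 1" "\<bar>t\<bar> * V \<le> r0"
  shows "norm (\<rho> t \<zeta> - \<rho> t \<xi>) \<le> 2 * C * V * \<bar>t\<bar> * norm (\<zeta> - \<xi>)"
proof (cases "t = 0")
  case False
  let ?a = "t *\<^sub>R (v + \<zeta>)" and ?b = "t *\<^sub>R (v + \<xi>)"
  have n: "norm (?a - ?b) = \<bar>t\<bar> * norm (\<zeta> - \<xi>)"
    by (simp add: scaleR_diff_right[symmetric])
  have "norm (R ?a - R ?b) \<le> C * (norm ?a + norm ?b) * norm (?a - ?b)"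
    using norm_arg assms by (intro R_lip) auto
  also have "\<dots> \<le> C * (\<bar>t\<bar> * V + \<bar>t\<bar> * V) * norm (?a - ?b)"
    using norm_arg(1) assms C by (intro mult_right_mono mult_left_mono add_mono) auto
  finally have "norm (R ?a - R ?b) \<le> C * (\<bar>t\<bar> * V + \<bar>t\<bar> * V) * (\<bar>t\<bar> * norm (\<zeta> - \<xi>))"
    unfolding n .
  moreover have "norm (\<rho> t \<zeta> - \<rho> t \<xi>) = norm (R ?a - R ?b) / \<bar>t\<bar>"
    unfolding \<rho>_def scaleR_diff_right[symmetric] by simp
  ultimately have "norm (\<rho> t \<zeta> - \<rho> t \<xi>) \<le> C * (\<bar>t\<bar> * V + \<bar>t\<bar> * V) * (\<bar>t\<bar> * norm (\<zeta> - \<xi>)) / \<bar>t\<bar>"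
    using divide_right_mono[of _ _ "\<bar>t\<bar>"] by (metis abs_ge_zero)
  also have "\<dots> = 2 * C * V * \<bar>t\<bar> * norm (\<zeta> - \<xi>)" using False by (simp add: algebra_simps)
  finally show ?thesis .
qed (simp add: \<rho>_zero)

text \<open>The factor 1/t is harmless even near t = 0. With x = v + \<zeta>, the difference is
  (1/t) (R (t x) - R (s x)) + (1/t - 1/s) R (s x). If \<bar>s\<bar> \<le> \<bar>t\<bar>, the first
  term costs 2 C V^2 \<bar>t - s\<bar> by \<open>R_lip\<close> and the second C V^2 \<bar>t -
  s\<bar>, since R (s x) is of order s^2; hence the 3.\<close>

lemma \<rho>_lip_t:
  assumes "norm \<zeta> \<le> 1" "\<bar>t\<bar> * V \<le> r0" "\<bar>s\<bar> * V \<le> r0"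
  shows "norm (\<rho> t \<zeta> - \<rho> s \<zeta>) \<le> 3 * C * V\<^sup>2 * \<bar>t - s\<bar>"
proof -
  have main: "norm (\<rho> t \<zeta> - \<rho> s \<zeta>) \<le> 3 * C * V\<^sup>2 * \<bar>t - s\<bar>"
    if ts: "\<bar>s\<bar> \<le> \<bar>t\<bar>" "\<bar>t\<bar> * V \<le> r0" "\<bar>s\<bar> * V \<le> r0" for t s
  proof (cases "s = 0")
    case True
    have "C * V\<^sup>2 * \<bar>t\<bar> \<le> 3 * C * V\<^sup>2 * \<bar>t\<bar>" using C by (intro mult_right_mono) auto
    with \<rho>_bound[OF assms(1) ts(2)] have "norm (\<rho> t \<zeta>) \<le> 3 * C * V\<^sup>2 * \<bar>t\<bar>" by linarith
    with True show ?thesis by (simp add: \<rho>_zero)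
  next
    case s: False
    then have t: "t \<noteq> 0" using ts(1) by auto
    let ?x = "v + \<zeta>"
    have "norm (R (t *\<^sub>R ?x) - R (s *\<^sub>R ?x)) \<le> C * (norm (t *\<^sub>R ?x) + norm (s *\<^sub>R ?x)) * norm (t *\<^sub>R ?x - s *\<^sub>R ?x)"
      using norm_arg assms(1) ts by (intro R_lip) auto
    also have "\<dots> \<le> C * (\<bar>t\<bar> * V + \<bar>t\<bar> * V) * (\<bar>t - s\<bar> * V)"
    proof (intro mult_mono add_mono)
      show "norm (s *\<^sub>R ?x) \<le> \<bar>t\<bar> * V"
        using norm_arg(1)[OF assms(1) ts(3)] ts(1) V mult_right_mono[of "\<bar>s\<bar>" "\<bar>t\<bar>" V] by linarith
      show "norm (t *\<^sub>R ?x - s *\<^sub>R ?x) \<le> \<bar>t - s\<bar> * V"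
        unfolding scaleR_left_diff_distrib[symmetric] using norm_v_\<zeta>[OF assms(1)] by (simp add: mult_left_mono)
    qed (use norm_arg(1)[OF assms(1) ts(2)] C V in auto)
    finally have 1: "norm (R (t *\<^sub>R ?x) - R (s *\<^sub>R ?x)) / \<bar>t\<bar> \<le> 2 * C * V\<^sup>2 * \<bar>t - s\<bar>"
      using t by (simp add: field_simps power2_eq_square)
    have 2: "norm (R (s *\<^sub>R ?x)) \<le> C * V\<^sup>2 * s\<^sup>2"
      using \<rho>_bound[OF assms(1) ts(3)] s by (simp add: \<rho>_def field_simps power2_eq_square)
    have "\<bar>1 / t - 1 / s\<bar> = \<bar>t - s\<bar> / (\<bar>t\<bar> * \<bar>s\<bar>)"
      using s t by (simp add: divide_simps abs_mult abs_minus_commute)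
    also have "\<dots> \<le> \<bar>t - s\<bar> / (\<bar>s\<bar> * \<bar>s\<bar>)"
      using s ts(1) by (intro divide_left_mono mult_right_mono mult_pos_pos) auto
    finally have "norm (R (s *\<^sub>R ?x)) * \<bar>1 / t - 1 / s\<bar> \<le> (C * V\<^sup>2 * s\<^sup>2) * (\<bar>t - s\<bar> / (\<bar>s\<bar> * \<bar>s\<bar>))"
      using 2 C by (intro mult_mono) auto
    also have "\<dots> = C * V\<^sup>2 * \<bar>t - s\<bar>" using s by (simp add: power2_eq_square)
    finally have 3: "norm (R (s *\<^sub>R ?x)) * \<bar>1 / t - 1 / s\<bar> \<le> C * V\<^sup>2 * \<bar>t - s\<bar>" .
    have "\<rho> t \<zeta> - \<rho> s \<zeta> = (1 / t) *\<^sub>R (R (t *\<^sub>R ?x) - R (s *\<^sub>R ?x)) + (1 / t - 1 / s) *\<^sub>R R (s *\<^sub>R ?x)"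
      unfolding \<rho>_def by (simp add: scaleR_diff_right scaleR_diff_left)
    then have "norm (\<rho> t \<zeta> - \<rho> s \<zeta>) \<le> norm (R (t *\<^sub>R ?x) - R (s *\<^sub>R ?x)) / \<bar>t\<bar>
        + norm (R (s *\<^sub>R ?x)) * \<bar>1 / t - 1 / s\<bar>"
      using norm_triangle_ineq[of "(1 / t) *\<^sub>R (R (t *\<^sub>R ?x) - R (s *\<^sub>R ?x))" "(1 / t - 1 / s) *\<^sub>R R (s *\<^sub>R ?x)"]
      by (simp add: mult.commute)
    with 1 3 show ?thesis by linarith
  qed
  show ?thesis
  proof (cases "\<bar>s\<bar> \<le> \<bar>t\<bar>")
    case True then show ?thesis using main assms by blast
  next
    case False
    then show ?thesis using main[of t s] assms by (simp add: norm_minus_commute abs_minus_commute)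
  qed
qed

text \<open>Dividing the equation \<open>\<kappa> u = G u\<close> by \<open>t\<close> after substituting \<open>u = t (v + \<zeta>)\<close> with \<open>c \<zeta> = 0\<close>:
  the \<open>v\<close>-component fixes \<open>\<kappa>\<close> and the rest is the fixed point equation \<open>\<zeta> = F t \<zeta>\<close>.\<close>

lemma solution_iff:
  assumes "t \<noteq> 0" "c \<zeta> = 0"
  shows "\<kappa> *\<^sub>R (t *\<^sub>R (v + \<zeta>)) = G (t *\<^sub>R (v + \<zeta>)) \<longleftrightarrow> \<kappa> = \<kappa>0 + c (\<rho> t \<zeta>) \<and> \<zeta> = F t \<zeta>"
proof -
  have G: "G (t *\<^sub>R (v + \<zeta>)) = t *\<^sub>R (\<kappa>0 *\<^sub>R v + A \<zeta> + \<rho> t \<zeta>)"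
    using assms(1) by (simp add: \<rho>_def R_def A.scaleR A.add Av scaleR_add_right scaleR_diff_right)
  have eq: "\<kappa> *\<^sub>R (t *\<^sub>R (v + \<zeta>)) = G (t *\<^sub>R (v + \<zeta>)) \<longleftrightarrow> \<kappa> *\<^sub>R (v + \<zeta>) = \<kappa>0 *\<^sub>R v + A \<zeta> + \<rho> t \<zeta>"
    unfolding G scaleR_left_commute[of \<kappa> t] using assms(1) by (simp only: scaleR_cancel_left) simp
  show ?thesis
  proof
    assume "\<kappa> *\<^sub>R (t *\<^sub>R (v + \<zeta>)) = G (t *\<^sub>R (v + \<zeta>))"
    then have e: "\<kappa> *\<^sub>R (v + \<zeta>) = \<kappa>0 *\<^sub>R v + A \<zeta> + \<rho> t \<zeta>" by (rule eq[THEN iffD1])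
    from arg_cong[OF e, of c] have \<kappa>: "\<kappa> = \<kappa>0 + c (\<rho> t \<zeta>)"
      by (simp add: c.add c.scaleR cv cA assms(2))
    have "\<kappa>0 *\<^sub>R \<zeta> - A \<zeta> = \<rho> t \<zeta> - c (\<rho> t \<zeta>) *\<^sub>R (v + \<zeta>)"
      using e unfolding \<kappa> by (simp add: algebra_simps)
    \<comment> \<open>\<open>BA\<close> recovers \<zeta> from the left side because
      \<open>c \<zeta> = 0\<close>, and \<open>Bv\<close> removes the component along
      \<open>v\<close> on the right.\<close>
    from arg_cong[OF this, of B] have "\<zeta> = F t \<zeta>"
      unfolding BA F_def by (simp add: assms(2) B.diff B.scaleR B.add Bv)
    with \<kappa> show "\<kappa> = \<kappa>0 + c (\<rho> t \<zeta>) \<and> \<zeta> = F t \<zeta>" by blast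
  next
    assume *: "\<kappa> = \<kappa>0 + c (\<rho> t \<zeta>) \<and> \<zeta> = F t \<zeta>"
    \<comment> \<open>Conversely, apply \<open>\<kappa>0 - A\<close> to the fixed point equation:
      \<open>AB\<close> cancels each \<open>B\<close> up to a multiple of \<open>v\<close>.\<close>
    then have "\<kappa>0 *\<^sub>R \<zeta> - A \<zeta> = \<kappa>0 *\<^sub>R F t \<zeta> - A (F t \<zeta>)" by simp
    also have "\<dots> = (\<kappa>0 *\<^sub>R B (\<rho> t \<zeta>) - A (B (\<rho> t \<zeta>))) - c (\<rho> t \<zeta>) *\<^sub>R (\<kappa>0 *\<^sub>R B \<zeta> - A (B \<zeta>))"
      unfolding F_def by (simp add: A.diff A.scaleR algebra_simps)
    also have "\<dots> = \<rho> t \<zeta> - c (\<rho> t \<zeta>) *\<^sub>R (v + \<zeta>)"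
      unfolding AB by (simp add: assms(2) algebra_simps)
    finally have "\<kappa>0 *\<^sub>R \<zeta> - A \<zeta> = \<rho> t \<zeta> - c (\<rho> t \<zeta>) *\<^sub>R (v + \<zeta>)" .
    then show "\<kappa> *\<^sub>R (t *\<^sub>R (v + \<zeta>)) = G (t *\<^sub>R (v + \<zeta>))"
      unfolding eq using * by (simp add: algebra_simps)
  qed
qed

lemma cF: "c (F t \<zeta>) = 0" by (simp add: F_def c.diff c.scaleR cB)

text \<open>For small t the map \<open>F t\<close> contracts the unit ball, and its fixed point
  there gives the branch. It remains to see that every nontrivial solution near the bifurcation
  point has the blown-up form at all, that is, that its component off \<open>v\<close> is dominated
  by its \<open>v\<close>-coordinate.\<close>

theorem bifurcation: "two_solutions_bifurcate G (1 / \<kappa>0)"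
proof -
  obtain KB where KB: "KB > 0" "\<And>u. norm (B u) \<le> norm u * KB" using B.pos_bounded by blast
  obtain Kc where Kc: "Kc > 0" "\<And>u. norm (c u) \<le> norm u * Kc" using c.pos_bounded by blast
  \<comment> \<open>One constant for two purposes: the first summand bounds the Lipschitz constant
    of \<open>F t\<close> divided by \<bar>t\<bar>, the second the size of
    \<open>F t \<zeta>\<close> divided by \<bar>t\<bar>.\<close>
  define D where "D = KB * (2 * C * V + Kc * (2 * C * V) + Kc * (C * V\<^sup>2)) + KB * (C * V\<^sup>2) * (1 + Kc)"
  have D: "D > 0" unfolding D_def using KB(1) Kc(1) C V by (intro add_pos_pos mult_pos_pos) auto
  have F_bound: "norm (F t \<zeta>) \<le> D * \<bar>t\<bar>" if "norm \<zeta> \<le> 1" "\<bar>t\<bar> * V \<le> r0" for t \<zeta>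
  proof -
    let ?m = "C * V\<^sup>2 * \<bar>t\<bar>"
    have m0: "?m \<ge> 0" using C by simp
    have r: "norm (\<rho> t \<zeta>) \<le> ?m" by (rule \<rho>_bound[OF that])
    have "norm (F t \<zeta>) \<le> norm (B (\<rho> t \<zeta>)) + \<bar>c (\<rho> t \<zeta>)\<bar> * norm (B \<zeta>)"
      unfolding F_def using norm_triangle_ineq4[of "B (\<rho> t \<zeta>)" "c (\<rho> t \<zeta>) *\<^sub>R B \<zeta>"] by simp
    also have "\<dots> \<le> ?m * KB + (?m * Kc) * KB"
    proof (intro add_mono mult_mono)
      show "norm (B (\<rho> t \<zeta>)) \<le> ?m * KB" using KB(2)[of "\<rho> t \<zeta>"] mult_right_mono[OF r] KB(1) by (smt (verit))
      show "\<bar>c (\<rho> t \<zeta>)\<bar> \<le> ?m * Kc" using Kc(2)[of "\<rho> t \<zeta>"] mult_right_mono[OF r] Kc(1) by (smt (verit) real_norm_def)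
      show "norm (B \<zeta>) \<le> KB" using KB(2)[of \<zeta>] mult_right_mono[OF that(1)] KB(1) by (smt (verit))
    qed (use m0 Kc(1) in auto)
    also have "\<dots> = KB * (C * V\<^sup>2) * (1 + Kc) * \<bar>t\<bar>" by (simp add: algebra_simps)
    also have "\<dots> \<le> D * \<bar>t\<bar>"
      unfolding D_def using KB(1) Kc(1) C V by (intro mult_right_mono) auto
    finally show ?thesis .
  qed
  have F_diff: "norm (F t \<zeta> - F s \<xi>) \<le> KB * norm (\<rho> t \<zeta> - \<rho> s \<xi>) * (1 + Kc) + KB * Kc * norm (\<rho> s \<xi>) * norm (\<zeta> - \<xi>)"
    if "norm \<zeta> \<le> 1" for t \<zeta> s \<xi>
  proof -
    let ?d = "\<rho> t \<zeta> - \<rho> s \<xi>"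
    have "F t \<zeta> - F s \<xi> = B ?d - c ?d *\<^sub>R B \<zeta> - c (\<rho> s \<xi>) *\<^sub>R B (\<zeta> - \<xi>)"
      unfolding F_def by (simp add: B.diff c.diff algebra_simps)
    then have "norm (F t \<zeta> - F s \<xi>) \<le> norm (B ?d) + \<bar>c ?d\<bar> * norm (B \<zeta>) + \<bar>c (\<rho> s \<xi>)\<bar> * norm (B (\<zeta> - \<xi>))"
      using norm_triangle_ineq4[of "B ?d - c ?d *\<^sub>R B \<zeta>" "c (\<rho> s \<xi>) *\<^sub>R B (\<zeta> - \<xi>)"]
        norm_triangle_ineq4[of "B ?d" "c ?d *\<^sub>R B \<zeta>"] by simp
    also have "\<dots> \<le> norm ?d * KB + (norm ?d * Kc) * KB + (norm (\<rho> s \<xi>) * Kc) * (norm (\<zeta> - \<xi>) * KB)"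
    proof (intro add_mono mult_mono)
      show "norm (B \<zeta>) \<le> KB" using KB(2)[of \<zeta>] mult_right_mono[OF that] KB(1) by (smt (verit))
    qed (use KB Kc in \<open>auto simp: mult_nonneg_nonneg\<close>)
    finally show ?thesis by (simp add: algebra_simps)
  qed
  have F_contr: "norm (F t \<zeta> - F t \<xi>) \<le> D * \<bar>t\<bar> * norm (\<zeta> - \<xi>)"
    if "norm \<zeta> \<le> 1" "norm \<xi> \<le> 1" "\<bar>t\<bar> * V \<le> r0" for t \<zeta> \<xi>
  proof -
    let ?n = "norm (\<zeta> - \<xi>)"
    have "norm (F t \<zeta> - F t \<xi>) \<le> KB * (2 * C * V * \<bar>t\<bar> * ?n) * (1 + Kc) + KB * Kc * (C * V\<^sup>2 * \<bar>t\<bar>) * ?n"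
      by (rule order_trans[OF F_diff[OF that(1)]], intro add_mono mult_right_mono mult_left_mono \<rho>_lip_\<zeta> \<rho>_bound that)
         (use KB(1) Kc(1) in auto)
    also have "\<dots> = (KB * (2 * C * V + Kc * (2 * C * V) + Kc * (C * V\<^sup>2))) * \<bar>t\<bar> * ?n"
      by (simp add: algebra_simps)
    also have "\<dots> \<le> D * \<bar>t\<bar> * ?n"
      unfolding D_def using KB(1) Kc(1) C V by (intro mult_right_mono) auto
    finally show ?thesis .
  qed
  \<comment> \<open>\<open>\<eta>\<close> limits the distance of \<kappa> from
    \<open>\<kappa>0\<close>: half of \<open>\<kappa>0\<close> keeps \<kappa> positive, and
    \<open>\<eta> * KB \<le> 1/4\<close> lets the term with \<open>\<kappa>0 - k\<close> be absorbed
    below. \<open>\<epsilon>\<close> limits the norm of u so that the quadratic remainder is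
    absorbed with another factor 1/4.\<close>
  define \<eta> where "\<eta> = min (\<kappa>0 / 2) (1 / (4 * KB))"
  define \<epsilon> where "\<epsilon> = min r0 (1 / (4 * (KB * C * V)))"
  have \<eta>: "\<eta> > 0" "\<eta> \<le> \<kappa>0 / 2" "\<eta> * KB \<le> 1/4"
    unfolding \<eta>_def using \<kappa>0 KB(1) by (auto simp: min_def field_simps)
  have KCV: "KB * C * V > 0" using KB(1) C V by simp
  have \<epsilon>: "\<epsilon> > 0" "\<epsilon> \<le> r0" "KB * C * V * \<epsilon> \<le> 1/4"
  proof -
    have "KB * C * V * \<epsilon> \<le> KB * C * V * (1 / (4 * (KB * C * V)))"
      unfolding \<epsilon>_def using KCV by (intro mult_left_mono) auto
    also have "\<dots> = 1 / 4" using KCV KB(1) C V by (simp add: field_simps)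
    finally show "KB * C * V * \<epsilon> \<le> 1/4" .
  qed (use r0 KCV in \<open>auto simp: \<epsilon>_def\<close>)
  \<comment> \<open>The three entries ensure that t (v + \<zeta>) stays in the ball of radius
    \<open>\<epsilon>\<close>, that \<open>F t\<close> contracts with factor 1/2 into the ball of
    radius 1/2, and that the shift of \<kappa> is below \<open>\<eta>\<close>.\<close>
  define \<delta> where "\<delta> = Min {\<epsilon> / V, 1 / (2 * D), \<eta> / (2 * (Kc * (C * V\<^sup>2)))}"
  have KcCV: "Kc * (C * V\<^sup>2) > 0" using Kc(1) C V by simp
  have \<delta>: "\<delta> > 0" unfolding \<delta>_def using \<epsilon> V D \<eta> KcCV by auto
  have small: "\<bar>t\<bar> * V < \<epsilon>" "\<bar>t\<bar> * V \<le> r0" "D * \<bar>t\<bar> \<le> 1/2" "Kc * (C * V\<^sup>2) * \<bar>t\<bar> < \<eta>" if "\<bar>t\<bar> < \<delta>" for t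
  proof -
    have d: "\<delta> \<le> \<epsilon> / V" "\<delta> \<le> 1 / (2 * D)" "\<delta> \<le> \<eta> / (2 * (Kc * (C * V\<^sup>2)))" unfolding \<delta>_def by auto
    have "\<bar>t\<bar> < \<epsilon> / V" using d(1) that by linarith
    then show "\<bar>t\<bar> * V < \<epsilon>" using V by (simp add: pos_less_divide_eq)
    then show "\<bar>t\<bar> * V \<le> r0" using \<epsilon>(2) by linarith
    have "\<bar>t\<bar> < 1 / (2 * D)" using d(2) that by linarith
    then show "D * \<bar>t\<bar> \<le> 1/2" using D by (simp add: pos_less_divide_eq mult_ac)
    have "\<bar>t\<bar> < \<eta> / (2 * (Kc * (C * V\<^sup>2)))" using d(3) that by linarith
    then have "\<bar>t\<bar> * (2 * (Kc * (C * V\<^sup>2))) < \<eta>" using KcCV by (subst (asm) pos_less_divide_eq) auto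
    moreover have "0 \<le> Kc * (C * V\<^sup>2) * \<bar>t\<bar>" using KcCV by simp
    ultimately show "Kc * (C * V\<^sup>2) * \<bar>t\<bar> < \<eta>" by (simp add: mult_ac)
  qed
  have c\<rho>: "\<bar>c (\<rho> t \<zeta>)\<bar> < \<eta>" if "\<bar>t\<bar> < \<delta>" "norm \<zeta> \<le> 1" for t \<zeta>
  proof -
    have "\<bar>c (\<rho> t \<zeta>)\<bar> \<le> (C * V\<^sup>2 * \<bar>t\<bar>) * Kc"
      using Kc(2)[of "\<rho> t \<zeta>"] mult_right_mono[OF \<rho>_bound[OF that(2) small(2)[OF that(1)]], of Kc] Kc(1)
      by (smt (verit) real_norm_def)
    with small(4)[OF that(1)] show ?thesis by (simp add: mult_ac)
  qed
  have half: "norm (F t \<zeta> - F t \<xi>) \<le> 1/2 * norm (\<zeta> - \<xi>)"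
    if "\<bar>t\<bar> < \<delta>" "norm \<zeta> \<le> 1" "norm \<xi> \<le> 1" for t \<zeta> \<xi>
    using F_contr[OF that(2,3) small(2)[OF that(1)]] mult_right_mono[OF small(3)[OF that(1)] norm_ge_zero[of "\<zeta> - \<xi>"]]
    by linarith
  have ex: "\<exists>\<zeta>. norm \<zeta> \<le> 1 \<and> \<zeta> = F t \<zeta>" if t: "\<bar>t\<bar> < \<delta>" for t
  proof -
    define z where "z k = (F t ^^ k) 0" for k
    have zS: "z (Suc k) = F t (z k)" for k by (simp add: z_def)
    have zn: "norm (z k) \<le> 1/2" for k
    proof (induction k)
      case (Suc k)
      then have "norm (z (Suc k)) \<le> D * \<bar>t\<bar>" unfolding zS by (intro F_bound small t) auto
      then show ?case using small(3)[OF t] by linarith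
    qed (simp add: z_def)
    then have zn1: "norm (z k) \<le> 1" for k by (rule order_trans) simp
    have step: "norm (z (Suc k) - z k) \<le> (1/2) ^ k" for k
    proof (induction k)
      case 0
      then show ?case using zn1[of 1] by (simp add: z_def)
    next
      case (Suc k)
      have "norm (F t (z (Suc k)) - F t (z k)) \<le> 1/2 * norm (z (Suc k) - z k)" by (intro half t zn1)
      then show ?case using Suc by (simp add: zS)
    qed
    then have Cz: "Cauchy z" by (rule Cauchy_geometric_half)
    have cz: "c (z k) = 0" for k by (cases k) (simp_all add: zS cF, simp add: z_def c.zero)
    have Ct: "Cauchy (\<lambda>k. t *\<^sub>R (v + z k))"
      using bounded_linear.Cauchy[OF bounded_linear_scaleR_right Cz, of t] by (simp add: Cauchy_iff algebra_simps)
    obtain a where a: "(\<lambda>k. A (z k)) \<longlonglongrightarrow> a" using convA[OF Cz] unfolding convergent_def by blast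
    obtain a' where a': "(\<lambda>k. A (t *\<^sub>R (v + z k))) \<longlonglongrightarrow> a'" using convA[OF Ct] unfolding convergent_def by blast
    obtain g where g: "(\<lambda>k. G (t *\<^sub>R (v + z k))) \<longlonglongrightarrow> g" using convG[OF Ct] unfolding convergent_def by blast
    define r where "r = (1 / t) *\<^sub>R (g - a')"
    have r: "(\<lambda>k. \<rho> t (z k)) \<longlonglongrightarrow> r"
      unfolding \<rho>_def R_def r_def by (intro tendsto_intros a' g)
    have cr: "(\<lambda>k. c (\<rho> t (z k))) \<longlonglongrightarrow> c r" by (rule c.tendsto[OF r])
    have "\<bar>c r\<bar> \<le> \<eta>"
      by (rule tendsto_upperbound[OF tendsto_rabs[OF cr]]) (use c\<rho>[OF t zn1] in \<open>auto intro!: always_eventually less_imp_le\<close>)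
    then have pos: "\<kappa>0 + c r > 0" using \<eta> \<kappa>0 by linarith
    \<comment> \<open>Replacement for completeness: apply \<open>\<kappa>0 - A\<close> to the
      iteration and solve for \<open>z k\<close>. On the right, the \<open>A\<close> term converges
      by \<open>convA\<close>, the \<open>\<rho>\<close> terms by \<open>convA\<close> and
      \<open>convG\<close>, and the increment tends to 0; the scalar on the left stays away from 0,
      so the iterates converge.\<close>
    have eq: "(\<kappa>0 + c (\<rho> t (z k))) *\<^sub>R z k = A (z (Suc k)) + (\<rho> t (z k) - c (\<rho> t (z k)) *\<^sub>R v) - \<kappa>0 *\<^sub>R (z (Suc k) - z k)" for k
    proof -
      have "\<kappa>0 *\<^sub>R z (Suc k) - A (z (Suc k)) = (\<kappa>0 *\<^sub>R B (\<rho> t (z k)) - A (B (\<rho> t (z k)))) - c (\<rho> t (z k)) *\<^sub>R (\<kappa>0 *\<^sub>R B (z k) - A (B (z k)))"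
        unfolding zS F_def by (simp add: A.diff A.scaleR algebra_simps)
      also have "\<dots> = \<rho> t (z k) - c (\<rho> t (z k)) *\<^sub>R (v + z k)"
        unfolding AB by (simp add: cz algebra_simps)
      finally show ?thesis by (simp add: algebra_simps)
    qed
    have d0: "(\<lambda>k. z (Suc k) - z k) \<longlonglongrightarrow> 0"
      by (rule Lim_null_comparison[where g="\<lambda>k. (1/2)^k"]) (use step in \<open>auto intro: LIMSEQ_power_zero\<close>)
    have lim: "(\<lambda>k. (\<kappa>0 + c (\<rho> t (z k))) *\<^sub>R z k) \<longlonglongrightarrow> a + (r - c r *\<^sub>R v) - \<kappa>0 *\<^sub>R 0"
      unfolding eq by (intro tendsto_intros r cr d0 LIMSEQ_Suc[OF a])
    define \<zeta> where "\<zeta> = (1 / (\<kappa>0 + c r)) *\<^sub>R (a + (r - c r *\<^sub>R v) - \<kappa>0 *\<^sub>R 0)"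
    have "(\<lambda>k. (1 / (\<kappa>0 + c (\<rho> t (z k)))) *\<^sub>R ((\<kappa>0 + c (\<rho> t (z k))) *\<^sub>R z k)) \<longlonglongrightarrow> \<zeta>"
      unfolding \<zeta>_def using pos by (intro tendsto_intros lim cr) auto
    moreover have "\<kappa>0 + c (\<rho> t (z k)) \<noteq> 0" for k
      using c\<rho>[OF t zn1[of k]] \<eta>(2) \<kappa>0 by linarith
    ultimately have z\<zeta>: "z \<longlonglongrightarrow> \<zeta>" by simp
    have \<zeta>1: "norm \<zeta> \<le> 1"
      by (rule tendsto_upperbound[OF tendsto_norm[OF z\<zeta>]]) (use zn1 in auto)
    have "(\<lambda>k. F t (z k) - F t \<zeta>) \<longlonglongrightarrow> 0"
    proof (rule Lim_null_comparison[where g="\<lambda>k. 1/2 * norm (z k - \<zeta>)"])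
      show "\<forall>\<^sub>F k in sequentially. norm (F t (z k) - F t \<zeta>) \<le> 1/2 * norm (z k - \<zeta>)"
        by (intro always_eventually allI half t zn1 \<zeta>1)
      show "(\<lambda>k. 1/2 * norm (z k - \<zeta>)) \<longlonglongrightarrow> 0"
        by (rule tendsto_eq_intros z\<zeta> refl | simp)+
    qed
    then have "(\<lambda>k. z (Suc k)) \<longlonglongrightarrow> F t \<zeta>" unfolding zS by (simp add: LIM_zero_iff)
    with LIMSEQ_Suc[OF z\<zeta>] have "\<zeta> = F t \<zeta>" by (rule LIMSEQ_unique)
    with \<zeta>1 show ?thesis by blast
  qed
  define z where "z t = (SOME \<zeta>. norm \<zeta> \<le> 1 \<and> \<zeta> = F t \<zeta>)" for t
  have z: "norm (z t) \<le> 1" "z t = F t (z t)" if "\<bar>t\<bar> < \<delta>" for t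
    using someI_ex[OF ex[OF that]] unfolding z_def[symmetric] by blast+
  have uniq: "\<zeta> = z t" if "\<bar>t\<bar> < \<delta>" "norm \<zeta> \<le> 1" "\<zeta> = F t \<zeta>" for t \<zeta>
    using half[OF that(1,2) z(1)[OF that(1)]] z(2)[OF that(1)] that(3) by simp
  have cz: "c (z t) = 0" if "\<bar>t\<bar> < \<delta>" for t using cF[of t "z t"] z(2)[OF that] by simp
  have z0: "z 0 = 0"
    using z(2)[of 0] \<delta> by (simp add: F_def \<rho>_zero B.zero c.zero)
  define \<kappa> where "\<kappa> t = \<kappa>0 + c (\<rho> t (z t))" for t
  have \<kappa>\<eta>: "\<bar>\<kappa> t - \<kappa>0\<bar> < \<eta>" if "\<bar>t\<bar> < \<delta>" for t
    using c\<rho>[OF that z(1)[OF that]] by (simp add: \<kappa>_def)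
  have \<kappa>pos: "\<kappa> t > 0" if "\<bar>t\<bar> < \<delta>" for t using \<kappa>\<eta>[OF that] \<eta>(2) \<kappa>0 by linarith
  define \<mu> where "\<mu> t = 1 / \<kappa> t - 1 / \<kappa>0" for t
  let ?I = "{-\<delta><..<\<delta>}"
  have I: "t \<in> ?I \<longleftrightarrow> \<bar>t\<bar> < \<delta>" for t by auto
  define W where "W = C * V\<^sup>2"
  have Wp: "W > 0" using C V by (simp add: W_def)
  \<comment> \<open>The contraction factor 1/2 bounds the distance of the fixed points by twice the
    variation of \<open>F\<close> in t at a fixed argument.\<close>
  have zlip: "norm (z t - z s) \<le> 2 * (KB * (3 * W * \<bar>t - s\<bar>) * (1 + Kc))" if "\<bar>t\<bar> < \<delta>" "\<bar>s\<bar> < \<delta>" for t s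
  proof -
    have "norm (z t - z s) \<le> norm (F t (z t) - F t (z s)) + norm (F t (z s) - F s (z s))"
      using norm_triangle_ineq[of "F t (z t) - F t (z s)" "F t (z s) - F s (z s)"] z(2) that by simp
    moreover have "norm (F t (z t) - F t (z s)) \<le> 1/2 * norm (z t - z s)"
      by (intro half z that)
    moreover have "norm (F t (z s) - F s (z s)) \<le> KB * norm (\<rho> t (z s) - \<rho> s (z s)) * (1 + Kc)"
      using F_diff[OF z(1)[OF that(2)], of t s "z s"] by simp
    moreover have "KB * norm (\<rho> t (z s) - \<rho> s (z s)) * (1 + Kc) \<le> KB * (3 * C * V\<^sup>2 * \<bar>t - s\<bar>) * (1 + Kc)"
      by (intro mult_right_mono mult_left_mono \<rho>_lip_t z small that) (use KB(1) Kc(1) in auto)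
    ultimately show ?thesis unfolding W_def by (simp add: mult.assoc)
  qed
  have zcont: "continuous_on ?I z"
    unfolding continuous_on_def
  proof
    fix s assume s: "s \<in> ?I"
    show "(z \<longlongrightarrow> z s) (at s within ?I)"
      unfolding Lim_null[of z]
    proof (rule Lim_null_comparison[where g="\<lambda>t. 2 * (KB * (3 * W * \<bar>t - s\<bar>) * (1 + Kc))"])
      show "\<forall>\<^sub>F t in at s within ?I. norm (z t - z s) \<le> 2 * (KB * (3 * W * \<bar>t - s\<bar>) * (1 + Kc))"
        unfolding eventually_at_filter using s zlip by (auto simp: I intro!: always_eventually)
      show "((\<lambda>t. 2 * (KB * (3 * W * \<bar>t - s\<bar>) * (1 + Kc))) \<longlongrightarrow> 0) (at s within ?I)"
        by (rule tendsto_eq_intros refl | simp)+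
    qed
  qed
  have rcont: "continuous_on ?I (\<lambda>t. \<rho> t (z t))"
    unfolding continuous_on_def
  proof
    fix s assume s: "s \<in> ?I"
    have zs: "(z \<longlongrightarrow> z s) (at s within ?I)" using zcont s unfolding continuous_on_def by blast
    show "((\<lambda>t. \<rho> t (z t)) \<longlongrightarrow> \<rho> s (z s)) (at s within ?I)"
      unfolding Lim_null[of "\<lambda>t. \<rho> t (z t)"]
    proof (rule Lim_null_comparison[where g="\<lambda>t. 2 * C * V * \<bar>t\<bar> * norm (z t - z s) + 3 * C * V\<^sup>2 * \<bar>t - s\<bar>"])
      have "norm (\<rho> t (z t) - \<rho> s (z s)) \<le> 2 * C * V * \<bar>t\<bar> * norm (z t - z s) + 3 * C * V\<^sup>2 * \<bar>t - s\<bar>"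
        if t: "t \<in> ?I" for t
      proof -
        have "norm (\<rho> t (z t) - \<rho> s (z s)) \<le> norm (\<rho> t (z t) - \<rho> t (z s)) + norm (\<rho> t (z s) - \<rho> s (z s))"
          using norm_triangle_ineq[of "\<rho> t (z t) - \<rho> t (z s)" "\<rho> t (z s) - \<rho> s (z s)"] by simp
        also have "\<dots> \<le> 2 * C * V * \<bar>t\<bar> * norm (z t - z s) + 3 * C * V\<^sup>2 * \<bar>t - s\<bar>"
          using s t unfolding I by (intro add_mono \<rho>_lip_\<zeta> \<rho>_lip_t z small)
        finally show ?thesis .
      qed
      then show "\<forall>\<^sub>F t in at s within ?I. norm (\<rho> t (z t) - \<rho> s (z s)) \<le> 2 * C * V * \<bar>t\<bar> * norm (z t - z s) + 3 * C * V\<^sup>2 * \<bar>t - s\<bar>"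
        unfolding eventually_at_filter by (intro always_eventually) blast
      show "((\<lambda>t. 2 * C * V * \<bar>t\<bar> * norm (z t - z s) + 3 * C * V\<^sup>2 * \<bar>t - s\<bar>) \<longlongrightarrow> 0) (at s within ?I)"
        by (rule tendsto_eq_intros refl zs | simp)+
    qed
  qed
  have \<mu>cont: "continuous_on ?I \<mu>"
    unfolding \<mu>_def \<kappa>_def
    by (intro continuous_intros c.continuous_on rcont) (use \<kappa>pos in \<open>auto simp: \<kappa>_def I less_imp_neq[symmetric]\<close>, use \<kappa>0 in auto)
  have \<mu>0: "\<mu> 0 = 0" by (simp add: \<mu>_def \<kappa>_def \<rho>_zero c.zero)
  let ?Z = "{u. c u = 0}"
  have Z: "closed_complement ?Z (span {v})"
    unfolding closed_complement_def
  proof (intro conjI allI)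
    show "subspace ?Z" by (auto simp: subspace_def c.zero c.add c.scaleR)
    show "closed ?Z" by (intro closed_Collect_eq continuous_intros c.continuous_on)
    show "?Z \<inter> span {v} = {0}" by (auto simp: span_singleton c.scaleR cv c.zero)
    show "\<exists>a\<in>span {v}. \<exists>z\<in>?Z. u = a + z" for u
      by (intro bexI[of _ "c u *\<^sub>R v"] bexI[of _ "u - c u *\<^sub>R v"]) (auto simp: c.diff c.scaleR cv span_singleton)
  qed
  \<comment> \<open>The parameter interval is the reciprocal image of the
    \<open>\<eta>\<close>-neighbourhood of \<open>\<kappa>0\<close>. Since \<open>c\<close> takes
    the value t on the branch point with parameter t, the condition on \<open>c u\<close> cuts out
    exactly \<bar>t\<bar> < \<open>\<delta>\<close>; a norm ball alone would not give the stated
    equality of sets.\<close>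
  define U where "U = {1 / (\<kappa>0 + \<eta>) <..< 1 / (\<kappa>0 - \<eta>)} \<times> {u. norm u < \<epsilon> \<and> \<bar>c u\<bar> < \<delta>}"
  have int: "1 / k \<in> {1 / (\<kappa>0 + \<eta>) <..< 1 / (\<kappa>0 - \<eta>)} \<longleftrightarrow> \<bar>k - \<kappa>0\<bar> < \<eta>" if "k > 0" for k
    using that \<eta> \<kappa>0 by (auto simp: divide_simps abs_less_iff)
  have lpos: "l > 0" if "l \<in> {1 / (\<kappa>0 + \<eta>) <..< 1 / (\<kappa>0 - \<eta>)}" for l
  proof -
    have "1 / (\<kappa>0 + \<eta>) > 0" using \<kappa>0 \<eta>(1) by simp
    then show ?thesis using that unfolding greaterThanLessThan_iff by linarith
  qed
  have "{u. norm u < \<epsilon> \<and> \<bar>c u\<bar> < \<delta>} = {u. norm u < \<epsilon>} \<inter> {u. \<bar>c u\<bar> < \<delta>}" by blast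
  then have oU: "open U"
    unfolding U_def by (auto intro!: open_Times open_Int open_Collect_less continuous_intros c.continuous_on)
  have inU: "(1 / \<kappa>0, 0) \<in> U"
    unfolding U_def using int[OF \<kappa>0] \<eta>(1) \<epsilon>(1) \<delta> by (simp add: c.zero)
  have "{(l, u). (l, u) \<in> U \<and> u \<noteq> 0 \<and> u - l *\<^sub>R G u = 0}
      = {(1 / \<kappa>0 + \<mu> t, t *\<^sub>R v + t *\<^sub>R z t) | t. 0 < \<bar>t\<bar> \<and> \<bar>t\<bar> < \<delta>}" (is "?S = ?T")
  proof (intro equalityI subsetI)
    fix p assume "p \<in> ?S"
    then obtain l u where p: "p = (l, u)" "(l, u) \<in> U" "u \<noteq> 0" "u - l *\<^sub>R G u = 0" by auto
    define k where "k = 1 / l"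
    have l: "l > 0" using p(2) lpos unfolding U_def by blast
    then have k: "k > 0" "l = 1 / k" by (auto simp: k_def)
    have k\<eta>: "\<bar>k - \<kappa>0\<bar> < \<eta>" using p(2) int[OF k(1)] unfolding U_def k(2) by blast
    have u: "norm u < \<epsilon>" "\<bar>c u\<bar> < \<delta>" using p(2) unfolding U_def by auto
    have eq: "k *\<^sub>R u = G u"
    proof -
      have "k *\<^sub>R u = k *\<^sub>R (l *\<^sub>R G u)" using p(4) by simp
      then show ?thesis using k by simp
    qed
    \<comment> \<open>The equation for \<open>y\<close> is obtained with \<open>B\<close>. Absorbing
      the remainder and the parameter shift gives \<open>norm y \<le> 1/2 * \<bar>s\<bar>\<close>.
      Thus \<open>s\<close> is nonzero for a nontrivial solution, and \<open>y / s\<close> lies in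
      the unit ball, where the fixed point is unique.\<close>
    define s y where "s = c u" and "y = u - c u *\<^sub>R v"
    have "\<kappa>0 *\<^sub>R u - A u = R u + (\<kappa>0 - k) *\<^sub>R u"
      unfolding R_def eq[symmetric] by (simp add: algebra_simps)
    from arg_cong[OF this, of B] have "y = B (R u) + (\<kappa>0 - k) *\<^sub>R B u"
      unfolding BA y_def by (simp add: B.add B.scaleR)
    moreover have "B u = B y" unfolding y_def by (simp add: B.diff B.scaleR Bv)
    ultimately have yeq: "y = B (R u) + (\<kappa>0 - k) *\<^sub>R B y" by simp
    have usy: "u = s *\<^sub>R v + y" by (simp add: s_def y_def)
    have un: "norm u \<le> \<bar>s\<bar> * norm v + norm y"
      unfolding usy by (metis norm_triangle_ineq norm_scaleR)
    have "norm y \<le> norm (B (R u)) + \<bar>\<kappa>0 - k\<bar> * norm (B y)"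
      using norm_triangle_ineq[of "B (R u)" "(\<kappa>0 - k) *\<^sub>R B y"] yeq by simp
    also have "\<dots> \<le> (C * norm u * norm u) * KB + \<eta> * (norm y * KB)"
    proof (intro add_mono mult_mono)
      have "norm (R u) * KB \<le> (C * norm u * norm u) * KB"
        using u(1) \<epsilon>(2) KB(1) by (intro mult_right_mono R_quad) auto
      then show "norm (B (R u)) \<le> (C * norm u * norm u) * KB" using KB(2)[of "R u"] by linarith
    qed (use k\<eta> KB(2)[of y] \<eta>(1) in auto)
    also have "\<eta> * (norm y * KB) \<le> 1/4 * norm y"
      using mult_right_mono[OF \<eta>(3) norm_ge_zero[of y]] by (simp add: mult_ac)
    also have "(C * norm u * norm u) * KB \<le> (C * \<epsilon> * norm u) * KB"
      using u(1) C KB(1) by (intro mult_right_mono mult_left_mono) auto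
    also have "\<dots> \<le> (C * \<epsilon> * ((\<bar>s\<bar> + norm y) * V)) * KB"
    proof (intro mult_right_mono mult_left_mono)
      have "\<bar>s\<bar> * norm v \<le> \<bar>s\<bar> * V" "norm y * 1 \<le> norm y * V"
        using V by (intro mult_left_mono; simp add: V_def)+
      then show "norm u \<le> (\<bar>s\<bar> + norm y) * V" using un by (simp add: algebra_simps)
    qed (use C \<epsilon> KB(1) in auto)
    also have "\<dots> = (KB * C * V * \<epsilon>) * (\<bar>s\<bar> + norm y)" by (simp add: mult_ac)
    also have "\<dots> \<le> 1/4 * (\<bar>s\<bar> + norm y)" using \<epsilon>(3) by (intro mult_right_mono) auto
    finally have "norm y \<le> 1/4 * (\<bar>s\<bar> + norm y) + 1/4 * norm y" by simp
    then have ys: "norm y \<le> 1/2 * \<bar>s\<bar>" by (simp add: field_simps)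
    have s: "s \<noteq> 0"
    proof
      assume "s = 0" then have "y = 0" using ys by simp
      with usy \<open>s = 0\<close> p(3) show False by simp
    qed
    define \<zeta> where "\<zeta> = (1 / s) *\<^sub>R y"
    have \<zeta>: "norm \<zeta> \<le> 1" using ys s by (simp add: \<zeta>_def divide_le_eq)
    have c\<zeta>: "c \<zeta> = 0" by (simp add: \<zeta>_def y_def c.scaleR c.diff cv)
    have u\<zeta>: "u = s *\<^sub>R (v + \<zeta>)" unfolding \<zeta>_def using s usy by (simp add: scaleR_add_right)
    have sd: "\<bar>s\<bar> < \<delta>" using u(2) by (simp add: s_def)
    have sol: "k = \<kappa>0 + c (\<rho> s \<zeta>)" "\<zeta> = F s \<zeta>"
      using eq solution_iff[OF s c\<zeta>, of k] unfolding u\<zeta> by blast+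
    have "\<zeta> = z s" by (rule uniq[OF sd \<zeta> sol(2)])
    with sol(1) have "k = \<kappa> s" by (simp add: \<kappa>_def)
    then have "l = 1 / \<kappa>0 + \<mu> s" using k(2) by (simp add: \<mu>_def)
    moreover have "u = s *\<^sub>R v + s *\<^sub>R z s" using u\<zeta> \<open>\<zeta> = z s\<close> by (simp add: scaleR_add_right)
    ultimately show "p \<in> ?T" using p(1) s sd by auto
  next
    fix p assume "p \<in> ?T"
    then obtain t where p: "p = (1 / \<kappa>0 + \<mu> t, t *\<^sub>R v + t *\<^sub>R z t)" and t: "t \<noteq> 0" "\<bar>t\<bar> < \<delta>" by auto
    have p': "p = (1 / \<kappa> t, t *\<^sub>R (v + z t))" using p by (simp add: \<mu>_def scaleR_add_right)
    have cu: "c (t *\<^sub>R (v + z t)) = t" by (simp add: c.scaleR c.add cv cz[OF t(2)])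
    have "t *\<^sub>R (v + z t) \<noteq> 0"
    proof
      assume "t *\<^sub>R (v + z t) = 0"
      then show False using cu t(1) c.zero by simp
    qed
    moreover have "(1 / \<kappa> t, t *\<^sub>R (v + z t)) \<in> U"
      unfolding U_def mem_Times_iff fst_conv snd_conv mem_Collect_eq cu
      using int[OF \<kappa>pos[OF t(2)]] \<kappa>\<eta>[OF t(2)] t(2) norm_arg(1)[OF z(1)[OF t(2)] small(2)[OF t(2)]] small(1)[OF t(2)]
      by auto
    moreover have "\<kappa> t *\<^sub>R (t *\<^sub>R (v + z t)) = G (t *\<^sub>R (v + z t))"
      using solution_iff[OF t(1) cz[OF t(2)], of "\<kappa> t"] z(2)[OF t(2)] by (simp add: \<kappa>_def)
    then have "(1 / \<kappa> t) *\<^sub>R (\<kappa> t *\<^sub>R (t *\<^sub>R (v + z t))) = (1 / \<kappa> t) *\<^sub>R G (t *\<^sub>R (v + z t))" by (rule arg_cong)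
    then have "t *\<^sub>R (v + z t) - (1 / \<kappa> t) *\<^sub>R G (t *\<^sub>R (v + z t)) = 0" using \<kappa>pos[OF t(2)] by simp
    ultimately show "p \<in> ?S" unfolding p' by blast
  qed
  then show ?thesis
    unfolding two_solutions_bifurcate_def
    using Z \<delta> \<mu>cont zcont cz z0 \<mu>0 oU inU kernel cv c.zero
    by (intro exI[of _ v] conjI exI[of _ ?Z] exI[of _ \<delta>] exI[of _ \<mu>] exI[of _ z] exI[of _ U]) (auto simp: I)
qed

end

section \<open>Square integrable functions\<close>

lemma L2D: "f \<in> L2 \<Longrightarrow> integrable leb2pi (\<lambda>x. (f x)\<^sup>2)"
  by (simp add: L2_def)

lemma L2_diff: "u \<in> L2 \<Longrightarrow> v \<in> L2 \<Longrightarrow> (\<lambda>x. u x - v x) \<in> L2"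
  using L2_add[OF _ L2_scale[of v "-1"]] by simp

lemma L2_const: "(\<lambda>_. a) \<in> L2"
  by (rule bounded_meas_L2[of _ "\<bar>a\<bar>"]) simp_all

lemma L2_abs: "f \<in> L2 \<Longrightarrow> (\<lambda>x. \<bar>f x\<bar>) \<in> L2"
  by (auto simp: L2_def)

lemma L2_sum: "(\<And>i. i \<in> I \<Longrightarrow> f i \<in> L2) \<Longrightarrow> (\<lambda>x. \<Sum>i\<in>I. f i x) \<in> L2"
  by (induction I rule: infinite_finite_induct) (auto intro: L2_add L2_const[of 0])

lemma continuous_L2:
  assumes "continuous_on UNIV f" shows "f \<in> L2"
proof -
  have "continuous_on {0..2*pi} (\<lambda>x. (f x)\<^sup>2)"
    by (intro continuous_intros continuous_on_subset[OF assms]) simp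
  then show ?thesis
    unfolding L2_def using continuous_leb2pi_measurable[OF assms] continuous_imp_integrable_real by blast
qed

lemma AE_bounded_L2:
  assumes "f \<in> borel_measurable leb2pi" "AE x in leb2pi. \<bar>f x\<bar> \<le> M" shows "f \<in> L2"
proof -
  interpret finite_measure leb2pi by (rule finite_measure_leb2pi)
  have "integrable leb2pi (\<lambda>x. (f x)\<^sup>2)"
  proof (rule integrable_const_bound)
    show "AE x in leb2pi. norm ((f x)\<^sup>2) \<le> M\<^sup>2"
      using assms(2)
    proof eventually_elim
      case (elim x)
      then show ?case using power_mono[OF elim abs_ge_zero, of 2] by simp
    qed
  qed (intro borel_measurable_power assms)
  with assms(1) show ?thesis by (simp add: L2_def)
qed

lemma LINT_const: "(\<integral>x. (a::real) \<partial>leb2pi) = 2 * pi * a"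
  by (simp add: measure_restrict_space)

lemma LINT_FTC:
  fixes f F :: "real \<Rightarrow> real"
  assumes "\<And>x. (F has_real_derivative f x) (at x)" "continuous_on UNIV f"
  shows "(\<integral>x. f x \<partial>leb2pi) = F (2*pi) - F 0"
proof -
  have "integrable leb2pi f"
    by (intro continuous_imp_integrable_real continuous_on_subset[OF assms(2)]) simp
  then have "(\<integral>x. f x \<partial>leb2pi) = integral {0..2*pi} f"
    by (rule lebesgue_integral_eq_integral) simp
  moreover have "(f has_integral F (2*pi) - F 0) {0..2*pi}"
    by (rule fundamental_theorem_of_calculus)
       (auto intro: has_field_derivative_at_within assms(1)
             simp flip: has_real_derivative_iff_has_vector_derivative)
  ultimately show ?thesis by (simp add: integral_unique)
qed

lemma LINT_le_AE:
  fixes f g :: "real \<Rightarrow> real"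
  assumes "integrable leb2pi f" "integrable leb2pi g" "AE x in leb2pi. f x \<le> g x"
  shows "(\<integral>x. f x \<partial>leb2pi) \<le> (\<integral>x. g x \<partial>leb2pi)"
  using assms by (rule integral_mono_AE)

text \<open>Cauchy-Schwarz against the constant 1: expand the integral of (\<bar>f\<bar> - t)^2 at
  its minimiser, the mean of \<bar>f\<bar>.\<close>

lemma L1_le_L2:
  assumes "f \<in> L2" shows "(\<integral>x. \<bar>f x\<bar> \<partial>leb2pi)\<^sup>2 \<le> 2 * pi * (\<integral>x. (f x)\<^sup>2 \<partial>leb2pi)"
proof -
  define I where "I = (\<integral>x. \<bar>f x\<bar> \<partial>leb2pi)"
  define t where "t = I / (2 * pi)"
  have int: "integrable leb2pi (\<lambda>x. \<bar>f x\<bar>)" "integrable leb2pi (\<lambda>x. (f x)\<^sup>2)"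
    using L2_integrable[OF assms] L2D[OF assms] by auto
  have ic: "integrable leb2pi (\<lambda>_. t\<^sup>2)" by (rule L2_integrable[OF L2_const])
  have "0 \<le> (\<integral>x. (\<bar>f x\<bar> - t)\<^sup>2 \<partial>leb2pi)" by simp
  also have "\<dots> = (\<integral>x. (f x)\<^sup>2 - 2 * t * \<bar>f x\<bar> + t\<^sup>2 \<partial>leb2pi)"
    by (intro Bochner_Integration.integral_cong) (auto simp: power2_eq_square algebra_simps)
  also have "\<dots> = (\<integral>x. (f x)\<^sup>2 \<partial>leb2pi) - 2 * t * I + 2 * pi * t\<^sup>2"
    using int ic LINT_const[of "t\<^sup>2"] unfolding I_def by (simp del: lebesgue_integral_const)
  also have "\<dots> = (\<integral>x. (f x)\<^sup>2 \<partial>leb2pi) - I\<^sup>2 / (2 * pi)"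
    unfolding t_def by (simp add: power2_eq_square field_simps)
  finally show ?thesis unfolding I_def by (simp add: field_simps)
qed

lemma L2_tendsto_L1:
  assumes "\<And>n. s n \<in> L2" "g \<in> L2" "(\<lambda>n. \<integral>x. (s n x - g x)\<^sup>2 \<partial>leb2pi) \<longlonglongrightarrow> 0"
  shows "(\<lambda>n. \<integral>x. \<bar>s n x - g x\<bar> \<partial>leb2pi) \<longlonglongrightarrow> 0"
proof -
  have "(\<lambda>n. sqrt (2 * pi * (\<integral>x. (s n x - g x)\<^sup>2 \<partial>leb2pi))) \<longlonglongrightarrow> sqrt (2 * pi * 0)"
    by (intro tendsto_intros assms)
  then show ?thesis
  proof (rule metric_tendsto_imp_tendsto)
    show "\<forall>\<^sub>F n in sequentially. dist (\<integral>x. \<bar>s n x - g x\<bar> \<partial>leb2pi) 0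
        \<le> dist (sqrt (2 * pi * (\<integral>x. (s n x - g x)\<^sup>2 \<partial>leb2pi))) (sqrt (2 * pi * 0))"
      using L1_le_L2[OF L2_diff[OF assms(1,2)]]
      by (intro always_eventually) (simp add: real_le_rsqrt)
  qed
qed

text \<open>The pointwise inequality b^2 \<le> 2 (a - b)^2 + 2 a^2 costs a factor 2 against the
  optimal bound; only some finite constant matters later.\<close>

lemma L2_limit_bound:
  assumes "\<And>n. s n \<in> L2" "g \<in> L2" "(\<lambda>n. \<integral>x. (s n x - g x)\<^sup>2 \<partial>leb2pi) \<longlonglongrightarrow> 0"
    and "\<And>n. (\<integral>x. (s n x)\<^sup>2 \<partial>leb2pi) \<le> M"
  shows "(\<integral>x. (g x)\<^sup>2 \<partial>leb2pi) \<le> 2 * M"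
proof -
  have "(\<integral>x. (g x)\<^sup>2 \<partial>leb2pi) \<le> 2 * (\<integral>x. (s n x - g x)\<^sup>2 \<partial>leb2pi) + 2 * M" for n
  proof -
    have "(\<integral>x. (g x)\<^sup>2 \<partial>leb2pi) \<le> (\<integral>x. 2 * (s n x - g x)\<^sup>2 + 2 * (s n x)\<^sup>2 \<partial>leb2pi)"
    proof (rule LINT_le_AE)
      have "b\<^sup>2 \<le> 2 * (a - b)\<^sup>2 + 2 * a\<^sup>2" for a b :: real
        using zero_le_power2[of "2 * a - b"] by (simp add: power2_eq_square algebra_simps)
      then show "AE x in leb2pi. (g x)\<^sup>2 \<le> 2 * (s n x - g x)\<^sup>2 + 2 * (s n x)\<^sup>2" by simp
    qed (use L2D[OF assms(2)] L2D[OF assms(1)[of n]] L2D[OF L2_diff[OF assms(1)[of n] assms(2)]] in auto)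
    also have "\<dots> = 2 * (\<integral>x. (s n x - g x)\<^sup>2 \<partial>leb2pi) + 2 * (\<integral>x. (s n x)\<^sup>2 \<partial>leb2pi)"
      using L2D[OF assms(1)[of n]] L2D[OF L2_diff[OF assms(1)[of n] assms(2)]] by simp
    finally show ?thesis using assms(4)[of n] by linarith
  qed
  moreover have "(\<lambda>n. 2 * (\<integral>x. (s n x - g x)\<^sup>2 \<partial>leb2pi) + 2 * M) \<longlonglongrightarrow> 2 * 0 + 2 * M"
    by (intro tendsto_intros assms)
  ultimately show ?thesis using LIMSEQ_le_const by fastforce
qed

text \<open>Riesz-Fischer: \<open>L1_le_L2\<close> gives an a.e. convergent subsequence, and Fatou's
  lemma along it bounds the distance of the whole sequence from the limit.\<close>

theorem L2_complete:
  assumes L2: "\<And>n. s n \<in> L2"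
    and Cau: "\<And>e. e > 0 \<Longrightarrow> \<exists>N. \<forall>i\<ge>N. \<forall>j\<ge>N. (\<integral>x. (s i x - s j x)\<^sup>2 \<partial>leb2pi) < e"
  obtains g where "g \<in> L2" "(\<lambda>n. \<integral>x. (s n x - g x)\<^sup>2 \<partial>leb2pi) \<longlonglongrightarrow> 0"
proof -
  have meas[measurable]: "s n \<in> borel_measurable leb2pi" for n using L2 by (rule L2_measurable)
  have "\<exists>N. \<forall>i\<ge>N. \<forall>j\<ge>N. (\<integral>x. norm (s i x - s j x) \<partial>leb2pi) < e" if e: "e > 0" for e
  proof -
    obtain N where N: "\<And>i j. i \<ge> N \<Longrightarrow> j \<ge> N \<Longrightarrow> (\<integral>x. (s i x - s j x)\<^sup>2 \<partial>leb2pi) < e\<^sup>2 / (2 * pi)"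
      using Cau[of "e\<^sup>2 / (2 * pi)"] e by auto
    have "(\<integral>x. norm (s i x - s j x) \<partial>leb2pi) < e" if "i \<ge> N" "j \<ge> N" for i j
    proof (rule power2_less_imp_less)
      have "(\<integral>x. \<bar>s i x - s j x\<bar> \<partial>leb2pi)\<^sup>2 \<le> 2 * pi * (\<integral>x. (s i x - s j x)\<^sup>2 \<partial>leb2pi)"
        by (rule L1_le_L2[OF L2_diff[OF L2 L2]])
      also have "\<dots> < e\<^sup>2" using N[OF that] by (simp add: field_simps)
      finally show "(\<integral>x. norm (s i x - s j x) \<partial>leb2pi)\<^sup>2 < e\<^sup>2" by simp
    qed (use e in simp)
    then show ?thesis by blast
  qed
  from cauchy_L1_AE_cauchy_subseq[OF L2_integrable[OF L2] this]
  obtain r where r: "strict_mono r" and AEr: "AE x in leb2pi. Cauchy (\<lambda>i. s (r i) x)" by blast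
  define g where "g x = lim (\<lambda>i. s (r i) x)" for x
  have gm[measurable]: "g \<in> borel_measurable leb2pi"
    unfolding g_def[abs_def] by (rule borel_measurable_lim_metric) simp
  have lim: "AE x in leb2pi. (\<lambda>i. s (r i) x) \<longlonglongrightarrow> g x"
    using AEr unfolding g_def by eventually_elim (simp add: Cauchy_convergent_iff convergent_LIMSEQ_iff)
  have bound: "(\<integral>\<^sup>+x. ennreal ((s n x - g x)\<^sup>2) \<partial>leb2pi) \<le> ennreal e"
    if N: "\<And>i j. i \<ge> N \<Longrightarrow> j \<ge> N \<Longrightarrow> (\<integral>x. (s i x - s j x)\<^sup>2 \<partial>leb2pi) < e" and n: "n \<ge> N" for n N e
  proof -
    have "(\<integral>\<^sup>+x. ennreal ((s n x - g x)\<^sup>2) \<partial>leb2pi) = (\<integral>\<^sup>+x. liminf (\<lambda>i. ennreal ((s n x - s (r i) x)\<^sup>2)) \<partial>leb2pi)"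
    proof (rule nn_integral_cong_AE, use lim in eventually_elim)
      fix x assume "(\<lambda>i. s (r i) x) \<longlonglongrightarrow> g x"
      then have "(\<lambda>i. ennreal ((s n x - s (r i) x)\<^sup>2)) \<longlonglongrightarrow> ennreal ((s n x - g x)\<^sup>2)"
        by (intro tendsto_ennrealI tendsto_intros)
      then show "ennreal ((s n x - g x)\<^sup>2) = liminf (\<lambda>i. ennreal ((s n x - s (r i) x)\<^sup>2))"
        by (metis lim_imp_Liminf trivial_limit_sequentially)
    qed
    also have "\<dots> \<le> liminf (\<lambda>i. \<integral>\<^sup>+x. ennreal ((s n x - s (r i) x)\<^sup>2) \<partial>leb2pi)"
      by (rule nn_integral_liminf) simp
    also have "\<dots> \<le> limsup (\<lambda>i. \<integral>\<^sup>+x. ennreal ((s n x - s (r i) x)\<^sup>2) \<partial>leb2pi)"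
      by (rule Liminf_le_Limsup) simp
    also have "\<dots> \<le> ennreal e"
    proof (rule Limsup_bounded)
      have "(\<integral>\<^sup>+x. ennreal ((s n x - s (r i) x)\<^sup>2) \<partial>leb2pi) \<le> ennreal e" if "i \<ge> N" for i
      proof -
        have "(\<integral>\<^sup>+x. ennreal ((s n x - s (r i) x)\<^sup>2) \<partial>leb2pi) = ennreal (\<integral>x. (s n x - s (r i) x)\<^sup>2 \<partial>leb2pi)"
          by (intro nn_integral_eq_integral L2D[OF L2_diff[OF L2 L2]]) simp
        also have "\<dots> \<le> ennreal e"
          using N[OF n, of "r i"] seq_suble[OF r, of i] that by (intro ennreal_leI) auto
        finally show ?thesis .
      qed
      then show "\<forall>\<^sub>F i in sequentially. (\<integral>\<^sup>+x. ennreal ((s n x - s (r i) x)\<^sup>2) \<partial>leb2pi) \<le> ennreal e"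
        unfolding eventually_sequentially by blast
    qed
    finally show ?thesis .
  qed
  obtain N1 where N1: "\<And>i j. i \<ge> N1 \<Longrightarrow> j \<ge> N1 \<Longrightarrow> (\<integral>x. (s i x - s j x)\<^sup>2 \<partial>leb2pi) < 1"
    using Cau[of 1] by auto
  have "(\<lambda>x. s N1 x - g x) \<in> L2"
    unfolding L2_def mem_Collect_eq
  proof
    show "integrable leb2pi (\<lambda>x. (s N1 x - g x)\<^sup>2)"
    proof (rule integrableI_bounded)
      show "(\<integral>\<^sup>+x. ennreal (norm ((s N1 x - g x)\<^sup>2)) \<partial>leb2pi) < \<infinity>"
        using bound[OF N1 order_refl] le_less_trans[OF _ ennreal_less_top[of 1]] by simp
    qed simp
  qed simp
  from L2_diff[OF L2[of N1] this] have gL2: "g \<in> L2" by simp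
  have "(\<lambda>n. \<integral>x. (s n x - g x)\<^sup>2 \<partial>leb2pi) \<longlonglongrightarrow> 0"
  proof (rule LIMSEQ_I)
    fix e :: real assume e: "e > 0"
    obtain N where N: "\<And>i j. i \<ge> N \<Longrightarrow> j \<ge> N \<Longrightarrow> (\<integral>x. (s i x - s j x)\<^sup>2 \<partial>leb2pi) < e / 2"
      using Cau[of "e / 2"] e by auto
    have "norm ((\<integral>x. (s n x - g x)\<^sup>2 \<partial>leb2pi) - 0) < e" if "n \<ge> N" for n
    proof -
      have "ennreal (\<integral>x. (s n x - g x)\<^sup>2 \<partial>leb2pi) = (\<integral>\<^sup>+x. ennreal ((s n x - g x)\<^sup>2) \<partial>leb2pi)"
        by (intro nn_integral_eq_integral[symmetric] L2D[OF L2_diff[OF L2 gL2]]) simp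
      also have "\<dots> \<le> ennreal (e / 2)" by (rule bound[OF N that])
      finally have "(\<integral>x. (s n x - g x)\<^sup>2 \<partial>leb2pi) \<le> e / 2"
        using e by (subst (asm) ennreal_le_iff) auto
      then show ?thesis using e by simp
    qed
    then show "\<exists>N. \<forall>n\<ge>N. norm ((\<integral>x. (s n x - g x)\<^sup>2 \<partial>leb2pi) - 0) < e" by blast
  qed
  with gL2 show ?thesis by (rule that)
qed

section \<open>Cosine series\<close>

text \<open>The index is shifted by one, so that the zero mode is absent and series run over all
  natural numbers.\<close>

definition cosn :: "nat \<Rightarrow> real \<Rightarrow> real" where "cosn n x = cos (2 * real (Suc n) * x)"
definition sinn :: "nat \<Rightarrow> real \<Rightarrow> real" where "sinn n x = sin (2 * real (Suc n) * x)"

lemma cosn_le1: "\<bar>cosn n x\<bar> \<le> 1"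
  by (simp add: cosn_def)

lemma continuous_cosn: "continuous_on S (cosn n)" and continuous_sinn: "continuous_on S (sinn n)"
  unfolding cosn_def[abs_def] sinn_def[abs_def] by (intro continuous_intros)+

lemma cosn_L2: "cosn n \<in> L2" and sinn_L2: "sinn n \<in> L2"
  by (intro continuous_L2 continuous_cosn continuous_sinn)+

lemma cosn_deriv: "(cosn n has_real_derivative - (2 * real (Suc n)) * sinn n x) (at x)"
  unfolding cosn_def[abs_def] sinn_def by (rule derivative_eq_intros refl | simp add: algebra_simps)+

lemma cosn_periodic: "cosn n (x + 2 * pi * of_int j) = cosn n x"
  and sinn_periodic: "sinn n (x + 2 * pi * of_int j) = sinn n x"
proof -
  have "2 * real (Suc n) * (x + 2 * pi * of_int j) = 2 * real (Suc n) * x + 2 * pi * of_int (2 * int (Suc n) * j)"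
    by (simp add: algebra_simps)
  then show "cosn n (x + 2 * pi * of_int j) = cosn n x" "sinn n (x + 2 * pi * of_int j) = sinn n x"
    unfolding cosn_def sinn_def by (simp_all only: cos_add sin_add cos_int_2pin sin_int_2pin mult_1_right mult_zero_right diff_zero add_0_right)
qed

lemma cosn_rmod: "cosn n (x rmod (2*pi)) = cosn n x"
  using cosn_periodic[of n x "- \<lfloor>x / (2*pi)\<rfloor>"] by (simp add: rmod_def)

lemma cosn_minus: "cosn n (- x) = cosn n x" and sinn_minus: "sinn n (- x) = - sinn n x"
  by (simp_all add: cosn_def sinn_def)

lemma cosn_pi: "cosn n (pi + x) = cosn n x"
proof -
  have "2 * real (Suc n) * (pi + x) = 2 * real (Suc n) * x + 2 * pi * of_int (int (Suc n))"
    by (simp add: algebra_simps)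
  then show ?thesis unfolding cosn_def by (simp only: cos_add cos_int_2pin sin_int_2pin mult_1_right mult_zero_right diff_zero)
qed

lemma LINT_cos_even:
  assumes "j \<noteq> 0" shows "(\<integral>x. cos (2 * real_of_int j * x) \<partial>leb2pi) = 0"
proof -
  have "(\<integral>x. cos (2 * real_of_int j * x) \<partial>leb2pi)
      = sin (2 * real_of_int j * (2 * pi)) / (2 * real_of_int j) - sin (2 * real_of_int j * 0) / (2 * real_of_int j)"
    by (rule LINT_FTC) (use assms in \<open>auto intro!: derivative_eq_intros continuous_intros\<close>)
  moreover have "2 * real_of_int j * (2 * pi) = 2 * pi * of_int (2 * j)" by simp
  ultimately show ?thesis by (simp only: sin_int_2pin) simp
qed

lemma LINT_cosn: "(\<integral>x. cosn n x \<partial>leb2pi) = 0"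
  using LINT_cos_even[of "int (Suc n)"] by (simp add: cosn_def)

lemma LINT_cos_even_if: "(\<integral>x. cos (2 * real_of_int j * x) \<partial>leb2pi) = (if j = 0 then 2 * pi else 0)"
  using LINT_cos_even[of j] LINT_const[of 1] by simp

lemma cosn_orth: "(\<integral>x. cosn m x * cosn n x \<partial>leb2pi) = (if m = n then pi else 0)"
  and sinn_orth: "(\<integral>x. sinn m x * sinn n x \<partial>leb2pi) = (if m = n then pi else 0)"
proof -
  let ?a = "int m - int n" and ?b = "int m + int n + 2"
  have i: "integrable leb2pi (\<lambda>x. cos (2 * real_of_int j * x))" for j
    by (intro L2_integrable continuous_L2 continuous_intros)
  have e: "2 * real_of_int ?a * x = 2 * real (Suc m) * x - 2 * real (Suc n) * x"
    "2 * real_of_int ?b * x = 2 * real (Suc m) * x + 2 * real (Suc n) * x" for x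
    by (simp_all add: algebra_simps)
  have "(\<integral>x. cosn m x * cosn n x \<partial>leb2pi)
      = (\<integral>x. (cos (2 * real_of_int ?a * x) + cos (2 * real_of_int ?b * x)) / 2 \<partial>leb2pi)"
    unfolding cosn_def cos_times_cos e ..
  also have "\<dots> = (if m = n then pi else 0)"
    using i[of ?a] i[of ?b] LINT_cos_even_if[of ?a] LINT_cos_even_if[of ?b] by simp
  finally show "(\<integral>x. cosn m x * cosn n x \<partial>leb2pi) = (if m = n then pi else 0)" .
  have "(\<integral>x. sinn m x * sinn n x \<partial>leb2pi)
      = (\<integral>x. (cos (2 * real_of_int ?a * x) - cos (2 * real_of_int ?b * x)) / 2 \<partial>leb2pi)"
    unfolding sinn_def sin_times_sin e ..
  also have "\<dots> = (if m = n then pi else 0)"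
    using i[of ?a] i[of ?b] LINT_cos_even_if[of ?a] LINT_cos_even_if[of ?b] by simp
  finally show "(\<integral>x. sinn m x * sinn n x \<partial>leb2pi) = (if m = n then pi else 0)" .
qed

lemma orth_sum_sq:
  fixes \<phi> :: "nat \<Rightarrow> real \<Rightarrow> real"
  assumes "\<And>n. \<phi> n \<in> L2" "\<And>m n. (\<integral>x. \<phi> m x * \<phi> n x \<partial>leb2pi) = (if m = n then pi else 0)" "finite I"
  shows "(\<integral>x. (\<Sum>i\<in>I. a i * \<phi> i x)\<^sup>2 \<partial>leb2pi) = pi * (\<Sum>i\<in>I. (a i)\<^sup>2)"
proof -
  have "(\<integral>x. (\<Sum>i\<in>I. a i * \<phi> i x)\<^sup>2 \<partial>leb2pi) = (\<integral>x. (\<Sum>i\<in>I. \<Sum>j\<in>I. a i * a j * (\<phi> i x * \<phi> j x)) \<partial>leb2pi)"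
    unfolding power2_eq_square sum_product by (simp add: mult_ac)
  also have "\<dots> = (\<Sum>i\<in>I. \<Sum>j\<in>I. a i * a j * (if i = j then pi else 0))"
    using assms L2_integrable_mult[OF assms(1) assms(1)]
    by (simp add: Bochner_Integration.integral_sum Bochner_Integration.integrable_sum)
  also have "\<dots> = pi * (\<Sum>i\<in>I. (a i)\<^sup>2)"
    using assms(3) by (simp add: sum_distrib_left power2_eq_square if_distrib[of "\<lambda>t. _ * t"] sum.delta mult_ac cong: if_cong)
  finally show ?thesis .
qed

definition cos_coeff :: "nat \<Rightarrow> (real \<Rightarrow> real) \<Rightarrow> real" where
  "cos_coeff n w = (\<integral>x. w x * cosn n x \<partial>leb2pi) / pi"

lemma bessel:
  assumes "w \<in> L2" "finite I"
  shows "pi * (\<Sum>n\<in>I. (cos_coeff n w)\<^sup>2) \<le> (\<integral>x. (w x)\<^sup>2 \<partial>leb2pi)"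
proof -
  define S where "S x = (\<Sum>n\<in>I. cos_coeff n w * cosn n x)" for x
  have SL2: "S \<in> L2" unfolding S_def[abs_def] by (intro L2_sum L2_scale cosn_L2)
  have S2: "(\<integral>x. (S x)\<^sup>2 \<partial>leb2pi) = pi * (\<Sum>n\<in>I. (cos_coeff n w)\<^sup>2)"
    unfolding S_def by (rule orth_sum_sq[OF cosn_L2 cosn_orth assms(2)])
  have "(\<integral>x. w x * S x \<partial>leb2pi) = (\<integral>x. (\<Sum>n\<in>I. cos_coeff n w * (w x * cosn n x)) \<partial>leb2pi)"
    unfolding S_def by (simp add: sum_distrib_left mult_ac)
  also have "\<dots> = (\<Sum>n\<in>I. cos_coeff n w * (\<integral>x. w x * cosn n x \<partial>leb2pi))"
    using L2_integrable_mult[OF assms(1) cosn_L2]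
    by (simp add: Bochner_Integration.integral_sum)
  also have "\<dots> = pi * (\<Sum>n\<in>I. (cos_coeff n w)\<^sup>2)"
    by (simp add: cos_coeff_def sum_distrib_left power2_eq_square)
  finally have wS: "(\<integral>x. w x * S x \<partial>leb2pi) = pi * (\<Sum>n\<in>I. (cos_coeff n w)\<^sup>2)" .
  have "0 \<le> (\<integral>x. (w x - S x)\<^sup>2 \<partial>leb2pi)" by simp
  also have "\<dots> = (\<integral>x. (w x)\<^sup>2 - 2 * (w x * S x) + (S x)\<^sup>2 \<partial>leb2pi)"
    by (simp add: power2_diff algebra_simps)
  also have "\<dots> = (\<integral>x. (w x)\<^sup>2 \<partial>leb2pi) - 2 * (\<integral>x. w x * S x \<partial>leb2pi) + (\<integral>x. (S x)\<^sup>2 \<partial>leb2pi)"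
    using L2_integrable_mult[OF assms(1) SL2] L2D[OF assms(1)] L2D[OF SL2] by simp
  finally show ?thesis unfolding S2 wS by simp
qed

text \<open>By the arithmetic-geometric mean inequality, \<bar>d\<bar> is at most half the sum of
  1/m^2 and (m d)^2 with m = n + 1.\<close>

lemma summable_weighted:
  fixes d :: "nat \<Rightarrow> real"
  assumes "summable (\<lambda>n. (real (Suc n) * d n)\<^sup>2)"
  shows "summable (\<lambda>n. \<bar>d n\<bar>)"
proof (rule summable_comparison_test'[where N=0])
  have "summable (\<lambda>n. inverse ((real (Suc n))\<^sup>2))"
    using inverse_squares_sums by (simp add: sums_iff field_simps)
  then show "summable (\<lambda>n. (inverse ((real (Suc n))\<^sup>2) + (real (Suc n) * d n)\<^sup>2) / 2)"
    using assms by (intro summable_divide summable_add)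
  fix n
  have "0 \<le> (inverse (real (Suc n)) - real (Suc n) * \<bar>d n\<bar>)\<^sup>2" by simp
  also have "\<dots> = inverse ((real (Suc n))\<^sup>2) + (real (Suc n) * d n)\<^sup>2 - 2 * \<bar>d n\<bar>"
    by (simp add: power2_diff power_mult_distrib power_inverse)
  finally show "norm \<bar>d n\<bar> \<le> (inverse ((real (Suc n))\<^sup>2) + (real (Suc n) * d n)\<^sup>2) / 2" by simp
qed

section \<open>Absolutely convergent cosine series\<close>

definition cosseries :: "(nat \<Rightarrow> real) \<Rightarrow> real \<Rightarrow> real" where
  "cosseries d x = (\<Sum>n. d n * cosn n x)"

context
  fixes d :: "nat \<Rightarrow> real"
  assumes d: "summable (\<lambda>n. \<bar>d n\<bar>)"
begin

lemma norm_cosseries_term: "norm (d n * cosn n x) \<le> \<bar>d n\<bar>"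
  using mult_left_mono[OF cosn_le1 abs_ge_zero[of "d n"]] by (simp add: abs_mult)

lemma cosseries_sums: "(\<lambda>n. d n * cosn n x) sums cosseries d x"
  unfolding cosseries_def by (intro summable_sums summable_comparison_test'[OF d norm_cosseries_term])

lemma cosseries_uniform:
  "uniform_limit UNIV (\<lambda>N x. \<Sum>n<N. d n * cosn n x) (cosseries d) sequentially"
  unfolding cosseries_def[abs_def] by (rule Weierstrass_m_test[OF norm_cosseries_term d])

lemma continuous_cosseries: "continuous_on S (cosseries d)"
proof -
  have "continuous_on UNIV (cosseries d)"
    by (rule uniform_limit_theorem[OF _ cosseries_uniform])
       (auto intro!: always_eventually continuous_intros continuous_cosn)
  then show ?thesis by (rule continuous_on_subset) simp
qed

lemma cosseries_L2: "cosseries d \<in> L2"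
  by (intro continuous_L2 continuous_cosseries)

text \<open>The majorant \<bar>d n\<bar> \<bar>w\<bar> permits termwise integration. General
  \<open>\<phi>\<close> rather than \<open>cosn\<close> is allowed because the convolution with
  \<open>K\<close> needs the translates \<open>cosn n (\<theta> - t)\<close>.\<close>

lemma LINT_cosseries_mult:
  assumes "w \<in> L2" "\<And>n x. \<bar>\<phi> n x\<bar> \<le> 1" "\<And>n. \<phi> n \<in> L2"
  shows "(\<lambda>n. d n * (\<integral>x. w x * \<phi> n x \<partial>leb2pi)) sums (\<integral>x. w x * (\<Sum>n. d n * \<phi> n x) \<partial>leb2pi)"
proof -
  have i: "integrable leb2pi (\<lambda>x. w x * \<phi> n x)" for n by (rule L2_integrable_mult[OF assms(1,3)])
  have b: "\<bar>w x * \<phi> n x\<bar> \<le> \<bar>w x\<bar>" for n x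
    using mult_left_mono[OF assms(2) abs_ge_zero[of "w x"]] by (simp add: abs_mult)
  have sd: "summable (\<lambda>n. norm (d n * \<phi> n x))" for x
    by (rule summable_comparison_test'[OF d]) (use mult_left_mono[OF assms(2) abs_ge_zero] in \<open>simp add: abs_mult\<close>)
  have "(\<lambda>n. \<integral>x. d n * (w x * \<phi> n x) \<partial>leb2pi) sums (\<integral>x. (\<Sum>n. d n * (w x * \<phi> n x)) \<partial>leb2pi)"
  proof (rule sums_integral)
    show "integrable leb2pi (\<lambda>x. d n * (w x * \<phi> n x))" for n using i by simp
    have "summable (\<lambda>n. norm (d n * (w x * \<phi> n x)))" for x
    proof (rule summable_comparison_test'[OF summable_mult2[OF d, of "\<bar>w x\<bar>"]])
      show "norm (norm (d n * (w x * \<phi> n x))) \<le> \<bar>d n\<bar> * \<bar>w x\<bar>" for n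
        using mult_left_mono[OF b[of x n] abs_ge_zero[of "d n"]] by (simp only: abs_mult real_norm_def abs_abs)
    qed
    then show "AE x in leb2pi. summable (\<lambda>n. norm (d n * (w x * \<phi> n x)))" by simp
    show "summable (\<lambda>n. \<integral>x. norm (d n * (w x * \<phi> n x)) \<partial>leb2pi)"
    proof (rule summable_comparison_test'[OF summable_mult2[OF d, of "\<integral>x. \<bar>w x\<bar> \<partial>leb2pi"]])
      fix n
      have "(\<integral>x. \<bar>w x * \<phi> n x\<bar> \<partial>leb2pi) \<le> (\<integral>x. \<bar>w x\<bar> \<partial>leb2pi)"
        using i[of n] L2_integrable[OF assms(1)] b by (intro LINT_le_AE) auto
      from mult_left_mono[OF this abs_ge_zero[of "d n"]]
      show "norm (\<integral>x. norm (d n * (w x * \<phi> n x)) \<partial>leb2pi) \<le> \<bar>d n\<bar> * (\<integral>x. \<bar>w x\<bar> \<partial>leb2pi)"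
        by (simp add: abs_mult)
    qed
  qed
  moreover have "(\<Sum>n. d n * (w x * \<phi> n x)) = w x * (\<Sum>n. d n * \<phi> n x)" for x
    using suminf_mult[OF summable_norm_cancel[OF sd], of "w x" x] by (simp add: mult_ac)
  ultimately show ?thesis by simp
qed

lemma cos_coeff_cosseries: "cos_coeff n (cosseries d) = d n"
proof -
  have "(\<lambda>m. d m * (\<integral>x. cosn n x * cosn m x \<partial>leb2pi)) sums (\<integral>x. cosn n x * cosseries d x \<partial>leb2pi)"
    unfolding cosseries_def by (rule LINT_cosseries_mult[OF cosn_L2 cosn_le1 cosn_L2])
  moreover have "(\<lambda>m. d m * (\<integral>x. cosn n x * cosn m x \<partial>leb2pi)) sums (d n * pi)"
    unfolding cosn_orth using sums_single[of n "\<lambda>m. d m * pi"]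
    by (simp add: if_distrib[of "\<lambda>t. _ * t"] eq_commute cong: if_cong)
  ultimately have "(\<integral>x. cosn n x * cosseries d x \<partial>leb2pi) = d n * pi" by (rule sums_unique2)
  then show ?thesis by (simp add: cos_coeff_def mult.commute)
qed

lemma LINT_cosseries: "(\<integral>x. cosseries d x \<partial>leb2pi) = 0"
proof -
  have "(\<lambda>m. d m * (\<integral>x. 1 * cosn m x \<partial>leb2pi)) sums (\<integral>x. 1 * cosseries d x \<partial>leb2pi)"
    unfolding cosseries_def by (rule LINT_cosseries_mult[OF L2_const cosn_le1 cosn_L2])
  then show ?thesis by (simp add: LINT_cosn sums_iff)
qed

lemma cosseries_sym:
  "cosseries d ((pi + x) rmod (2*pi)) = cosseries d x"
  "cosseries d ((2*pi - x) rmod (2*pi)) = cosseries d x"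
proof -
  have "cosn n (2*pi - x) = cosn n x" for n
    using cosn_periodic[of n "-x" 1] by (simp add: cosn_minus)
  then show "cosseries d ((pi + x) rmod (2*pi)) = cosseries d x"
    "cosseries d ((2*pi - x) rmod (2*pi)) = cosseries d x"
    unfolding cosseries_def by (simp_all only: cosn_rmod cosn_pi)
qed

end

section \<open>The Sobolev embedding\<close>

lemma test_funD:
  assumes "test_fun \<phi>"
  shows "(\<phi> has_real_derivative deriv \<phi> x) (at x)" "continuous_on UNIV (deriv \<phi>)"
    "continuous_on UNIV \<phi>" "\<phi> 0 = 0" "\<phi> (2*pi) = 0"
proof -
  have C1: "\<phi> C1_differentiable_on UNIV" and sub: "closure {x. \<phi> x \<noteq> 0} \<subseteq> {0<..<2*pi}"
    using assms by (auto simp: test_fun_def)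
  from C1 obtain D where D: "\<forall>x\<in>UNIV. (\<phi> has_vector_derivative D x) (at x)" "continuous_on UNIV D"
    unfolding C1_differentiable_on_def by blast
  have D1: "(\<phi> has_real_derivative D x) (at x)" for x
    using D(1) by (simp add: has_real_derivative_iff_has_vector_derivative)
  have "deriv \<phi> = D" using D1 by (intro ext DERIV_imp_deriv)
  then show "(\<phi> has_real_derivative deriv \<phi> x) (at x)" "continuous_on UNIV (deriv \<phi>)"
    using D1 D(2) by auto
  show "continuous_on UNIV \<phi>" using C1 by (rule C1_differentiable_imp_continuous_on)
  have "0 \<notin> {x. \<phi> x \<noteq> 0}" "2*pi \<notin> {x. \<phi> x \<noteq> 0}"
    using sub closure_subset[of "{x. \<phi> x \<noteq> 0}"] by auto
  then show "\<phi> 0 = 0" "\<phi> (2*pi) = 0" by auto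
qed

lemma test_fun_support:
  assumes "test_fun \<phi>"
  obtains a b where "0 < a" "a \<le> b" "b < 2*pi" "\<And>x. x \<notin> {a..b} \<Longrightarrow> \<phi> x = 0"
proof (cases "closure {x. \<phi> x \<noteq> 0} = {}")
  case True
  then have "\<phi> x = 0" for x by auto
  with pi_gt_zero show ?thesis by (intro that[of pi pi]) auto
next
  case False
  let ?K = "closure {x. \<phi> x \<noteq> 0}"
  have K: "compact ?K" "?K \<subseteq> {0<..<2*pi}" using assms by (auto simp: test_fun_def)
  obtain a where a: "a \<in> ?K" "\<And>x. x \<in> ?K \<Longrightarrow> a \<le> x" using compact_attains_inf[OF K(1) False] by blast
  obtain b where b: "b \<in> ?K" "\<And>x. x \<in> ?K \<Longrightarrow> x \<le> b" using compact_attains_sup[OF K(1) False] by blast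
  show ?thesis
  proof (rule that[of a b])
    show "\<phi> x = 0" if "x \<notin> {a..b}" for x
    proof (rule ccontr)
      assume "\<phi> x \<noteq> 0"
      then have "x \<in> ?K" using subsetD[OF closure_subset, of x "{x. \<phi> x \<noteq> 0}"] by simp
      with a(2)[of x] b(2)[of x] that show False by simp
    qed
    show "0 < a" "b < 2*pi" using subsetD[OF K(2) a(1)] subsetD[OF K(2) b(1)] by simp_all
    show "a \<le> b" by (rule a(2)[OF b(1)])
  qed
qed

section \<open>Primitives of test functions and of weak derivatives\<close>

lemma LINT_indicator_atMost:
  fixes h :: "real \<Rightarrow> real"
  assumes "continuous_on UNIV h" "0 \<le> x" "x \<le> 2*pi"
  shows "(\<integral>t. h t * indicator {..x} t \<partial>leb2pi) = integral {0..x} h"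
proof -
  have "(\<integral>t. h t * indicator {..x} t \<partial>leb2pi) = (\<integral>t. indicator {0..2*pi} t *\<^sub>R (h t * indicator {..x} t) \<partial>lebesgue)"
    by (rule integral_restrict_space) simp
  also have "\<dots> = (\<integral>t. indicator {0..x} t *\<^sub>R h t \<partial>lebesgue)"
    using assms by (intro Bochner_Integration.integral_cong) (auto simp: indicator_def)
  also have "\<dots> = (\<integral>t. h t \<partial>lebesgue_on {0..x})"
    by (rule integral_restrict_space[symmetric]) simp
  also have "\<dots> = integral {0..x} h"
    by (intro lebesgue_integral_eq_integral continuous_imp_integrable_real continuous_on_subset[OF assms(1)]) auto
  finally show ?thesis .
qed

text \<open>Zero mean is what makes the primitive vanish to the right of \<open>b\<close>, hence
  gives it compact support in the open interval.\<close>

lemma test_fun_antiderivative: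
  fixes h :: "real \<Rightarrow> real"
  assumes h: "continuous_on UNIV h" and ab: "0 < a" "a \<le> b" "b < 2*pi"
    and out: "\<And>x. x \<notin> {a..b} \<Longrightarrow> h x = 0" and zero: "(\<integral>x. h x \<partial>leb2pi) = 0"
  obtains \<phi> where "test_fun \<phi>" "deriv \<phi> = h"
    "\<And>x. 0 \<le> x \<Longrightarrow> x \<le> 2*pi \<Longrightarrow> \<phi> x = (\<integral>t. h t * indicator {..x} t \<partial>leb2pi)"
proof -
  define \<phi> where "\<phi> x = integral {0..x} h" for x
  have lt: "\<phi> x = 0" if "x < a" for x
  proof -
    have "\<phi> x = integral {0..x} (\<lambda>_. 0)"
      unfolding \<phi>_def using that by (intro Henstock_Kurzweil_Integration.integral_cong out) auto
    then show ?thesis by simp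
  qed
  have D: "(\<phi> has_real_derivative h x) (at x)" for x
  proof (cases "x < a")
    case True
    have "((\<lambda>_. 0::real) has_real_derivative 0) (at x)" by simp
    then have "(\<phi> has_real_derivative 0) (at x)"
      by (rule has_field_derivative_transform_within_open[of _ _ _ "{..<a}"]) (use True lt in auto)
    then show ?thesis using out[of x] True by simp
  next
    case False
    have "(\<phi> has_vector_derivative h x) (at x within {0..x+1})"
      unfolding \<phi>_def using False ab
      by (intro integral_has_vector_derivative continuous_on_subset[OF h]) auto
    moreover have "at x within {0..x+1} = at x"
      using False ab by (intro at_within_interior) auto
    ultimately show ?thesis by (simp add: has_real_derivative_iff_has_vector_derivative)
  qed
  have ep: "\<phi> (2*pi) = 0"
  proof -
    have "\<phi> (2*pi) = (\<integral>t. h t * indicator {..2*pi} t \<partial>leb2pi)"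
      unfolding \<phi>_def by (rule LINT_indicator_atMost[symmetric, OF h]) auto
    also have "\<dots> = (\<integral>t. h t \<partial>leb2pi)"
      by (intro Bochner_Integration.integral_cong) (auto simp: space_restrict_space)
    finally show ?thesis using zero by simp
  qed
  have gt: "\<phi> x = 0" if "x > b" for x
  proof -
    have "\<phi> x = \<phi> (2*pi)"
    proof (rule has_field_derivative_zero_constant[of "{b<..}", THEN exE])
      show "convex {b<..}" by simp
      show "(\<phi> has_field_derivative 0) (at y within {b<..})" if "y \<in> {b<..}" for y
        using D[of y] out[of y] that by (auto intro: has_field_derivative_at_within)
      fix c assume "\<forall>y\<in>{b<..}. \<phi> y = c"
      then show "\<phi> x = \<phi> (2*pi)" using that ab by auto
    qed
    then show ?thesis using ep by simp
  qed
  have sub: "closure {x. \<phi> x \<noteq> 0} \<subseteq> {a..b}"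
    by (rule closure_minimal) (use lt gt in \<open>auto simp: not_less[symmetric]\<close>)
  have "test_fun \<phi>"
    unfolding test_fun_def
  proof (intro conjI)
    show "\<phi> C1_differentiable_on UNIV"
      unfolding C1_differentiable_on_def using D h
      by (auto simp: has_real_derivative_iff_has_vector_derivative)
    show "compact (closure {x. \<phi> x \<noteq> 0})"
      using compact_Int_closed[OF compact_Icc closed_closure[of "{x. \<phi> x \<noteq> 0}"], of a b] sub
      by (simp only: Int_absorb1)
    show "closure {x. \<phi> x \<noteq> 0} \<subseteq> {0<..<2*pi}" using sub ab by fastforce
  qed
  moreover have "deriv \<phi> = h" using D by (intro ext DERIV_imp_deriv)
  moreover have "\<phi> x = (\<integral>t. h t * indicator {..x} t \<partial>leb2pi)" if "0 \<le> x" "x \<le> 2*pi" for x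
    unfolding \<phi>_def by (rule LINT_indicator_atMost[symmetric, OF h that])
  ultimately show ?thesis by (rule that)
qed

text \<open>Multiples of such a function are subtracted from an arbitrary test function to make its
  mean zero.\<close>

lemma test_fun_unit_mass: obtains \<eta> where "test_fun \<eta>" "(\<integral>x. \<eta> x \<partial>leb2pi) = 1"
proof -
  define \<beta> where "\<beta> x = real 1 * bump 1 2 x / (1 + real 1 * bump 1 2 x)" for x
  have t: "test_fun \<beta>" unfolding \<beta>_def[abs_def] using pi_gt3 by (intro test_fun_bump) auto
  have nn: "\<beta> x \<ge> 0" for x using bump_nonneg[of 1 2 x] by (simp add: \<beta>_def)
  define I where "I = (\<integral>x. \<beta> x \<partial>leb2pi)"
  have "I \<noteq> 0"
  proof
    assume "I = 0"
    then have "AE x in leb2pi. \<beta> x = 0"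
      using integral_nonneg_eq_0_iff_AE[OF L2_integrable[OF test_fun_L2(1)[OF t]]] nn by (simp add: I_def)
    then have "AE x in lebesgue. x \<in> {0..2*pi} \<longrightarrow> \<beta> x = 0"
      by (subst (asm) AE_restrict_space_iff) auto
    then have "AE x in lebesgue. x \<notin> {1<..<2::real}"
    proof eventually_elim
      case (elim x)
      show ?case
      proof
        assume x: "x \<in> {1<..<2}"
        have "(1::real) < 2" by simp
        from bump_pos_iff[OF this] x have b: "bump 1 2 x > 0" by (simp only: greaterThanLessThan_iff)
        have "\<beta> x > 0" unfolding \<beta>_def by (intro divide_pos_pos add_pos_pos mult_pos_pos b) simp_all
        moreover have "x \<in> {0..2*pi}"
          unfolding atLeastAtMost_iff using x pi_gt3 unfolding greaterThanLessThan_iff by linarith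
        ultimately show False using elim by simp
      qed
    qed
    then have "{1<..<2} \<in> null_sets (lebesgue :: real measure)"
      by (subst AE_iff_null_sets) auto
    then have "emeasure lebesgue {1<..<2::real} = 0" by (rule null_setsD1)
    then show False by simp
  qed
  have "test_fun (\<lambda>x. \<beta> x / I)"
    unfolding test_fun_def
  proof (intro conjI)
    have "\<beta> C1_differentiable_on UNIV" using t by (simp add: test_fun_def)
    then show "(\<lambda>x. \<beta> x / I) C1_differentiable_on UNIV"
      by (auto simp: divide_inverse)
    have "{x. \<beta> x / I \<noteq> 0} = {x. \<beta> x \<noteq> 0}" using \<open>I \<noteq> 0\<close> by auto
    then show "compact (closure {x. \<beta> x / I \<noteq> 0})" "closure {x. \<beta> x / I \<noteq> 0} \<subseteq> {0<..<2*pi}"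
      using t by (simp_all add: test_fun_def)
  qed
  moreover have "(\<integral>x. \<beta> x / I \<partial>leb2pi) = 1" using \<open>I \<noteq> 0\<close> by (simp add: I_def)
  ultimately show ?thesis by (rule that)
qed

text \<open>Lemma of du Bois-Reymond. Testing the weak derivative with a primitive of a mean-zero
  \<open>h\<close> and exchanging integrals shows that u + H is orthogonal to every such
  \<open>h\<close>, where H is the tail integral of \<open>g\<close>; so u + H is constant. The tail
  from t onwards, and with it the minus sign, arises because the primitive of \<open>h\<close>
  starts at 0.\<close>

lemma weak_deriv_primitive:
  assumes u: "u \<in> L2" and g: "g \<in> L2" and ug: "has_weak_deriv u g"
  obtains c where "AE t in leb2pi. u t = c - (\<integral>x. g x * indicator {t..} x \<partial>leb2pi)"
    "(\<lambda>t. \<integral>x. g x * indicator {t..} x \<partial>leb2pi) \<in> L2"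
proof -
  interpret leb: finite_measure leb2pi by (rule finite_measure_leb2pi)
  interpret P: pair_sigma_finite leb2pi leb2pi by unfold_locales
  have idm: "(\<lambda>x. x) \<in> borel_measurable leb2pi"
    by (intro continuous_leb2pi_measurable continuous_intros)
  have fstm: "fst \<in> borel_measurable (leb2pi \<Otimes>\<^sub>M leb2pi)" and sndm: "snd \<in> borel_measurable (leb2pi \<Otimes>\<^sub>M leb2pi)"
    using measurable_compose[OF measurable_fst idm] measurable_compose[OF measurable_snd idm] by auto
  have gm: "g \<in> borel_measurable leb2pi" by (rule L2_measurable[OF g])
  define H where "H t = (\<integral>x. g x * indicator {t..} x \<partial>leb2pi)" for t
  have km: "(\<lambda>(t, x). g x * indicator {t..} x) \<in> borel_measurable (leb2pi \<Otimes>\<^sub>M leb2pi)"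
  proof -
    have "(\<lambda>p. g (snd p) * (if fst p \<le> snd p then 1 else 0)) \<in> borel_measurable (leb2pi \<Otimes>\<^sub>M leb2pi)"
      by (intro borel_measurable_times measurable_compose[OF measurable_snd gm] measurable_If
          borel_measurable_const borel_measurable_le fstm sndm)
    then show ?thesis by (simp add: case_prod_beta' indicator_def of_bool_def)
  qed
  have Hm: "H \<in> borel_measurable leb2pi"
    unfolding H_def[abs_def] using leb.borel_measurable_lebesgue_integral[OF km] by simp
  have gi: "integrable leb2pi (\<lambda>x. \<bar>g x\<bar>)" using L2_integrable[OF g] by simp
  have Hb: "\<bar>H t\<bar> \<le> (\<integral>x. \<bar>g x\<bar> \<partial>leb2pi)" for t
  proof -
    have "\<bar>H t\<bar> \<le> (\<integral>x. \<bar>g x * indicator {t..} x\<bar> \<partial>leb2pi)"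
      unfolding H_def by (rule integral_abs_bound)
    also have "\<dots> \<le> (\<integral>x. \<bar>g x\<bar> \<partial>leb2pi)"
      by (intro integral_mono_AE' gi AE_I2) (auto simp: indicator_def)
    finally show ?thesis .
  qed
  have HL2: "H \<in> L2" by (rule bounded_meas_L2[OF Hm Hb])
  have key: "(\<integral>x. (u x + H x) * h x \<partial>leb2pi) = 0"
    if h: "continuous_on UNIV h" and ab: "0 < a" "a \<le> b" "b < 2*pi"
      and out: "\<And>x. x \<notin> {a..b} \<Longrightarrow> h x = 0" and zero: "(\<integral>x. h x \<partial>leb2pi) = 0" for h a b
  proof -
    obtain \<phi> where \<phi>: "test_fun \<phi>" "deriv \<phi> = h"
      "\<And>x. 0 \<le> x \<Longrightarrow> x \<le> 2*pi \<Longrightarrow> \<phi> x = (\<integral>t. h t * indicator {..x} t \<partial>leb2pi)"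
      using test_fun_antiderivative[OF h ab out zero] by blast
    have hL2: "h \<in> L2" by (rule continuous_L2[OF h])
    have hm: "h \<in> borel_measurable leb2pi" by (rule L2_measurable[OF hL2])
    let ?f = "\<lambda>t x. h t * (g x * indicator {t..} x)"
    have int: "integrable (leb2pi \<Otimes>\<^sub>M leb2pi) (case_prod ?f)"
    proof (rule P.Fubini_integrable)
      show m: "case_prod ?f \<in> borel_measurable (leb2pi \<Otimes>\<^sub>M leb2pi)"
        using borel_measurable_times[OF measurable_compose[OF measurable_fst hm] km] by (simp add: case_prod_beta')
      have i: "integrable leb2pi (\<lambda>x. g x * indicator {t..} x)" for t
      proof (rule Bochner_Integration.integrable_bound[OF gi])
        have "(indicator {t..} :: real \<Rightarrow> real) \<in> borel_measurable leb2pi"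
          by (intro measurable_restrict_space1 borel_measurable_indicator) simp
        with gm show "(\<lambda>x. g x * indicator {t..} x) \<in> borel_measurable leb2pi"
          by (rule borel_measurable_times)
      qed (simp add: indicator_def)
      then show "AE t in leb2pi. integrable leb2pi (\<lambda>x. case_prod ?f (t, x))" by simp
      show "integrable leb2pi (\<lambda>t. \<integral>x. norm (case_prod ?f (t, x)) \<partial>leb2pi)"
      proof (rule Bochner_Integration.integrable_bound)
        show "integrable leb2pi (\<lambda>t. h t * (\<integral>x. \<bar>g x\<bar> \<partial>leb2pi))" using L2_integrable[OF hL2] by simp
        show "(\<lambda>t. \<integral>x. norm (case_prod ?f (t, x)) \<partial>leb2pi) \<in> borel_measurable leb2pi"
          using m by (intro leb.borel_measurable_lebesgue_integral) (simp add: case_prod_beta')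
        have "(\<integral>x. norm (case_prod ?f (t, x)) \<partial>leb2pi) \<le> \<bar>h t\<bar> * (\<integral>x. \<bar>g x\<bar> \<partial>leb2pi)" for t
        proof -
          have "(\<integral>x. norm (case_prod ?f (t, x)) \<partial>leb2pi) = \<bar>h t\<bar> * (\<integral>x. \<bar>g x * indicator {t..} x\<bar> \<partial>leb2pi)"
            by (simp add: abs_mult)
          also have "\<dots> \<le> \<bar>h t\<bar> * (\<integral>x. \<bar>g x\<bar> \<partial>leb2pi)"
            by (intro mult_left_mono integral_mono_AE' gi AE_I2) (auto simp: indicator_def)
          finally show ?thesis .
        qed
        moreover have "0 \<le> (\<integral>x. \<bar>g x\<bar> \<partial>leb2pi)" by simp
        ultimately show "AE t in leb2pi. norm (\<integral>x. norm (case_prod ?f (t, x)) \<partial>leb2pi) \<le> norm (h t * (\<integral>x. \<bar>g x\<bar> \<partial>leb2pi))"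
          by (intro AE_I2) (simp add: abs_mult)
      qed
    qed
    have "(\<integral>x. g x * \<phi> x \<partial>leb2pi) = (\<integral>x. (\<integral>t. ?f t x \<partial>leb2pi) \<partial>leb2pi)"
    proof (rule Bochner_Integration.integral_cong[OF refl])
      fix x assume "x \<in> space leb2pi"
      then have x: "0 \<le> x" "x \<le> 2*pi" by (auto simp: space_restrict_space)
      have "(\<integral>t. ?f t x \<partial>leb2pi) = (\<integral>t. g x * (h t * indicator {..x} t) \<partial>leb2pi)"
        by (intro Bochner_Integration.integral_cong) (auto simp: indicator_def)
      then show "g x * \<phi> x = (\<integral>t. ?f t x \<partial>leb2pi)" using \<phi>(3)[OF x] by simp
    qed
    also have "\<dots> = (\<integral>t. (\<integral>x. ?f t x \<partial>leb2pi) \<partial>leb2pi)"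
      by (rule P.Fubini_integral[OF int])
    also have "\<dots> = (\<integral>t. H t * h t \<partial>leb2pi)" by (simp add: H_def mult.commute)
    finally have "(\<integral>x. g x * \<phi> x \<partial>leb2pi) = (\<integral>t. H t * h t \<partial>leb2pi)" .
    moreover have "(\<integral>x. u x * h x \<partial>leb2pi) = - (\<integral>x. g x * \<phi> x \<partial>leb2pi)"
      using ug \<phi>(1,2) by (auto simp: has_weak_deriv_def)
    ultimately show ?thesis
      using L2_integrable_mult[OF u hL2] L2_integrable_mult[OF HL2 hL2] by (simp add: distrib_right)
  qed
  obtain \<eta> where \<eta>: "test_fun \<eta>" "(\<integral>x. \<eta> x \<partial>leb2pi) = 1" by (rule test_fun_unit_mass)
  define w where "w x = u x + H x" for x
  have wL2: "w \<in> L2" unfolding w_def[abs_def] by (rule L2_add[OF u HL2])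
  define c where "c = (\<integral>x. w x * \<eta> x \<partial>leb2pi)"
  have "AE x in leb2pi. w x - c = 0"
  proof (rule weak_zero_AE)
    show "(\<lambda>x. w x - c) \<in> L2" by (rule L2_diff[OF wL2 L2_const])
    fix \<psi> assume \<psi>: "test_fun \<psi>"
    obtain a b where ab: "0 < a" "a \<le> b" "b < 2*pi" "\<And>x. x \<notin> {a..b} \<Longrightarrow> \<psi> x = 0"
      by (rule test_fun_support[OF \<psi>]) blast
    obtain a' b' where ab': "0 < a'" "a' \<le> b'" "b' < 2*pi" "\<And>x. x \<notin> {a'..b'} \<Longrightarrow> \<eta> x = 0"
      by (rule test_fun_support[OF \<eta>(1)]) blast
    \<comment> \<open>\<open>\<psi> - m \<eta>\<close> has mean zero, so it is admissible in
      \<open>key\<close>; the part \<open>m \<eta>\<close> accounts for the constant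
      \<open>c\<close>.\<close>
    define m where "m = (\<integral>x. \<psi> x \<partial>leb2pi)"
    note L = test_fun_L2(1)[OF \<psi>] test_fun_L2(1)[OF \<eta>(1)]
    have "(\<integral>x. (u x + H x) * (\<psi> x - m * \<eta> x) \<partial>leb2pi) = 0"
    proof (rule key[of _ "min a a'" "max b b'"])
      show "continuous_on UNIV (\<lambda>x. \<psi> x - m * \<eta> x)"
        by (intro continuous_intros test_funD(3) \<psi> \<eta>(1))
      show "(\<integral>x. \<psi> x - m * \<eta> x \<partial>leb2pi) = 0"
        using L[THEN L2_integrable] \<eta>(2) by (simp add: m_def)
      show "\<psi> x - m * \<eta> x = 0" if "x \<notin> {min a a'..max b b'}" for x
      proof -
        have "x \<notin> {a..b}" "x \<notin> {a'..b'}" using that by auto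
        then show ?thesis by (simp add: ab(4) ab'(4))
      qed
    qed (use ab ab' in auto)
    then have "(\<integral>x. w x * \<psi> x - m * (w x * \<eta> x) \<partial>leb2pi) = 0"
      by (simp add: w_def algebra_simps)
    then have "(\<integral>x. w x * \<psi> x \<partial>leb2pi) = m * c"
      using L2_integrable_mult[OF wL2 L(1)] L2_integrable_mult[OF wL2 L(2)] by (simp add: c_def)
    then show "(\<integral>x. (w x - c) * \<psi> x \<partial>leb2pi) = 0"
      using L2_integrable_mult[OF wL2 L(1)] L2_integrable[OF L(1)] by (simp add: left_diff_distrib m_def)
  qed
  then have "AE t in leb2pi. u t = c - (\<integral>x. g x * indicator {t..} x \<partial>leb2pi)"
    by eventually_elim (simp add: w_def H_def)
  then show ?thesis using HL2 unfolding H_def[abs_def] by (rule that)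
qed

text \<open>Zero mean identifies the constant of integration with the mean of the tail integral H.
  Both are at most the L1 norm of the derivative, which explains the factor 2, and
  \<open>L1_le_L2\<close> passes to the Sobolev norm.\<close>

lemma W12_sup_bound:
  assumes u: "u \<in> W12" and mean: "(\<integral>x. u x \<partial>leb2pi) = 0"
  shows "AE x in leb2pi. \<bar>u x\<bar> \<le> 2 * sqrt (2 * pi * W12_inner u u)"
proof -
  define g where "g = wderiv u"
  have g: "g \<in> L2" "has_weak_deriv u g" using wderiv[OF u] by (auto simp: g_def)
  define H where "H t = (\<integral>x. g x * indicator {t..} x \<partial>leb2pi)" for t
  obtain c where c: "AE t in leb2pi. u t = c - H t" and HL2: "H \<in> L2"
    using weak_deriv_primitive[OF W12_L2[OF u] g] unfolding H_def by blast
  define M where "M = (\<integral>x. \<bar>g x\<bar> \<partial>leb2pi)"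
  have gi: "integrable leb2pi (\<lambda>x. \<bar>g x\<bar>)" using L2_integrable[OF g(1)] by simp
  have HM: "\<bar>H t\<bar> \<le> M" for t
  proof -
    have "\<bar>H t\<bar> \<le> (\<integral>x. \<bar>g x * indicator {t..} x\<bar> \<partial>leb2pi)"
      unfolding H_def by (rule integral_abs_bound)
    also have "\<dots> \<le> M"
      unfolding M_def by (intro integral_mono_AE' gi AE_I2) (auto simp: indicator_def)
    finally show ?thesis .
  qed
  have "(\<integral>x. u x \<partial>leb2pi) = (\<integral>x. c - H x \<partial>leb2pi)"
    using c L2_measurable[OF W12_L2[OF u]] L2_measurable[OF HL2] by (intro integral_cong_AE) auto
  also have "\<dots> = 2 * pi * c - (\<integral>x. H x \<partial>leb2pi)"
    using L2_integrable[OF HL2] L2_integrable[OF L2_const[of c]] LINT_const[of c]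
    by (simp del: lebesgue_integral_const)
  finally have "2 * pi * c = (\<integral>x. H x \<partial>leb2pi)" using mean by simp
  moreover have "\<bar>\<integral>x. H x \<partial>leb2pi\<bar> \<le> (\<integral>x. M \<partial>leb2pi)"
    by (rule order_trans[OF integral_abs_bound LINT_le_AE])
       (use L2_integrable[OF HL2] L2_integrable[OF L2_const[of M]] HM in auto)
  ultimately have "2 * pi * \<bar>c\<bar> \<le> 2 * pi * M" using LINT_const[of M] by (metis abs_mult abs_of_pos pi_gt_zero mult_pos_pos zero_less_numeral)
  then have cM: "\<bar>c\<bar> \<le> M" by simp
  have "M \<le> sqrt (2 * pi * (\<integral>x. (g x)\<^sup>2 \<partial>leb2pi))"
    unfolding M_def by (rule real_le_rsqrt[OF L1_le_L2[OF g(1)]])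
  also have "\<dots> \<le> sqrt (2 * pi * W12_inner u u)"
  proof -
    have "0 \<le> (\<integral>x. u x * u x \<partial>leb2pi)" by simp
    then show ?thesis by (simp add: W12_inner_def g_def power2_eq_square)
  qed
  finally have M: "M \<le> sqrt (2 * pi * W12_inner u u)" .
  from c show ?thesis
  proof eventually_elim
    case (elim t)
    then show ?case using HM[of t] cM M by linarith
  qed
qed

section \<open>Cosine series in \<open>Y\<close>\<close>

text \<open>The weak derivative is the L2 limit of the differentiated partial sums, which are Cauchy
  by orthogonality of the sines. With T the weighted sum of squares, the constant 10 is 8 + 2: twice
  4 pi T for the derivative and twice pi T for the function, the doubling coming from
  \<open>L2_limit_bound\<close>.\<close>

theorem cosseries_Yfun:
  assumes d2: "summable (\<lambda>n. (real (Suc n) * d n)\<^sup>2)"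
  shows "cosseries d \<in> Yfun" (is ?Y)
    and "W12_inner (cosseries d) (cosseries d) \<le> 10 * pi * (\<Sum>n. (real (Suc n) * d n)\<^sup>2)" (is ?W)
proof -
  note d1 = summable_weighted[OF d2]
  define T where "T = (\<Sum>n. (real (Suc n) * d n)\<^sup>2)"
  have T: "(\<Sum>n\<in>I. (real (Suc n) * d n)\<^sup>2) \<le> T" if "finite I" for I
    unfolding T_def by (rule sum_le_suminf[OF d2 that]) auto
  define a where "a n = - (2 * real (Suc n)) * d n" for n
  have a2: "(a n)\<^sup>2 = 4 * (real (Suc n) * d n)\<^sup>2" for n
    by (simp add: a_def power2_eq_square algebra_simps)
  define s where "s N x = (\<Sum>n<N. a n * sinn n x)" for N x
  have sL2: "s N \<in> L2" for N
    unfolding s_def[abs_def] by (intro L2_sum L2_scale sinn_L2)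
  have s_diff: "(\<integral>x. (s i x - s j x)\<^sup>2 \<partial>leb2pi) = 4 * pi * (\<Sum>n=j..<i. (real (Suc n) * d n)\<^sup>2)" if "j \<le> i" for i j
  proof -
    have "s i x - s j x = (\<Sum>n=j..<i. a n * sinn n x)" for x
      unfolding s_def lessThan_atLeast0 using sum.atLeastLessThan_concat[of 0 j i "\<lambda>n. a n * sinn n x"] that by simp
    then show ?thesis
      using orth_sum_sq[OF sinn_L2 sinn_orth, of "{j..<i}" a] by (simp add: a2 sum_distrib_left mult_ac)
  qed
  have "\<exists>N. \<forall>i\<ge>N. \<forall>j\<ge>N. (\<integral>x. (s i x - s j x)\<^sup>2 \<partial>leb2pi) < e" if e: "e > 0" for e
  proof -
    obtain N where N: "\<And>m n. m \<ge> N \<Longrightarrow> norm (\<Sum>k=m..<n. (real (Suc k) * d k)\<^sup>2) < e / (4 * pi)"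
      using d2 e unfolding summable_Cauchy by (metis divide_pos_pos mult_pos_pos pi_gt_zero zero_less_numeral)
    have *: "(\<integral>x. (s i x - s j x)\<^sup>2 \<partial>leb2pi) < e" if "i \<ge> N" "j \<ge> N" "j \<le> i" for i j
    proof -
      have "0 \<le> (\<Sum>k=j..<i. (real (Suc k) * d k)\<^sup>2)" by (intro sum_nonneg) simp
      with N[OF that(2), of i] have "(\<Sum>k=j..<i. (real (Suc k) * d k)\<^sup>2) < e / (4 * pi)" by simp
      then show ?thesis unfolding s_diff[OF that(3)] by (simp add: pos_less_divide_eq mult.commute)
    qed
    have "(\<integral>x. (s i x - s j x)\<^sup>2 \<partial>leb2pi) < e" if "i \<ge> N" "j \<ge> N" for i j
      using *[OF that] *[OF that(2,1)] by (cases "j \<le> i") (auto simp: power2_commute)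
    then show ?thesis by blast
  qed
  from L2_complete[OF sL2 this]
  obtain g where g: "g \<in> L2" "(\<lambda>n. \<integral>x. (s n x - g x)\<^sup>2 \<partial>leb2pi) \<longlonglongrightarrow> 0" by blast
  have "(\<integral>x. (s N x)\<^sup>2 \<partial>leb2pi) \<le> 4 * pi * T" for N
    using s_diff[of 0 N] T[of "{0..<N}"] by (simp add: s_def)
  from L2_limit_bound[OF sL2 g this] have g_bound: "(\<integral>x. (g x)\<^sup>2 \<partial>leb2pi) \<le> 8 * pi * T" by simp
  have f: "cosseries d \<in> L2" by (rule cosseries_L2[OF d1])
  have weak: "has_weak_deriv (cosseries d) g"
    unfolding has_weak_deriv_def
  proof (intro allI impI)
    fix \<phi> assume \<phi>: "test_fun \<phi>"
    note \<phi>D = test_funD[OF \<phi>]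
    note \<phi>L = test_fun_L2[OF \<phi>]
    \<comment> \<open>Integration by parts; the boundary terms vanish because \<open>\<phi>\<close>
      does at both ends.\<close>
    have parts: "(\<integral>x. deriv \<phi> x * cosn n x \<partial>leb2pi) = (2 * real (Suc n)) * (\<integral>x. sinn n x * \<phi> x \<partial>leb2pi)" for n
    proof -
      define q where "q = 2 * real (Suc n)"
      have "(\<integral>x. deriv \<phi> x * cosn n x + (- q * sinn n x) * \<phi> x \<partial>leb2pi)
          = \<phi> (2*pi) * cosn n (2*pi) - \<phi> 0 * cosn n 0"
      proof (rule LINT_FTC)
        show "((\<lambda>x. \<phi> x * cosn n x) has_real_derivative deriv \<phi> x * cosn n x + (- q * sinn n x) * \<phi> x) (at x)" for x
          unfolding q_def by (rule DERIV_mult[OF \<phi>D(1) cosn_deriv])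
        show "continuous_on UNIV (\<lambda>x. deriv \<phi> x * cosn n x + (- q * sinn n x) * \<phi> x)"
          by (intro continuous_intros \<phi>D continuous_cosn continuous_sinn)
      qed
      then show ?thesis
        using L2_integrable_mult[OF \<phi>L(2) cosn_L2[of n]] L2_integrable_mult[OF sinn_L2[of n] \<phi>L(1)]
        unfolding q_def[symmetric] by (simp add: \<phi>D(4,5) mult.assoc)
    qed
    have "(\<lambda>n. d n * (\<integral>x. deriv \<phi> x * cosn n x \<partial>leb2pi)) sums (\<integral>x. deriv \<phi> x * cosseries d x \<partial>leb2pi)"
      unfolding cosseries_def by (rule LINT_cosseries_mult[OF d1 \<phi>L(2) cosn_le1 cosn_L2])
    then have lim1: "(\<lambda>N. \<Sum>n<N. d n * (\<integral>x. deriv \<phi> x * cosn n x \<partial>leb2pi)) \<longlonglongrightarrow> (\<integral>x. deriv \<phi> x * cosseries d x \<partial>leb2pi)"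
      by (simp add: sums_def)
    have eq: "(\<Sum>n<N. d n * (\<integral>x. deriv \<phi> x * cosn n x \<partial>leb2pi)) = - (\<integral>x. s N x * \<phi> x \<partial>leb2pi)" for N
    proof -
      have "(\<integral>x. s N x * \<phi> x \<partial>leb2pi) = (\<integral>x. (\<Sum>n<N. a n * (sinn n x * \<phi> x)) \<partial>leb2pi)"
        unfolding s_def by (simp add: sum_distrib_right mult.assoc)
      also have "\<dots> = (\<Sum>n<N. a n * (\<integral>x. sinn n x * \<phi> x \<partial>leb2pi))"
        using L2_integrable_mult[OF sinn_L2 \<phi>L(1)] by (simp add: Bochner_Integration.integral_sum)
      also have "\<dots> = - (\<Sum>n<N. d n * (\<integral>x. deriv \<phi> x * cosn n x \<partial>leb2pi))"
        unfolding parts a_def sum_negf[symmetric] by (intro sum.cong refl) (simp only: mult_ac minus_mult_left minus_mult_right)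
      finally show ?thesis by simp
    qed
    obtain a b where ab: "0 < a" "a \<le> b" "b < 2*pi" "\<And>x. x \<notin> {a..b} \<Longrightarrow> \<phi> x = 0"
      by (rule test_fun_support[OF \<phi>]) blast
    obtain C where C: "\<And>x. \<bar>\<phi> x\<bar> \<le> C"
      using continuous_compact_support_bounded[OF \<phi>D(3) compact_Icc, of a b] ab(4) by blast
    have "(\<lambda>N. (\<integral>x. s N x * \<phi> x \<partial>leb2pi) - (\<integral>x. g x * \<phi> x \<partial>leb2pi)) \<longlonglongrightarrow> 0"
    proof (rule Lim_null_comparison[where g="\<lambda>N. C * (\<integral>x. \<bar>s N x - g x\<bar> \<partial>leb2pi)"])
      have "norm ((\<integral>x. s N x * \<phi> x \<partial>leb2pi) - (\<integral>x. g x * \<phi> x \<partial>leb2pi)) \<le> C * (\<integral>x. \<bar>s N x - g x\<bar> \<partial>leb2pi)" for N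
      proof -
        have "(\<integral>x. s N x * \<phi> x \<partial>leb2pi) - (\<integral>x. g x * \<phi> x \<partial>leb2pi) = (\<integral>x. (s N x - g x) * \<phi> x \<partial>leb2pi)"
          using L2_integrable_mult[OF sL2 \<phi>L(1)] L2_integrable_mult[OF g(1) \<phi>L(1)] by (simp add: left_diff_distrib)
        also have "norm \<dots> \<le> (\<integral>x. \<bar>(s N x - g x) * \<phi> x\<bar> \<partial>leb2pi)"
          unfolding real_norm_def by (rule integral_abs_bound)
        also have "\<dots> \<le> (\<integral>x. C * \<bar>s N x - g x\<bar> \<partial>leb2pi)"
        proof (rule LINT_le_AE)
          have "\<bar>(s N x - g x) * \<phi> x\<bar> \<le> C * \<bar>s N x - g x\<bar>" for x
            using mult_right_mono[OF C[of x] abs_ge_zero[of "s N x - g x"]] by (simp add: abs_mult mult.commute)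
          then show "AE x in leb2pi. \<bar>(s N x - g x) * \<phi> x\<bar> \<le> C * \<bar>s N x - g x\<bar>" by simp
        qed (use L2_integrable_mult[OF L2_diff[OF sL2 g(1)] \<phi>L(1)] L2_integrable[OF L2_diff[OF sL2 g(1)]] in auto)
        finally show ?thesis by simp
      qed
      then show "\<forall>\<^sub>F N in sequentially. norm ((\<integral>x. s N x * \<phi> x \<partial>leb2pi) - (\<integral>x. g x * \<phi> x \<partial>leb2pi)) \<le> C * (\<integral>x. \<bar>s N x - g x\<bar> \<partial>leb2pi)"
        by simp
      show "(\<lambda>N. C * (\<integral>x. \<bar>s N x - g x\<bar> \<partial>leb2pi)) \<longlonglongrightarrow> 0"
        by (rule tendsto_mult_right_zero[OF L2_tendsto_L1[OF sL2 g]])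
    qed
    then have "(\<lambda>N. - (\<integral>x. s N x * \<phi> x \<partial>leb2pi)) \<longlonglongrightarrow> - (\<integral>x. g x * \<phi> x \<partial>leb2pi)"
      by (intro tendsto_minus) (simp add: LIM_zero_iff)
    with lim1 have "(\<integral>x. deriv \<phi> x * cosseries d x \<partial>leb2pi) = - (\<integral>x. g x * \<phi> x \<partial>leb2pi)"
      unfolding eq by (rule LIMSEQ_unique)
    then show "(\<integral>x. cosseries d x * deriv \<phi> x \<partial>leb2pi) = - (\<integral>x. g x * \<phi> x \<partial>leb2pi)"
      by (simp add: mult.commute)
  qed
  have W: "cosseries d \<in> W12" using f g(1) weak by (auto simp: W12_def)
  show ?Y unfolding Yfun_def using W LINT_cosseries[OF d1] by (simp add: cosseries_sym[OF d1])
  have "(\<lambda>N. \<integral>x. ((\<Sum>n<N. d n * cosn n x) - cosseries d x)\<^sup>2 \<partial>leb2pi) \<longlonglongrightarrow> 0"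
  proof (rule LIMSEQ_I)
    fix e :: real assume e: "e > 0"
    define \<epsilon> where "\<epsilon> = sqrt (e / (4 * pi))"
    have \<epsilon>: "\<epsilon> > 0" "\<epsilon>\<^sup>2 = e / (4 * pi)" using e by (auto simp: \<epsilon>_def)
    obtain N where N: "\<And>n x. n \<ge> N \<Longrightarrow> dist (\<Sum>n<n. d n * cosn n x) (cosseries d x) < \<epsilon>"
      using cosseries_uniform[OF d1] \<epsilon>(1) unfolding uniform_limit_iff eventually_sequentially by blast
    have "norm ((\<integral>x. ((\<Sum>n<m. d n * cosn n x) - cosseries d x)\<^sup>2 \<partial>leb2pi) - 0) < e" if "m \<ge> N" for m
    proof -
      have "(\<integral>x. ((\<Sum>n<m. d n * cosn n x) - cosseries d x)\<^sup>2 \<partial>leb2pi) \<le> (\<integral>x. \<epsilon>\<^sup>2 \<partial>leb2pi)"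
      proof (rule LINT_le_AE)
        have "((\<Sum>n<m. d n * cosn n x) - cosseries d x)\<^sup>2 \<le> \<epsilon>\<^sup>2" for x
          using N[OF that, of x] by (simp add: dist_real_def abs_le_square_iff[symmetric])
        then show "AE x in leb2pi. ((\<Sum>n<m. d n * cosn n x) - cosseries d x)\<^sup>2 \<le> \<epsilon>\<^sup>2" by simp
        show "integrable leb2pi (\<lambda>x. ((\<Sum>n<m. d n * cosn n x) - cosseries d x)\<^sup>2)"
          by (intro L2D L2_diff f L2_sum L2_scale cosn_L2)
      qed (rule L2_integrable[OF L2_const])
      also have "\<dots> = e / 2" using LINT_const[of "\<epsilon>\<^sup>2"] \<epsilon>(2) by (simp del: lebesgue_integral_const)
      finally show ?thesis using e by simp
    qed
    then show "\<exists>N. \<forall>m\<ge>N. norm ((\<integral>x. ((\<Sum>n<m. d n * cosn n x) - cosseries d x)\<^sup>2 \<partial>leb2pi) - 0) < e" by blast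
  qed
  moreover have "(\<integral>x. (\<Sum>n<N. d n * cosn n x)\<^sup>2 \<partial>leb2pi) \<le> pi * T" for N
  proof -
    have "(\<Sum>n<N. (d n)\<^sup>2) \<le> (\<Sum>n<N. (real (Suc n) * d n)\<^sup>2)"
    proof (rule sum_mono)
      fix n
      have "1 * (d n)\<^sup>2 \<le> (real (Suc n))\<^sup>2 * (d n)\<^sup>2" by (intro mult_right_mono) (auto intro: one_le_power)
      then show "(d n)\<^sup>2 \<le> (real (Suc n) * d n)\<^sup>2" by (simp add: power_mult_distrib)
    qed
    also have "\<dots> \<le> T" by (rule T) simp
    finally show ?thesis
      using orth_sum_sq[OF cosn_L2 cosn_orth, of "{..<N}" d] by simp
  qed
  ultimately have f_bound: "(\<integral>x. (cosseries d x)\<^sup>2 \<partial>leb2pi) \<le> 2 * (pi * T)"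
    by (intro L2_limit_bound[OF _ f]) (auto intro!: L2_sum L2_scale cosn_L2)
  have "(\<integral>x. wderiv (cosseries d) x * wderiv (cosseries d) x \<partial>leb2pi) = (\<integral>x. g x * g x \<partial>leb2pi)"
    by (intro integral_mult_cong_AE wderiv_L2 W g(1) wderiv_AE_eqI weak)
  with f_bound g_bound show ?W
    unfolding W12_inner_def T_def[symmetric] by (simp add: power2_eq_square)
qed

section \<open>Cosine multipliers on \<open>Y\<close>\<close>

lemma eq_Y_rep_abs: "f \<in> Yfun \<Longrightarrow> eq_Y (rep_Y (abs_Y f)) f"
  by (intro Quotient3_rep_abs[OF Quotient3_Y]) (simp add: eq_Y_def)

lemma rep_Y_Yfun: "rep_Y u \<in> Yfun"
  using Quotient3_rep_reflp[OF Quotient3_Y, of u] by (simp add: eq_Y_def)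

lemma abs_rep_Y: "abs_Y (rep_Y u) = u"
  by (rule Quotient3_abs_rep[OF Quotient3_Y])

lemma abs_Y_eqI: "f \<in> Yfun \<Longrightarrow> g \<in> Yfun \<Longrightarrow> (AE x in leb2pi. f x = g x) \<Longrightarrow> abs_Y f = abs_Y g"
  by (intro Quotient3_rel_abs[OF Quotient3_Y]) (simp add: eq_Y_def)

lemma AE_rep_abs: "f \<in> Yfun \<Longrightarrow> AE x in leb2pi. rep_Y (abs_Y f) x = f x"
  using eq_Y_rep_abs by (simp add: eq_Y_def)

lemma Yfun_L2: "u \<in> Yfun \<Longrightarrow> u \<in> L2"
  by (intro W12_L2 Yfun_W12)

lemma rep_Y_L2: "rep_Y u \<in> L2"
  by (intro Yfun_L2 rep_Y_Yfun)

lemma abs_Y_add: "f \<in> Yfun \<Longrightarrow> g \<in> Yfun \<Longrightarrow> abs_Y f + abs_Y g = abs_Y (\<lambda>x. f x + g x)"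
  by (intro plus_Y.abs_eq) (simp_all add: eq_Y_def)

lemma abs_Y_diff: "f \<in> Yfun \<Longrightarrow> g \<in> Yfun \<Longrightarrow> abs_Y f - abs_Y g = abs_Y (\<lambda>x. f x - g x)"
  by (intro minus_Y.abs_eq) (simp_all add: eq_Y_def)

lemma abs_Y_scale: "f \<in> Yfun \<Longrightarrow> r *\<^sub>R abs_Y f = abs_Y (\<lambda>x. r * f x)"
  by (intro scaleR_Y.abs_eq) (simp_all add: eq_Y_def)

lemma Yfun_diff: "u \<in> Yfun \<Longrightarrow> v \<in> Yfun \<Longrightarrow> (\<lambda>x. u x - v x) \<in> Yfun"
  using Yfun_add[OF _ Yfun_scale[of v "-1"]] by simp

lemma AE_rep_add: "AE x in leb2pi. rep_Y (u + v) x = rep_Y u x + rep_Y v x"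
  using AE_rep_abs[OF Yfun_add[OF rep_Y_Yfun[of u] rep_Y_Yfun[of v]]]
  by (simp add: abs_Y_add[OF rep_Y_Yfun rep_Y_Yfun, symmetric] abs_rep_Y)

lemma AE_rep_diff: "AE x in leb2pi. rep_Y (u - v) x = rep_Y u x - rep_Y v x"
  using AE_rep_abs[OF Yfun_diff[OF rep_Y_Yfun[of u] rep_Y_Yfun[of v]]]
  by (simp add: abs_Y_diff[OF rep_Y_Yfun rep_Y_Yfun, symmetric] abs_rep_Y)

lemma AE_rep_scale: "AE x in leb2pi. rep_Y (r *\<^sub>R u) x = r * rep_Y u x"
  using AE_rep_abs[OF Yfun_scale[OF rep_Y_Yfun[of u], of r]]
  by (simp add: abs_Y_scale[OF rep_Y_Yfun, symmetric] abs_rep_Y)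

lemma zero_Y_abs: "(0::Y) = abs_Y (\<lambda>_. 0)"
  unfolding zero_Y_def ..

lemma norm_Y_eq: "norm u = sqrt (W12_inner (rep_Y u) (rep_Y u))"
  by (simp add: norm_eq_sqrt_inner inner_Y.rep_eq)

lemma norm_abs_Y: "f \<in> Yfun \<Longrightarrow> norm (abs_Y f) = sqrt (W12_inner f f)"
  by (simp add: norm_eq_sqrt_inner inner_Y.abs_eq eq_Y_def)

lemma L2_le_norm: "(\<integral>x. (rep_Y u x)\<^sup>2 \<partial>leb2pi) \<le> (norm u)\<^sup>2"
proof -
  have "0 \<le> (\<integral>x. wderiv (rep_Y u) x * wderiv (rep_Y u) x \<partial>leb2pi)" by simp
  then show ?thesis
    unfolding norm_Y_eq real_sqrt_pow2[OF W12_inner_ge0] by (simp add: W12_inner_def power2_eq_square)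
qed

text \<open>The constant 6 is 2 times 3, where 3 bounds the square root of 2 pi.\<close>

lemma sup_le_norm: "AE x in leb2pi. \<bar>rep_Y u x\<bar> \<le> 6 * norm u"
proof -
  have "AE x in leb2pi. \<bar>rep_Y u x\<bar> \<le> 2 * sqrt (2 * pi * W12_inner (rep_Y u) (rep_Y u))"
    using rep_Y_Yfun[of u] by (intro W12_sup_bound) (auto simp: Yfun_def)
  moreover have "sqrt (2 * pi) \<le> sqrt (3\<^sup>2)" using pi_less_4 by (intro real_sqrt_le_mono) simp
  then have "sqrt (2 * pi) * norm u \<le> 3 * norm u" by (intro mult_right_mono) auto
  then have "2 * sqrt (2 * pi * W12_inner (rep_Y u) (rep_Y u)) \<le> 6 * norm u"
    by (simp add: norm_Y_eq real_sqrt_mult mult_ac)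
  ultimately show ?thesis by (auto elim: eventually_mono)
qed

section \<open>Cosine coefficients as bounded functionals, and multipliers with decaying
  symbol\<close>

lemma cos_coeff_add: "u \<in> L2 \<Longrightarrow> v \<in> L2 \<Longrightarrow> cos_coeff n (\<lambda>x. u x + v x) = cos_coeff n u + cos_coeff n v"
  by (simp add: cos_coeff_def distrib_right L2_integrable_mult cosn_L2 add_divide_distrib)

lemma cos_coeff_scale: "cos_coeff n (\<lambda>x. r * u x) = r * cos_coeff n u"
  by (simp add: cos_coeff_def mult.assoc)

lemma cos_coeff_cong: "u \<in> L2 \<Longrightarrow> v \<in> L2 \<Longrightarrow> (AE x in leb2pi. u x = v x) \<Longrightarrow> cos_coeff n u = cos_coeff n v"
  by (drule (2) integral_mult_cong_AE[OF _ _ cosn_L2 cosn_L2 _ AE_I2[OF refl], of _ _ n]) (simp add: cos_coeff_def)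

definition hat :: "nat \<Rightarrow> Y \<Rightarrow> real" where "hat n u = cos_coeff n (rep_Y u)"

lemma bounded_linear_hat: "bounded_linear (hat n)"
proof (rule bounded_linear_intro)
  fix u v :: Y and r :: real
  show "hat n (u + v) = hat n u + hat n v"
    unfolding hat_def cos_coeff_add[OF rep_Y_L2 rep_Y_L2, symmetric]
    by (intro cos_coeff_cong rep_Y_L2 L2_add AE_rep_add)
  show "hat n (r *\<^sub>R u) = r *\<^sub>R hat n u"
    unfolding hat_def real_scaleR_def cos_coeff_scale[symmetric]
    by (intro cos_coeff_cong rep_Y_L2 L2_scale AE_rep_scale)
  have "1 * (hat n u)\<^sup>2 \<le> pi * (hat n u)\<^sup>2" using pi_gt3 by (intro mult_right_mono) auto
  also have "\<dots> \<le> (norm u)\<^sup>2"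
    using bessel[OF rep_Y_L2, of "{n}" u] L2_le_norm[of u] by (simp add: hat_def)
  finally show "norm (hat n u) \<le> norm u * 1" by (simp add: abs_le_square_iff[symmetric])
qed

lemmas hat_simps = linear_add[OF bounded_linear.linear[OF bounded_linear_hat]]
  linear_diff[OF bounded_linear.linear[OF bounded_linear_hat]]
  linear_scale[OF bounded_linear.linear[OF bounded_linear_hat]]
  linear_0[OF bounded_linear.linear[OF bounded_linear_hat]]

text \<open>Fourier multiplier with symbol \<open>b\<close>. It acts on functions in
  \<open>L2\<close> rather than on \<open>Y\<close> because \<open>gibbs u\<close> has mean -1 and
  so is no element of \<open>Y\<close>; the absent zero mode discards that mean.\<close>

definition mult :: "(nat \<Rightarrow> real) \<Rightarrow> (real \<Rightarrow> real) \<Rightarrow> real \<Rightarrow> real" where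
  "mult b w = cosseries (\<lambda>n. b n * cos_coeff n w)"

definition mult_Y :: "(nat \<Rightarrow> real) \<Rightarrow> (real \<Rightarrow> real) \<Rightarrow> Y" where
  "mult_Y b w = abs_Y (mult b w)"

text \<open>Decay of order 1/n of the symbol is a gain of one derivative: such multipliers map
  \<open>L2\<close> boundedly into \<open>Y\<close>.\<close>

locale smoothing =
  fixes b :: "nat \<Rightarrow> real" and C :: real
  assumes C: "\<And>n. real (Suc n) * \<bar>b n\<bar> \<le> C"
begin

lemma C_nonneg: "C \<ge> 0"
  using C[of 0] by (smt (verit) abs_ge_zero mult_nonneg_nonneg of_nat_0_le_iff)

lemma weighted:
  assumes "w \<in> L2"
  shows weighted_summable: "summable (\<lambda>n. (real (Suc n) * (b n * cos_coeff n w))\<^sup>2)"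
    and weighted_bound: "pi * (\<Sum>n. (real (Suc n) * (b n * cos_coeff n w))\<^sup>2) \<le> C\<^sup>2 * (\<integral>x. (w x)\<^sup>2 \<partial>leb2pi)"
proof -
  have le: "(real (Suc n) * (b n * cos_coeff n w))\<^sup>2 \<le> C\<^sup>2 * (cos_coeff n w)\<^sup>2" for n
  proof -
    have "(real (Suc n) * \<bar>b n\<bar>)\<^sup>2 \<le> C\<^sup>2" by (intro power_mono C) auto
    then have "(real (Suc n) * \<bar>b n\<bar>)\<^sup>2 * (cos_coeff n w)\<^sup>2 \<le> C\<^sup>2 * (cos_coeff n w)\<^sup>2" by (intro mult_right_mono) auto
    then show ?thesis by (simp add: power_mult_distrib mult.assoc)
  qed
  have part: "(\<Sum>n<N. (real (Suc n) * (b n * cos_coeff n w))\<^sup>2) \<le> C\<^sup>2 * (\<integral>x. (w x)\<^sup>2 \<partial>leb2pi) / pi" for N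
  proof -
    have "(\<Sum>n<N. (real (Suc n) * (b n * cos_coeff n w))\<^sup>2) \<le> C\<^sup>2 * (\<Sum>n<N. (cos_coeff n w)\<^sup>2)"
      unfolding sum_distrib_left by (intro sum_mono le)
    also have "\<dots> \<le> C\<^sup>2 * ((\<integral>x. (w x)\<^sup>2 \<partial>leb2pi) / pi)"
      using bessel[OF assms, of "{..<N}"] by (intro mult_left_mono) (auto simp: field_simps)
    finally show ?thesis by simp
  qed
  show s: "summable (\<lambda>n. (real (Suc n) * (b n * cos_coeff n w))\<^sup>2)"
    by (rule bounded_imp_summable[where B="C\<^sup>2 * (\<integral>x. (w x)\<^sup>2 \<partial>leb2pi) / pi"])
       (use part[of "Suc _"] in \<open>auto simp: lessThan_Suc_atMost\<close>)
  have "(\<Sum>n. (real (Suc n) * (b n * cos_coeff n w))\<^sup>2) \<le> C\<^sup>2 * (\<integral>x. (w x)\<^sup>2 \<partial>leb2pi) / pi"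
    by (rule suminf_le_const[OF s part])
  then show "pi * (\<Sum>n. (real (Suc n) * (b n * cos_coeff n w))\<^sup>2) \<le> C\<^sup>2 * (\<integral>x. (w x)\<^sup>2 \<partial>leb2pi)"
    by (simp add: field_simps)
qed

lemma abs_summable: "w \<in> L2 \<Longrightarrow> summable (\<lambda>n. \<bar>b n * cos_coeff n w\<bar>)"
  by (intro summable_weighted weighted_summable)

lemma mult_Yfun: "w \<in> L2 \<Longrightarrow> mult b w \<in> Yfun"
  unfolding mult_def by (intro cosseries_Yfun weighted_summable)

lemma norm_mult_Y:
  assumes "w \<in> L2" shows "(norm (mult_Y b w))\<^sup>2 \<le> 10 * C\<^sup>2 * (\<integral>x. (w x)\<^sup>2 \<partial>leb2pi)"
proof -
  have "(norm (mult_Y b w))\<^sup>2 = W12_inner (mult b w) (mult b w)"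
    unfolding mult_Y_def norm_abs_Y[OF mult_Yfun[OF assms]] by (rule real_sqrt_pow2[OF W12_inner_ge0])
  also have "\<dots> \<le> 10 * pi * (\<Sum>n. (real (Suc n) * (b n * cos_coeff n w))\<^sup>2)"
    unfolding mult_def by (rule cosseries_Yfun(2)[OF weighted_summable[OF assms]])
  finally show ?thesis using weighted_bound[OF assms] by simp
qed

text \<open>The squared constant 10 * 2 pi is at most 80, hence below the square of 9.\<close>

lemma norm_mult_Y_sup:
  assumes w: "w \<in> L2" and e: "e \<ge> 0" and "AE x in leb2pi. \<bar>w x\<bar> \<le> e"
  shows "norm (mult_Y b w) \<le> 9 * C * e"
proof (rule power2_le_imp_le)
  have "(\<integral>x. (w x)\<^sup>2 \<partial>leb2pi) \<le> (\<integral>x. e\<^sup>2 \<partial>leb2pi)"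
  proof (rule LINT_le_AE[OF L2D[OF w] L2_integrable[OF L2_const]])
    show "AE x in leb2pi. (w x)\<^sup>2 \<le> e\<^sup>2"
      using assms(3) by eventually_elim (use e in \<open>simp add: abs_le_square_iff[symmetric]\<close>)
  qed
  then have "(\<integral>x. (w x)\<^sup>2 \<partial>leb2pi) \<le> 2 * pi * e\<^sup>2" by (simp only: LINT_const)
  also have "\<dots> \<le> 8 * e\<^sup>2" using pi_less_4 by (intro mult_right_mono) auto
  finally have "10 * C\<^sup>2 * (\<integral>x. (w x)\<^sup>2 \<partial>leb2pi) \<le> 10 * C\<^sup>2 * (8 * e\<^sup>2)" by (intro mult_left_mono) auto
  also have "\<dots> = 80 * (C * e)\<^sup>2" by (simp add: power_mult_distrib)
  also have "\<dots> \<le> 81 * (C * e)\<^sup>2" by simp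
  also have "\<dots> = (9 * C * e)\<^sup>2" by (simp add: power_mult_distrib)
  finally show "(norm (mult_Y b w))\<^sup>2 \<le> (9 * C * e)\<^sup>2" using norm_mult_Y[OF w] by linarith
qed (use C_nonneg e in simp)

lemma mult_add:
  assumes "u \<in> L2" "v \<in> L2" shows "mult b (\<lambda>x. u x + v x) = (\<lambda>x. mult b u x + mult b v x)"
proof
  fix x
  have "(\<lambda>n. b n * cos_coeff n u * cosn n x + b n * cos_coeff n v * cosn n x) sums (mult b u x + mult b v x)"
    unfolding mult_def by (intro sums_add cosseries_sums abs_summable assms)
  then show "mult b (\<lambda>x. u x + v x) x = mult b u x + mult b v x"
    using assms by (simp add: mult_def cosseries_def cos_coeff_add algebra_simps sums_iff)
qed

lemma mult_scale:
  assumes "u \<in> L2" shows "mult b (\<lambda>x. r * u x) = (\<lambda>x. r * mult b u x)"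
proof
  fix x
  have "(\<lambda>n. r * (b n * cos_coeff n u * cosn n x)) sums (r * mult b u x)"
    unfolding mult_def by (intro sums_mult cosseries_sums abs_summable assms)
  then show "mult b (\<lambda>x. r * u x) x = r * mult b u x"
    by (simp add: mult_def cosseries_def cos_coeff_scale mult_ac sums_iff)
qed

lemma mult_Y_add: "u \<in> L2 \<Longrightarrow> v \<in> L2 \<Longrightarrow> mult_Y b (\<lambda>x. u x + v x) = mult_Y b u + mult_Y b v"
  unfolding mult_Y_def by (simp add: mult_add abs_Y_add mult_Yfun)

lemma mult_Y_scale: "u \<in> L2 \<Longrightarrow> mult_Y b (\<lambda>x. r * u x) = r *\<^sub>R mult_Y b u"
  unfolding mult_Y_def by (simp add: mult_scale abs_Y_scale mult_Yfun)

lemma mult_Y_diff: "u \<in> L2 \<Longrightarrow> v \<in> L2 \<Longrightarrow> mult_Y b (\<lambda>x. u x - v x) = mult_Y b u - mult_Y b v"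
  using mult_Y_add[OF _ L2_scale[of v "-1"], of u] mult_Y_scale[of v "-1"] by simp

lemma mult_Y_cong: "u \<in> L2 \<Longrightarrow> v \<in> L2 \<Longrightarrow> (AE x in leb2pi. u x = v x) \<Longrightarrow> mult_Y b u = mult_Y b v"
  unfolding mult_Y_def mult_def by (subst cos_coeff_cong[of u v]) auto

lemma cos_coeff_mult: "w \<in> L2 \<Longrightarrow> cos_coeff n (mult b w) = b n * cos_coeff n w"
  unfolding mult_def by (rule cos_coeff_cosseries[OF abs_summable])

lemma hat_mult_Y: "w \<in> L2 \<Longrightarrow> hat n (mult_Y b w) = b n * cos_coeff n w"
  unfolding hat_def mult_Y_def cos_coeff_mult[symmetric]
  by (intro cos_coeff_cong rep_Y_L2 Yfun_L2[OF mult_Yfun] AE_rep_abs[OF mult_Yfun])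

lemma bounded_linear_mult_Y: "bounded_linear (\<lambda>u. mult_Y b (rep_Y u))"
proof (rule bounded_linear_intro)
  fix u v :: Y and r :: real
  show "mult_Y b (rep_Y (u + v)) = mult_Y b (rep_Y u) + mult_Y b (rep_Y v)"
    unfolding mult_Y_add[OF rep_Y_L2 rep_Y_L2, symmetric] by (intro mult_Y_cong rep_Y_L2 L2_add AE_rep_add)
  show "mult_Y b (rep_Y (r *\<^sub>R u)) = r *\<^sub>R mult_Y b (rep_Y u)"
    unfolding mult_Y_scale[OF rep_Y_L2, symmetric] by (intro mult_Y_cong rep_Y_L2 L2_scale AE_rep_scale)
  show "norm (mult_Y b (rep_Y u)) \<le> norm u * (9 * C * 6)"
    using norm_mult_Y_sup[OF rep_Y_L2 _ sup_le_norm[of u]] by (simp add: mult_ac)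
qed

end

section \<open>The Gibbs map\<close>

definition mean_exp :: "(real \<Rightarrow> real) \<Rightarrow> real" where
  "mean_exp u = (\<integral>t. exp (- u t) \<partial>leb2pi) / (2 * pi)"

text \<open>With the minus sign the linear part at 0 is +u, and the accompanying symbol
  \<open>a\<close> is positive.\<close>

definition gibbs :: "(real \<Rightarrow> real) \<Rightarrow> real \<Rightarrow> real" where
  "gibbs u t = - exp (- u t) / mean_exp u"

lemma exp_measurable:
  assumes "u \<in> borel_measurable leb2pi"
  shows "(\<lambda>t. exp (- u t) :: real) \<in> borel_measurable leb2pi"
  by (rule borel_measurable_exp[THEN measurable_compose[OF borel_measurable_uminus[OF assms]]])

lemma exp_L2:
  assumes "u \<in> borel_measurable leb2pi" "AE x in leb2pi. \<bar>u x\<bar> \<le> M" shows "(\<lambda>t. exp (- u t)) \<in> L2"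
proof (rule AE_bounded_L2[of _ "exp M"])
  show "AE x in leb2pi. \<bar>exp (- u x)\<bar> \<le> exp M" using assms(2) by eventually_elim simp
qed (intro exp_measurable assms)

text \<open>Jensen's inequality in its simplest form: integrate 1 - u \<le> exp (-u). It keeps all
  later denominators at least 1.\<close>

lemma mean_exp_ge1:
  assumes "u \<in> borel_measurable leb2pi" "AE x in leb2pi. \<bar>u x\<bar> \<le> M" "(\<integral>x. u x \<partial>leb2pi) = 0"
  shows "mean_exp u \<ge> 1"
proof -
  note uL = L2_integrable[OF AE_bounded_L2[OF assms(1,2)]]
  note i1 = L2_integrable[OF L2_const[of 1]]
  have "2 * pi = (\<integral>x. 1 - u x \<partial>leb2pi)"
    using LINT_const[of 1] assms(3) Bochner_Integration.integral_diff[OF i1 uL] by simp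
  also have "\<dots> \<le> (\<integral>x. exp (- u x) \<partial>leb2pi)"
  proof (rule LINT_le_AE)
    show "AE x in leb2pi. 1 - u x \<le> exp (- u x)"
      using exp_ge_add_one_self[of "- u _"] by (intro AE_I2) simp
    show "integrable leb2pi (\<lambda>x. 1 - u x)" by (rule Bochner_Integration.integrable_diff[OF i1 uL])
  qed (rule L2_integrable[OF exp_L2[OF assms(1,2)]])
  finally show ?thesis by (simp add: mean_exp_def)
qed

lemma exp_minus_one_le: "exp (M::real) - 1 \<le> M * exp M"
  using mult_right_mono[OF exp_ge_add_one_self[of "-M"] exp_ge_zero[of M]]
  by (simp add: exp_minus algebra_simps)

text \<open>Mean value inequality for exp (-x) + x, whose derivative 1 - exp (-x) has absolute value
  at most M exp M on [-M, M].\<close>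

lemma exp_taylor_lip:
  fixes a b M :: real
  assumes "\<bar>a\<bar> \<le> M" "\<bar>b\<bar> \<le> M"
  shows "\<bar>exp (- a) - exp (- b) + (a - b)\<bar> \<le> M * exp M * \<bar>a - b\<bar>"
proof -
  let ?f = "\<lambda>x::real. exp (- x) + x"
  have "norm (?f a - ?f b) \<le> (M * exp M) * norm (a - b)"
  proof (rule field_differentiable_bound[of "{-M..M}" ?f "\<lambda>x. 1 - exp (- x)"])
    show "(?f has_field_derivative 1 - exp (- z)) (at z within {- M..M})" for z
      by (auto intro!: derivative_eq_intros)
    fix z assume z: "z \<in> {-M..M}"
    have M1: "M * 1 \<le> M * exp M" using z by (intro mult_left_mono) auto
    have "exp (- z) \<le> exp M" using z by simp
    moreover have "1 - exp (- z) \<le> z" using exp_ge_add_one_self[of "- z"] by simp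
    moreover have "z \<le> M" using z by simp
    ultimately show "norm (1 - exp (- z)) \<le> M * exp M"
      using exp_minus_one_le[of M] M1 unfolding real_norm_def by linarith
  qed (use assms in auto)
  then show ?thesis by (simp add: algebra_simps)
qed

lemma gibbs_L2:
  assumes "u \<in> borel_measurable leb2pi" "AE x in leb2pi. \<bar>u x\<bar> \<le> M" shows "gibbs u \<in> L2"
  using L2_scale[OF exp_L2[OF assms], of "- 1 / mean_exp u"] by (simp add: gibbs_def[abs_def])

text \<open>The factor M in the Lipschitz constant of the remainder is the point: with M comparable
  to the size of the arguments, it makes the nonlinear part quadratic.\<close>

lemma gibbs_estimate:
  assumes u: "u \<in> borel_measurable leb2pi" "AE x in leb2pi. \<bar>u x\<bar> \<le> M" "(\<integral>x. u x \<partial>leb2pi) = 0"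
    and w: "w \<in> borel_measurable leb2pi" "AE x in leb2pi. \<bar>w x\<bar> \<le> M" "(\<integral>x. w x \<partial>leb2pi) = 0"
    and d: "AE x in leb2pi. \<bar>u x - w x\<bar> \<le> d" and M: "M \<ge> 0" "d \<ge> 0"
  shows "AE x in leb2pi. \<bar>gibbs u x - gibbs w x - (u x - w x)\<bar> \<le> 3 * M * exp (2 * M) * d"
proof -
  define E where "E = exp M"
  have E: "E \<ge> 1" "exp (2 * M) = E * E" using M by (auto simp: E_def exp_add[symmetric])
  note uL = AE_bounded_L2[OF u(1,2)] and wL = AE_bounded_L2[OF w(1,2)]
  note eu = exp_L2[OF u(1,2)] and ew = exp_L2[OF w(1,2)]
  define q where "q x = exp (- u x) - exp (- w x) + (u x - w x)" for x
  have qL: "q \<in> L2" unfolding q_def[abs_def] by (intro L2_add L2_diff eu ew uL wL)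
  have q: "AE x in leb2pi. \<bar>q x\<bar> \<le> M * E * d"
    using u(2) w(2) d
  proof eventually_elim
    case (elim x)
    have "\<bar>q x\<bar> \<le> M * E * \<bar>u x - w x\<bar>"
      unfolding q_def E_def by (rule exp_taylor_lip[OF elim(1,2)])
    also have "\<dots> \<le> M * E * d" using elim(3) M E by (intro mult_left_mono) auto
    finally show ?case .
  qed
  have "(\<integral>x. q x \<partial>leb2pi) = (\<integral>x. exp (- u x) \<partial>leb2pi) - (\<integral>x. exp (- w x) \<partial>leb2pi)"
    unfolding q_def using eu ew uL wL u(3) w(3) by (simp add: L2_integrable)
  then have qm: "(\<integral>x. q x \<partial>leb2pi) = 2 * pi * (mean_exp u - mean_exp w)"
    by (simp add: mean_exp_def right_diff_distrib)
  have "\<bar>\<integral>x. q x \<partial>leb2pi\<bar> \<le> (\<integral>x. \<bar>q x\<bar> \<partial>leb2pi)" by (rule integral_abs_bound)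
  also have "\<dots> \<le> (\<integral>x. M * E * d \<partial>leb2pi)"
    by (intro LINT_le_AE q L2_integrable L2_const L2_abs qL)
  also have "\<dots> = 2 * pi * (M * E * d)" by (rule LINT_const)
  finally have m_diff: "\<bar>mean_exp u - mean_exp w\<bar> \<le> M * E * d"
    unfolding qm by (simp add: abs_mult)
  have mu: "mean_exp u \<ge> 1" and mw: "mean_exp w \<ge> 1" using mean_exp_ge1 u w by blast+
  have "(\<integral>x. exp (- u x) \<partial>leb2pi) \<le> (\<integral>x. E \<partial>leb2pi)"
    by (rule LINT_le_AE[OF L2_integrable[OF eu] L2_integrable[OF L2_const]])
       (use u(2) in \<open>eventually_elim, simp add: E_def\<close>)
  then have "mean_exp u \<le> E"
    unfolding LINT_const by (simp add: mean_exp_def divide_le_eq mult.commute)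
  then have mu1: "mean_exp u - 1 \<le> M * E" using exp_minus_one_le[of M] by (simp add: E_def)
  show ?thesis using u(2) w(2) d q
  proof eventually_elim
    case (elim x)
    let ?mu = "mean_exp u" and ?mw = "mean_exp w"
    \<comment> \<open>Three sources of error: the Taylor remainder \<open>q\<close>, the deviation
      of the mean of exp (-u) from 1, and the difference of the two means. Each is at most M E^2 d
      with E = exp M, whence 3 and exp (2 M).\<close>
    have "gibbs u x - gibbs w x - (u x - w x)
        = - (q x / ?mu) + (u x - w x) * (1 / ?mu - 1) + exp (- w x) * (1 / ?mw - 1 / ?mu)"
      unfolding gibbs_def q_def by (simp add: add_divide_distrib diff_divide_distrib algebra_simps)
    also have "\<bar>\<dots>\<bar> \<le> \<bar>q x\<bar> / ?mu + \<bar>u x - w x\<bar> * \<bar>1 / ?mu - 1\<bar> + exp (- w x) * \<bar>1 / ?mw - 1 / ?mu\<bar>"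
      using mu by (intro order_trans[OF abs_triangle_ineq] add_mono) (auto simp: abs_mult)
    also have "\<dots> \<le> M * E * d + d * (M * E) + E * (M * E * d)"
    proof (intro add_mono mult_mono)
      have "\<bar>q x\<bar> / ?mu \<le> \<bar>q x\<bar> / 1" using mu by (intro divide_left_mono) auto
      then show "\<bar>q x\<bar> / ?mu \<le> M * E * d" using elim(4) by simp
      have "\<bar>1 / ?mu - 1\<bar> = (?mu - 1) / ?mu" using mu by (simp add: field_simps)
      also have "\<dots> \<le> (?mu - 1) / 1" using mu by (intro divide_left_mono) auto
      finally show "\<bar>1 / ?mu - 1\<bar> \<le> M * E" using mu1 by simp
      show "exp (- w x) \<le> E" using elim(2) by (simp add: E_def)
      have "\<bar>1 / ?mw - 1 / ?mu\<bar> = \<bar>?mu - ?mw\<bar> / (?mu * ?mw)"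
        using mu mw by (simp add: field_simps abs_divide abs_mult)
      also have "\<dots> \<le> \<bar>?mu - ?mw\<bar> / 1"
        using mu mw mult_mono[OF mu mw] by (intro divide_left_mono) auto
      finally show "\<bar>1 / ?mw - 1 / ?mu\<bar> \<le> M * E * d" using m_diff by simp
    qed (use elim M E in auto)
    also have "\<dots> \<le> 3 * (M * (E * E) * d)"
    proof -
      have "M * E * d * 1 \<le> M * E * d * E" using M E by (intro mult_left_mono) auto
      then show ?thesis by (simp add: algebra_simps)
    qed
    finally show ?case unfolding E(2) by (simp add: algebra_simps)
  qed
qed

text \<open>Stands in for completeness of \<open>Y\<close>. The limit is not claimed to lie in
  \<open>Y\<close>; measurability, boundedness and zero mean are what \<open>gibbs_estimate\<close>
  asks for.\<close>

lemma Cauchy_Y_uniform_limit: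
  fixes X :: "nat \<Rightarrow> Y"
  assumes X: "Cauchy X"
  obtains w M where "w \<in> borel_measurable leb2pi" "AE x in leb2pi. \<bar>w x\<bar> \<le> M" "(\<integral>x. w x \<partial>leb2pi) = 0"
    "\<And>n. AE x in leb2pi. \<bar>rep_Y (X n) x\<bar> \<le> M"
    "\<And>e. e > 0 \<Longrightarrow> \<exists>N. \<forall>n\<ge>N. AE x in leb2pi. \<bar>rep_Y (X n) x - w x\<bar> \<le> e"
proof -
  obtain S where S: "\<And>n. norm (X n) \<le> S"
    using Cauchy_Bseq[OF X] unfolding Bseq_def by blast
  define M where "M = 6 * S"
  have XM: "AE x in leb2pi. \<bar>rep_Y (X n) x\<bar> \<le> M" for n
    using sup_le_norm[of "X n"] by eventually_elim (use S[of n] in \<open>simp add: M_def\<close>)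
  have diff: "AE x in leb2pi. \<bar>rep_Y (X m) x - rep_Y (X n) x\<bar> \<le> 6 * norm (X m - X n)" for m n
    using sup_le_norm[of "X m - X n"] AE_rep_diff[of "X m" "X n"] by eventually_elim simp
  define w where "w x = lim (\<lambda>n. rep_Y (X n) x)" for x
  have Xm: "rep_Y (X n) \<in> borel_measurable leb2pi" for n by (rule L2_measurable[OF rep_Y_L2])
  have wm: "w \<in> borel_measurable leb2pi"
    unfolding w_def[abs_def] by (rule borel_measurable_lim_metric[OF Xm])
  \<comment> \<open>Countably many a.e. statements share one null set, outside which every sequence
    of values is Cauchy.\<close>
  have all: "AE x in leb2pi. \<forall>m n. \<bar>rep_Y (X m) x - rep_Y (X n) x\<bar> \<le> 6 * norm (X m - X n)"
    using diff by (simp add: AE_all_countable)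
  have lim: "AE x in leb2pi. (\<lambda>n. rep_Y (X n) x) \<longlonglongrightarrow> w x"
    using all
  proof eventually_elim
    case (elim x)
    have "Cauchy (\<lambda>n. rep_Y (X n) x)"
    proof (rule CauchyI)
      fix e :: real assume "e > 0"
      then obtain N where N: "\<And>m n. m \<ge> N \<Longrightarrow> n \<ge> N \<Longrightarrow> norm (X m - X n) < e / 6"
        using CauchyD[OF X, of "e / 6"] by auto
      have "norm (rep_Y (X m) x - rep_Y (X n) x) < e" if "m \<ge> N" "n \<ge> N" for m n
        using N[OF that] elim[rule_format, of m n] by simp
      then show "\<exists>N. \<forall>m\<ge>N. \<forall>n\<ge>N. norm (rep_Y (X m) x - rep_Y (X n) x) < e" by blast
    qed
    then show ?case unfolding w_def by (simp add: Cauchy_convergent_iff convergent_LIMSEQ_iff)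
  qed
  have conv: "\<exists>N. \<forall>n\<ge>N. AE x in leb2pi. \<bar>rep_Y (X n) x - w x\<bar> \<le> e" if e: "e > 0" for e
  proof -
    obtain N where N: "\<And>m n. m \<ge> N \<Longrightarrow> n \<ge> N \<Longrightarrow> norm (X m - X n) < e / 6"
      using CauchyD[OF X, of "e / 6"] e by auto
    have "AE x in leb2pi. \<bar>rep_Y (X n) x - w x\<bar> \<le> e" if n: "n \<ge> N" for n
      using all lim
    proof eventually_elim
      case (elim x)
      show ?case
      proof (rule tendsto_upperbound)
        show "(\<lambda>m. \<bar>rep_Y (X n) x - rep_Y (X m) x\<bar>) \<longlonglongrightarrow> \<bar>rep_Y (X n) x - w x\<bar>"
          by (intro tendsto_intros elim(2))
        have "\<bar>rep_Y (X n) x - rep_Y (X m) x\<bar> \<le> e" if "m \<ge> N" for m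
          using N[OF n that] elim(1)[rule_format, of n m] by simp
        then show "\<forall>\<^sub>F m in sequentially. \<bar>rep_Y (X n) x - rep_Y (X m) x\<bar> \<le> e"
          unfolding eventually_sequentially by blast
      qed simp
    qed
    then show ?thesis by blast
  qed
  have wM: "AE x in leb2pi. \<bar>w x\<bar> \<le> M"
  proof -
    have "AE x in leb2pi. \<forall>n. \<bar>rep_Y (X n) x\<bar> \<le> M" using XM by (simp add: AE_all_countable)
    then show ?thesis using lim
    proof eventually_elim
      case (elim x)
      show ?case
        by (rule tendsto_upperbound[OF tendsto_rabs[OF elim(2)]]) (use elim(1) in auto)
    qed
  qed
  note wL = AE_bounded_L2[OF wm wM]
  have "\<bar>\<integral>x. w x \<partial>leb2pi\<bar> \<le> 0"
  proof (rule field_le_epsilon)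
    fix e :: real assume e: "e > 0"
    then obtain n where n: "AE x in leb2pi. \<bar>rep_Y (X n) x - w x\<bar> \<le> e / (2 * pi)"
      using conv[of "e / (2 * pi)"] by auto
    have "(\<integral>x. rep_Y (X n) x \<partial>leb2pi) = 0" using rep_Y_Yfun[of "X n"] by (simp add: Yfun_def)
    then have "\<bar>\<integral>x. w x \<partial>leb2pi\<bar> = \<bar>\<integral>x. rep_Y (X n) x - w x \<partial>leb2pi\<bar>"
      using L2_integrable[OF rep_Y_L2] L2_integrable[OF wL] by simp
    also have "\<dots> \<le> (\<integral>x. \<bar>rep_Y (X n) x - w x\<bar> \<partial>leb2pi)" by (rule integral_abs_bound)
    also have "\<dots> \<le> (\<integral>x. e / (2 * pi) \<partial>leb2pi)"
      by (intro LINT_le_AE n L2_integrable L2_const L2_abs L2_diff rep_Y_L2 wL)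
    also have "\<dots> = e" unfolding LINT_const by simp
    finally show "\<bar>\<integral>x. w x \<partial>leb2pi\<bar> \<le> 0 + e" by simp
  qed
  then show ?thesis using that[OF wm wM _ XM conv] by simp
qed

section \<open>Reflection symmetry\<close>

lemma LINT_reflect:
  fixes f :: "real \<Rightarrow> real"
  assumes "integrable leb2pi f"
  shows "integrable leb2pi (\<lambda>x. f (2*pi - x))" "(\<integral>x. f (2*pi - x) \<partial>leb2pi) = (\<integral>x. f x \<partial>leb2pi)"
proof -
  have "has_bochner_integral leb2pi f (\<integral>x. f x \<partial>leb2pi)" using assms by (rule has_bochner_integral_integrable)
  then have "has_bochner_integral lebesgue (\<lambda>x. indicator {0..2*pi} x *\<^sub>R f x) (\<integral>x. f x \<partial>leb2pi)"
    by (simp add: has_bochner_integral_restrict_space)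
  then have "has_bochner_integral lebesgue (\<lambda>x. indicator {0..2*pi} (2*pi + (-1) * x) *\<^sub>R f (2*pi + (-1) * x)) ((\<integral>x. f x \<partial>leb2pi) /\<^sub>R \<bar>-1\<bar>)"
    by (subst (asm) has_bochner_integral_lebesgue_real_affine_iff[where c="-1" and t="2*pi"]) auto
  moreover have "indicator {0..2*pi} (2*pi + (-1) * x) = (indicator {0..2*pi} x :: real)" for x
    by (auto simp: indicator_def)
  ultimately have "has_bochner_integral leb2pi (\<lambda>x. f (2*pi - x)) (\<integral>x. f x \<partial>leb2pi)"
    by (simp add: has_bochner_integral_restrict_space)
  then show "integrable leb2pi (\<lambda>x. f (2*pi - x))" "(\<integral>x. f (2*pi - x) \<partial>leb2pi) = (\<integral>x. f x \<partial>leb2pi)"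
    by (simp_all add: has_bochner_integral_iff)
qed

text \<open>For 0 < x \<le> 2 pi the point 2 pi - x is already reduced, so \<open>rmod\<close> does
  nothing; x = 0 is a null set.\<close>

lemma Yfun_reflect:
  assumes "u \<in> Yfun" shows "AE x in leb2pi. u x = u (2*pi - x)"
proof -
  have "{0} \<in> null_sets lebesgue"
    by (intro null_sets_completionI finite_imp_null_set_lborel) simp
  then have "AE x in lebesgue. x \<notin> {0}" by (rule AE_not_in)
  then have "AE x in leb2pi. 0 < x \<and> x \<le> 2*pi"
    by (subst AE_restrict_space_iff) (auto elim: eventually_mono)
  moreover have "AE x in leb2pi. u x = u ((2*pi - x) rmod (2*pi))"
    using assms by (simp add: Yfun_def)
  ultimately show ?thesis
  proof eventually_elim
    case (elim x)
    have "\<lfloor>(2*pi - x) / \<bar>2*pi\<bar>\<rfloor> = 0"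
      using elim(1) by (intro floor_unique) (auto simp: field_simps)
    then show ?case using elim(2) by (simp add: rmod_def)
  qed
qed

text \<open>The sines are odd under x \<mapsto> 2 pi - x. This removes the sine half of the addition
  formula in the convolution with \<open>K\<close>.\<close>

lemma LINT_sinn_reflect:
  assumes w: "w \<in> L2" and sym: "AE x in leb2pi. w x = w (2*pi - x)"
  shows "(\<integral>x. w x * sinn n x \<partial>leb2pi) = 0"
proof -
  have i: "integrable leb2pi (\<lambda>x. w x * sinn n x)" by (rule L2_integrable_mult[OF w sinn_L2])
  have s: "sinn n (2*pi - x) = - sinn n x" for x
    using sinn_periodic[of n "-x" 1] by (simp add: sinn_minus)
  have "(\<integral>x. w x * sinn n x \<partial>leb2pi) = (\<integral>x. w (2*pi - x) * sinn n (2*pi - x) \<partial>leb2pi)"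
    by (rule LINT_reflect(2)[OF i, symmetric])
  also have "\<dots> = (\<integral>x. - (w x * sinn n x) \<partial>leb2pi)"
  proof (rule integral_cong_AE)
    show "AE x in leb2pi. w (2*pi - x) * sinn n (2*pi - x) = - (w x * sinn n x)"
      using sym by eventually_elim (simp add: s)
  qed (use LINT_reflect(1)[OF i] i in auto)
  finally show ?thesis by simp
qed

text \<open>In hyperbolic terms this is 2 tanh (M/2) \<le> M. It follows with h = M/2 from h cosh h
  - sinh h \<ge> 0, a function vanishing at 0 with derivative h sinh h.\<close>

lemma two_tanh_half_le:
  fixes M :: real
  assumes "M \<ge> 0"
  shows "2 * (exp M + exp (- M) - 2) \<le> M * (exp M - exp (- M))"
proof -
  define f where "f h = h * (exp h + exp (- h)) - (exp h - exp (- h))" for h :: real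
  have "f 0 \<le> f (M / 2)"
  proof (rule DERIV_nonneg_imp_nondecreasing[of 0 "M / 2" f])
    fix h :: real assume h: "0 \<le> h" "h \<le> M / 2"
    have "(f has_real_derivative h * (exp h - exp (- h))) (at h)"
      unfolding f_def[abs_def] by (auto intro!: derivative_eq_intros simp: algebra_simps)
    moreover have "h * (exp h - exp (- h)) \<ge> 0" using h by (intro mult_nonneg_nonneg) auto
    ultimately show "\<exists>y. (f has_real_derivative y) (at h) \<and> 0 \<le> y" by blast
  qed (use assms in simp)
  then have f: "exp (M/2) - exp (- (M/2)) \<le> M / 2 * (exp (M/2) + exp (- (M/2)))"
    by (simp add: f_def)
  have e: "exp M = exp (M/2) * exp (M/2)" "exp (- M) = exp (- (M/2)) * exp (- (M/2))" "exp (M/2) * exp (- (M/2)) = 1"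
    by (simp_all add: exp_add[symmetric])
  have "2 * (exp M + exp (- M) - 2) = 2 * (exp (M/2) - exp (- (M/2))) * (exp (M/2) - exp (- (M/2)))"
    using e(3) unfolding e(1,2) by (simp add: algebra_simps)
  also have "\<dots> \<le> 2 * (M / 2 * (exp (M/2) + exp (- (M/2)))) * (exp (M/2) - exp (- (M/2)))"
    using f assms by (intro mult_right_mono mult_left_mono) auto
  also have "\<dots> = M * (exp M - exp (- M))" unfolding e(1,2) by (simp add: algebra_simps)
  finally show ?thesis .
qed

text \<open>Bounding \<open>\<bar>w - m\<bar>\<close> by its chord on \<open>[exp (-M), exp M]\<close> gives the sharp factor \<open>2 tanh (M/2) \<le> M\<close>,
  which is what makes the contraction argument work for all \<open>\<lambda> < 1 / \<parallel>K\<parallel>\<close>.\<close>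

lemma exp_mean_deviation:
  assumes u: "u \<in> borel_measurable leb2pi" "AE x in leb2pi. \<bar>u x\<bar> \<le> M" "(\<integral>x. u x \<partial>leb2pi) = 0" and M: "M > 0"
  shows "(\<integral>x. \<bar>exp (- u x) - mean_exp u\<bar> \<partial>leb2pi) \<le> 2 * pi * mean_exp u * M"
proof -
  define a b m where "a = exp (- M)" and "b = exp M" and "m = mean_exp u"
  define w where "w x = exp (- u x)" for x
  have ab: "a < b" "a * b = 1" using M by (auto simp: a_def b_def exp_add[symmetric])
  have wL: "w \<in> L2" unfolding w_def[abs_def] by (rule exp_L2[OF u(1,2)])
  note wi = L2_integrable[OF wL] and ci = L2_integrable[OF L2_const]
  have wm: "(\<integral>x. w x \<partial>leb2pi) = 2 * pi * m" by (simp add: m_def mean_exp_def w_def)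
  have wab: "AE x in leb2pi. a \<le> w x \<and> w x \<le> b"
    using u(2) by eventually_elim (auto simp: a_def b_def w_def abs_le_iff)
  have "(\<integral>x. a \<partial>leb2pi) \<le> (\<integral>x. w x \<partial>leb2pi)" "(\<integral>x. w x \<partial>leb2pi) \<le> (\<integral>x. b \<partial>leb2pi)"
    using wab by (intro LINT_le_AE wi ci; eventually_elim; simp)+
  then have mab: "a \<le> m" "m \<le> b" unfolding wm LINT_const by simp_all
  \<comment> \<open>The integrand on the right is b - a times the chord of the convex function
    \<bar>w - m\<bar> over [a, b]; being affine in \<open>w\<close>, its integral depends only on
    the mean.\<close>
  have "(\<integral>x. (b - a) * \<bar>w x - m\<bar> \<partial>leb2pi) \<le> (\<integral>x. (b - m) * (w x - a) + (m - a) * (b - w x) \<partial>leb2pi)"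
  proof (rule LINT_le_AE)
    show "AE x in leb2pi. (b - a) * \<bar>w x - m\<bar> \<le> (b - m) * (w x - a) + (m - a) * (b - w x)"
      using wab
    proof eventually_elim
      case (elim x)
      have "0 \<le> 2 * ((m - a) * (b - w x))" "0 \<le> 2 * ((b - m) * (w x - a))" using elim mab by auto
      then show ?case
        by (cases "w x \<ge> m") (simp_all add: algebra_simps)
    qed
    show "integrable leb2pi (\<lambda>x. (b - a) * \<bar>w x - m\<bar>)"
      by (intro L2_integrable L2_scale L2_abs L2_diff wL L2_const)
    show "integrable leb2pi (\<lambda>x. (b - m) * (w x - a) + (m - a) * (b - w x))"
      by (intro L2_integrable L2_add L2_scale L2_diff wL L2_const)
  qed
  also have "\<dots> = (b - m) * ((\<integral>x. w x \<partial>leb2pi) - (\<integral>x. a \<partial>leb2pi)) + (m - a) * ((\<integral>x. b \<partial>leb2pi) - (\<integral>x. w x \<partial>leb2pi))"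
  proof -
    have "(\<integral>x. w x - a \<partial>leb2pi) = (\<integral>x. w x \<partial>leb2pi) - (\<integral>x. a \<partial>leb2pi)"
      "(\<integral>x. b - w x \<partial>leb2pi) = (\<integral>x. b \<partial>leb2pi) - (\<integral>x. w x \<partial>leb2pi)"
      by (intro Bochner_Integration.integral_diff wi ci)+
    moreover have "integrable leb2pi (\<lambda>x. w x - a)" "integrable leb2pi (\<lambda>x. b - w x)"
      by (intro L2_integrable L2_diff wL L2_const)+
    ultimately show ?thesis by simp
  qed
  also have "\<dots> = 2 * pi * (2 * ((b - m) * (m - a)))"
    unfolding wm LINT_const by (simp add: algebra_simps)
  also have "\<dots> \<le> 2 * pi * (M * m * (b - a))"
  proof (intro mult_left_mono)
    \<comment> \<open>Because a b = 1, (b - m) (m - a) = (a + b) m - m^2 - 1, and m^2 + 1 \<ge> 2 m: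
      relative to \<open>m\<close>, the worst mean is 1.\<close>
    have "0 \<le> (m - 1)\<^sup>2" by simp
    then have "(b - m) * (m - a) \<le> (a + b - 2) * m"
      using ab(2) by (simp add: power2_eq_square algebra_simps)
    then have "2 * ((b - m) * (m - a)) \<le> 2 * (a + b - 2) * m" by (simp only: mult.assoc mult_le_cancel_left_pos zero_less_numeral)
    also have "\<dots> \<le> M * (b - a) * m"
      using two_tanh_half_le[of M] M mab(1) unfolding a_def b_def
      by (intro mult_right_mono) (auto simp: algebra_simps intro: order_trans[OF exp_ge_zero])
    finally show "2 * ((b - m) * (m - a)) \<le> M * m * (b - a)" by (simp add: mult_ac)
  qed simp
  finally have "(b - a) * (\<integral>x. \<bar>w x - m\<bar> \<partial>leb2pi) \<le> (b - a) * (2 * pi * m * M)"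
    by (simp add: mult_ac)
  then show ?thesis using ab(1) by (simp add: w_def m_def)
qed

section \<open>Composition of cosine multipliers\<close>

text \<open>Only the products of symbol and coefficient matter, so a multiplier applied to the
  result of another can be rewritten as one multiplier with product symbol.\<close>

lemma mult_Y_eqI:
  assumes "\<And>n. b n * cos_coeff n w = b' n * cos_coeff n w'" shows "mult_Y b w = mult_Y b' w'"
  unfolding mult_Y_def mult_def using assms by simp

lemma mult_Y_add_symbol:
  assumes "smoothing b C" "smoothing b' C'" "w \<in> L2"
  shows "mult_Y (\<lambda>n. b n + b' n) w = mult_Y b w + mult_Y b' w"
proof -
  interpret b: smoothing b C by fact
  interpret b': smoothing b' C' by fact
  have "mult (\<lambda>n. b n + b' n) w = (\<lambda>x. mult b w x + mult b' w x)"
  proof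
    fix x
    have "(\<lambda>n. b n * cos_coeff n w * cosn n x + b' n * cos_coeff n w * cosn n x) sums (mult b w x + mult b' w x)"
      unfolding mult_def using assms(3) by (intro sums_add cosseries_sums b.abs_summable b'.abs_summable)
    then show "mult (\<lambda>n. b n + b' n) w x = mult b w x + mult b' w x"
      by (simp add: mult_def cosseries_def algebra_simps sums_iff)
  qed
  then show ?thesis
    using assms(3) by (simp add: mult_Y_def abs_Y_add b.mult_Yfun b'.mult_Yfun)
qed

lemma mult_Y_scale_symbol:
  assumes "smoothing b C" "w \<in> L2" shows "mult_Y (\<lambda>n. r * b n) w = r *\<^sub>R mult_Y b w"
proof -
  interpret b: smoothing b C by fact
  show ?thesis
    unfolding b.mult_Y_scale[OF assms(2), symmetric] by (rule mult_Y_eqI) (simp add: cos_coeff_scale)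
qed

lemma mult_Y_zero:
  assumes "\<And>n. b n * cos_coeff n w = 0" shows "mult_Y b w = 0"
proof -
  have "cosseries (\<lambda>n. b n * cos_coeff n w) = (\<lambda>_. 0)"
    unfolding assms by (simp add: cosseries_def[abs_def])
  then show ?thesis by (simp add: mult_Y_def mult_def zero_Y_abs)
qed

definition mode :: "nat \<Rightarrow> Y" where "mode j = abs_Y (cosn j)"

text \<open>Makes membership of a single mode in \<open>Y\<close> an instance of
  \<open>cosseries_Yfun\<close>.\<close>

lemma cosn_cosseries: "cosn j = cosseries (\<lambda>n. if n = j then 1 else 0)"
proof
  fix x
  have "(\<lambda>n. if n = j then cosn n x else 0) sums cosn j x" by (rule sums_single)
  then show "cosn j x = cosseries (\<lambda>n. if n = j then 1 else 0) x"
    by (simp add: cosseries_def sums_iff if_distrib[of "\<lambda>t. t * _"] cong: if_cong)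
qed

lemma cosn_Yfun: "cosn j \<in> Yfun"
proof -
  have "summable (\<lambda>n. (real (Suc n) * (if n = j then 1 else 0))\<^sup>2)"
    by (rule summable_finite[of "{j}"]) auto
  then show ?thesis unfolding cosn_cosseries by (rule cosseries_Yfun)
qed

lemma cos_coeff_cosn: "cos_coeff n (cosn j) = (if n = j then 1 else 0)"
  by (simp add: cos_coeff_def cosn_orth)

lemma hat_mode: "hat n (mode j) = (if n = j then 1 else 0)"
  unfolding hat_def mode_def cos_coeff_cosn[symmetric]
  by (intro cos_coeff_cong rep_Y_L2 cosn_L2 AE_rep_abs cosn_Yfun)

lemma mode_nonzero: "mode j \<noteq> 0"
  using hat_mode[of j j] hat_simps(4)[of j] by auto

lemma mult_Y_single: "mult_Y (\<lambda>n. if n = j then r else 0) w = (r * cos_coeff j w) *\<^sub>R mode j"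
proof -
  have "cosseries (\<lambda>n. (if n = j then r else 0) * cos_coeff n w) = (\<lambda>x. r * cos_coeff j w * cosn j x)"
  proof
    fix x
    have "(\<lambda>n. if n = j then r * cos_coeff n w * cosn n x else 0) sums (r * cos_coeff j w * cosn j x)"
      by (rule sums_single)
    then show "cosseries (\<lambda>n. (if n = j then r else 0) * cos_coeff n w) x = r * cos_coeff j w * cosn j x"
      by (simp add: cosseries_def sums_iff if_distrib[of "\<lambda>t. t * _"] cong: if_cong)
  qed
  then show ?thesis by (simp add: mult_Y_def mult_def mode_def abs_Y_scale[OF cosn_Yfun])
qed

section \<open>The operator \<open>\<Gamma>\<close>\<close>

locale cosine_kernel =
  fixes K :: "real \<Rightarrow> real" and k :: "nat \<Rightarrow> real"
  assumes K_sums: "\<And>\<theta>. (\<lambda>n. k (Suc n) * cos (2 * real (Suc n) * \<theta>)) sums K \<theta>"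
    and k_neg: "\<And>n. n \<ge> 1 \<Longrightarrow> k n < 0"
    and k_mono: "strict_mono_on {1..} k"
begin

text \<open>Convolution with \<open>K\<close> multiplies a cosine coefficient by pi times that of
  \<open>K\<close>, and the normalisation divides by 2 pi, which leaves 1/2; the sign compensates
  that of \<open>gibbs\<close>. The index is shifted: \<open>1 / a (n - 1)\<close> is \<lambda>_n
  for n \<ge> 1.\<close>

definition a :: "nat \<Rightarrow> real" where "a n = - k (Suc n) / 2"

lemma a_pos: "a n > 0"
  using k_neg[of "Suc n"] by (simp add: a_def)

lemma a_less: "m < n \<Longrightarrow> a n < a m"
  using strict_mono_onD[OF k_mono, of "Suc m" "Suc n"] by (simp add: a_def)

lemma a_le: "m \<le> n \<Longrightarrow> a n \<le> a m"
  using a_less[of m n] by (cases "m = n") auto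

lemma a_summable: "summable a"
proof -
  have "summable (\<lambda>n. k (Suc n))" using K_sums[of 0] by (simp add: sums_iff)
  then show ?thesis unfolding a_def[abs_def] by (intro summable_divide summable_minus)
qed

lemma K_at_0: "K 0 = - 2 * suminf a"
proof -
  have "(\<lambda>n. (-2) * a n) sums ((-2) * suminf a)" by (intro sums_mult summable_sums a_summable)
  moreover have "(\<lambda>n. (-2) * a n) sums K 0" using K_sums[of 0] by (simp add: a_def)
  ultimately show ?thesis by (metis sums_unique2)
qed

lemma k_abs_summable: "summable (\<lambda>n. \<bar>-2 * a n\<bar>)"
  using summable_mult[OF a_summable, of 2] a_pos by (simp add: abs_mult less_imp_le)

lemma K_cosseries: "K = cosseries (\<lambda>n. -2 * a n)"
  using K_sums by (auto simp: cosseries_def cosn_def a_def sums_iff)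

lemma K_le: "\<bar>K x\<bar> \<le> - K 0"
proof -
  have "\<bar>K x\<bar> \<le> (\<Sum>n. \<bar>-2 * a n * cosn n x\<bar>)"
    unfolding K_cosseries cosseries_def
    by (rule summable_rabs, rule summable_comparison_test'[OF k_abs_summable])
       (use norm_cosseries_term[of "\<lambda>n. -2 * a n"] k_abs_summable in auto)
  also have "\<dots> \<le> (\<Sum>n. \<bar>-2 * a n\<bar>)"
  proof (rule suminf_le)
    show "summable (\<lambda>n. \<bar>-2 * a n * cosn n x\<bar>)"
      by (rule summable_comparison_test'[OF k_abs_summable])
         (use norm_cosseries_term[of "\<lambda>n. -2 * a n"] k_abs_summable in auto)
  qed (use norm_cosseries_term[of "\<lambda>n. -2 * a n"] k_abs_summable in auto)
  also have "\<dots> = - K 0"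
    using suminf_mult[OF a_summable, of 2] a_pos by (simp add: K_at_0 abs_mult less_imp_le)
  finally show ?thesis .
qed

text \<open>For a decreasing positive sequence, (n + 1) a_n is at most a_0 + ... + a_n, hence at
  most the full sum.\<close>

sublocale a: smoothing a "suminf a"
proof
  fix n
  have "real (Suc n) * a n = (\<Sum>i<Suc n. a n)" by simp
  also have "\<dots> \<le> (\<Sum>i<Suc n. a i)" by (intro sum_mono a_le) auto
  also have "\<dots> \<le> suminf a" using a_pos by (intro sum_le_suminf a_summable) (auto intro: less_imp_le)
  finally show "real (Suc n) * \<bar>a n\<bar> \<le> suminf a" using a_pos[of n] by simp
qed

text \<open>The addition formula splits each translated cosine, and evenness of \<open>w\<close>
  kills the sine part. The factor -2 pi combines the coefficient -2 a_n of \<open>K\<close> with the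
  squared norm pi of the modes.\<close>

lemma K_convolution:
  assumes w: "w \<in> L2" and sym: "AE x in leb2pi. w x = w (2*pi - x)"
  shows "(\<integral>t. K (\<theta> - t) * w t \<partial>leb2pi) = - 2 * pi * mult a w \<theta>"
proof -
  have eq: "cosn n (\<theta> - t) = cosn n \<theta> * cosn n t + sinn n \<theta> * sinn n t" for n t
    by (simp add: cosn_def sinn_def right_diff_distrib cos_diff)
  have cL: "(\<lambda>t. cosn n (\<theta> - t)) \<in> L2" for n
    unfolding eq by (intro L2_add L2_scale cosn_L2 sinn_L2)
  have int: "(\<integral>t. w t * cosn n (\<theta> - t) \<partial>leb2pi) = pi * cos_coeff n w * cosn n \<theta>" for n
  proof -
    have "(\<integral>t. w t * cosn n (\<theta> - t) \<partial>leb2pi)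
        = (\<integral>t. cosn n \<theta> * (w t * cosn n t) + sinn n \<theta> * (w t * sinn n t) \<partial>leb2pi)"
      unfolding eq by (simp add: algebra_simps)
    also have "\<dots> = cosn n \<theta> * (\<integral>t. w t * cosn n t \<partial>leb2pi) + sinn n \<theta> * (\<integral>t. w t * sinn n t \<partial>leb2pi)"
      using L2_integrable_mult[OF w cosn_L2[of n]] L2_integrable_mult[OF w sinn_L2[of n]] by simp
    finally show ?thesis by (simp add: LINT_sinn_reflect[OF w sym] cos_coeff_def)
  qed
  have "(\<lambda>n. -2 * a n * (\<integral>t. w t * cosn n (\<theta> - t) \<partial>leb2pi)) sums (\<integral>t. w t * (\<Sum>n. -2 * a n * cosn n (\<theta> - t)) \<partial>leb2pi)"
    by (rule LINT_cosseries_mult[OF k_abs_summable w cosn_le1 cL])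
  then have "(\<lambda>n. -2 * pi * (a n * cos_coeff n w * cosn n \<theta>)) sums (\<integral>t. K (\<theta> - t) * w t \<partial>leb2pi)"
    unfolding int K_cosseries cosseries_def by (simp add: mult_ac)
  moreover have "(\<lambda>n. -2 * pi * (a n * cos_coeff n w * cosn n \<theta>)) sums (-2 * pi * mult a w \<theta>)"
    unfolding mult_def by (intro sums_mult cosseries_sums a.abs_summable w)
  ultimately show ?thesis by (rule sums_unique2)
qed

lemma Yfun_bounded: "u \<in> Yfun \<Longrightarrow> \<exists>M. AE x in leb2pi. \<bar>u x\<bar> \<le> M"
  using W12_sup_bound[of u] by (auto simp: Yfun_def)

lemma Gamma_fun_eq:
  assumes u: "u \<in> Yfun" shows "Gamma_fun K u = mult a (gibbs u)"
proof
  fix \<theta>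
  obtain M where M: "AE x in leb2pi. \<bar>u x\<bar> \<le> M" using Yfun_bounded[OF u] by blast
  have eL: "(\<lambda>t. exp (- u t)) \<in> L2" by (rule exp_L2[OF L2_measurable[OF Yfun_L2[OF u]] M])
  have "AE x in leb2pi. exp (- u x) = exp (- u (2*pi - x))"
    using Yfun_reflect[OF u] by eventually_elim simp
  from K_convolution[OF eL this, of \<theta>]
  have "Gamma_fun K u \<theta> = (- 1 / mean_exp u) * mult a (\<lambda>t. exp (- u t)) \<theta>"
    by (simp add: Gamma_fun_def mean_exp_def field_simps)
  also have "\<dots> = mult a (gibbs u) \<theta>"
    using a.mult_scale[OF eL, of "- 1 / mean_exp u"] by (simp add: gibbs_def[abs_def])
  finally show "Gamma_fun K u \<theta> = mult a (gibbs u) \<theta>" .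
qed

lemma gibbs_rep_L2: "gibbs (rep_Y u) \<in> L2"
  by (rule gibbs_L2[OF L2_measurable[OF rep_Y_L2] sup_le_norm])

lemma Gamma_fun_Yfun: "u \<in> Yfun \<Longrightarrow> Gamma_fun K u \<in> Yfun"
  using Yfun_bounded[of u] a.mult_Yfun[OF gibbs_L2[OF L2_measurable[OF Yfun_L2]]]
  by (auto simp: Gamma_fun_eq)

lemma Gamma_Y_eq: "Gamma_Y K u = mult_Y a (gibbs (rep_Y u))"
  by (simp add: Gamma_Y_def mult_Y_def Gamma_fun_eq[OF rep_Y_Yfun])

text \<open>The representative of 0 vanishes only a.e., so \<open>gibbs\<close> of it is a.e. a
  constant; constants have no cosine coefficients.\<close>

lemma Gamma_Y_0: "Gamma_Y K 0 = 0"
  unfolding Gamma_Y_eq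
proof (rule mult_Y_zero)
  fix n
  let ?c = "- 1 / mean_exp (rep_Y 0)"
  have "AE x in leb2pi. rep_Y 0 x = 0" using AE_rep_abs[OF Yfun_zero] by (simp add: zero_Y_abs)
  then have "AE x in leb2pi. gibbs (rep_Y 0) x = ?c" by eventually_elim (simp add: gibbs_def)
  from cos_coeff_cong[OF gibbs_rep_L2 L2_const this]
  show "a n * cos_coeff n (gibbs (rep_Y 0)) = 0" by (simp add: cos_coeff_def LINT_cosn)
qed

section \<open>The linear part of \<Gamma> and its quadratic remainder\<close>

definition A :: "Y \<Rightarrow> Y" where "A u = mult_Y a (rep_Y u)"

lemma bounded_linear_A: "bounded_linear A"
  unfolding A_def[abs_def] by (rule a.bounded_linear_mult_Y)

lemma hat_A: "hat n (A u) = a n * hat n u"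
  unfolding A_def a.hat_mult_Y[OF rep_Y_L2] by (simp add: hat_def)

lemma A_mode: "A (mode j) = a j *\<^sub>R mode j"
proof -
  have "A (mode j) = mult_Y (\<lambda>n. if n = j then a j else 0) (rep_Y (mode j))"
    unfolding A_def by (rule mult_Y_eqI) (use hat_mode[of _ j] in \<open>simp add: hat_def\<close>)
  then show ?thesis using hat_mode[of j j] by (simp add: mult_Y_single hat_def)
qed

lemma rep_Y_mean: "(\<integral>x. rep_Y u x \<partial>leb2pi) = 0"
  using rep_Y_Yfun[of u] by (simp add: Yfun_def)

text \<open>The constant is 972 = 9 * 3 * 6 * 6, from \<open>norm_mult_Y_sup\<close>,
  \<open>gibbs_estimate\<close> and two uses of the embedding constant. On the unit ball the common
  bound M is at most 12, which turns exp (2 M) into exp 24.\<close>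

lemma Gamma_remainder:
  assumes "norm u \<le> 1" "norm w \<le> 1"
  shows "norm ((Gamma_Y K u - A u) - (Gamma_Y K w - A w))
    \<le> (972 * exp 24 * suminf a) * (norm u + norm w) * norm (u - w)"
proof -
  let ?u = "rep_Y u" and ?w = "rep_Y w"
  define M d where "M = 6 * (norm u + norm w)" and "d = 6 * norm (u - w)"
  have Md: "M \<ge> 0" "d \<ge> 0" "M \<le> 12" using assms by (auto simp: M_def d_def)
  have uM: "AE x in leb2pi. \<bar>?u x\<bar> \<le> M" "AE x in leb2pi. \<bar>?w x\<bar> \<le> M"
    using sup_le_norm[of u] sup_le_norm[of w] by (eventually_elim; simp add: M_def; smt (verit) norm_ge_zero)+
  have dd: "AE x in leb2pi. \<bar>?u x - ?w x\<bar> \<le> d"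
    using sup_le_norm[of "u - w"] AE_rep_diff[of u w] by eventually_elim (simp add: d_def)
  let ?r = "\<lambda>x. gibbs ?u x - gibbs ?w x - (?u x - ?w x)"
  have est: "AE x in leb2pi. \<bar>?r x\<bar> \<le> 3 * M * exp (2 * M) * d"
    by (intro gibbs_estimate L2_measurable rep_Y_L2 uM rep_Y_mean dd Md)
  have "(Gamma_Y K u - A u) - (Gamma_Y K w - A w) = mult_Y a ?r"
    unfolding Gamma_Y_eq A_def
    by (simp add: a.mult_Y_diff gibbs_rep_L2 rep_Y_L2 L2_diff)
  also have "norm \<dots> \<le> 9 * suminf a * (3 * M * exp (2 * M) * d)"
    using Md est by (intro a.norm_mult_Y_sup L2_diff gibbs_rep_L2 rep_Y_L2) auto
  also have "\<dots> \<le> 9 * suminf a * (3 * M * exp 24 * d)"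
    using Md a.C_nonneg by (intro mult_left_mono mult_right_mono) auto
  also have "\<dots> = (972 * exp 24 * suminf a) * (norm u + norm w) * norm (u - w)"
    by (simp add: M_def d_def algebra_simps)
  finally show ?thesis .
qed

text \<open>Supplies \<open>convA\<close> and \<open>convG\<close>. The sequence itself has only an
  a.e. uniform limit here; the multiplier \<open>a\<close> maps this convergence into
  \<open>Y\<close>, both directly and after \<open>gibbs\<close>, which is Lipschitz in the supremum
  norm on bounded sets of mean-zero functions.\<close>

lemma Gamma_Cauchy:
  assumes X: "Cauchy X"
  shows "convergent (\<lambda>n. A (X n))" "convergent (\<lambda>n. Gamma_Y K (X n))"
proof -
  obtain w M where w: "w \<in> borel_measurable leb2pi" "AE x in leb2pi. \<bar>w x\<bar> \<le> M" "(\<integral>x. w x \<partial>leb2pi) = 0"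
    and XM: "\<And>n. AE x in leb2pi. \<bar>rep_Y (X n) x\<bar> \<le> M"
    and conv: "\<And>e. e > 0 \<Longrightarrow> \<exists>N. \<forall>n\<ge>N. AE x in leb2pi. \<bar>rep_Y (X n) x - w x\<bar> \<le> e"
    by (rule Cauchy_Y_uniform_limit[OF X]) (rule that)
  \<comment> \<open>\<open>gibbs_estimate\<close> wants a bound known to be nonnegative.\<close>
  define L where "L = max M 0"
  have L: "L \<ge> 0" "AE x in leb2pi. \<bar>w x\<bar> \<le> L" "\<And>n. AE x in leb2pi. \<bar>rep_Y (X n) x\<bar> \<le> L"
  proof -
    show "AE x in leb2pi. \<bar>w x\<bar> \<le> L" using w(2) by eventually_elim (simp add: L_def)
    show "AE x in leb2pi. \<bar>rep_Y (X n) x\<bar> \<le> L" for n using XM[of n] by eventually_elim (simp add: L_def)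
  qed (simp add: L_def)
  note wL = AE_bounded_L2[OF w(1,2)] and gL = gibbs_L2[OF w(1,2)]
  define Q where "Q = 1 + 3 * L * exp (2 * L)"
  have Q: "Q \<ge> 1" using L(1) by (simp add: Q_def)
  have gibbs_close: "AE x in leb2pi. \<bar>gibbs (rep_Y (X n)) x - gibbs w x\<bar> \<le> Q * e"
    if d: "AE x in leb2pi. \<bar>rep_Y (X n) x - w x\<bar> \<le> e" and e: "e \<ge> 0" for n e
  proof -
    have "AE x in leb2pi. \<bar>gibbs (rep_Y (X n)) x - gibbs w x - (rep_Y (X n) x - w x)\<bar> \<le> 3 * L * exp (2 * L) * e"
      by (intro gibbs_estimate L2_measurable[OF rep_Y_L2] w(1,3) rep_Y_mean L d e)
    then show ?thesis using d by eventually_elim (simp add: Q_def algebra_simps)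
  qed
  have to: "(\<lambda>n. mult_Y a (f n)) \<longlonglongrightarrow> mult_Y a g"
    if fL: "\<And>n. f n \<in> L2" and gL: "g \<in> L2"
      and close: "\<And>n e. e \<ge> 0 \<Longrightarrow> AE x in leb2pi. \<bar>rep_Y (X n) x - w x\<bar> \<le> e \<Longrightarrow> AE x in leb2pi. \<bar>f n x - g x\<bar> \<le> Q * e" for f g
  proof (rule LIMSEQ_I)
    fix e :: real assume e: "e > 0"
    define S where "S = 9 * suminf a + 1"
    have S: "S > 0" using a.C_nonneg by (simp add: S_def)
    define e' where "e' = e / (2 * S * Q)"
    have e': "e' > 0" using e S Q by (simp add: e'_def)
    obtain N where N: "\<And>n. n \<ge> N \<Longrightarrow> AE x in leb2pi. \<bar>rep_Y (X n) x - w x\<bar> \<le> e'"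
      using conv[OF e'] by blast
    have "norm (mult_Y a (f n) - mult_Y a g) < e" if n: "n \<ge> N" for n
    proof -
      have "norm (mult_Y a (\<lambda>x. f n x - g x)) \<le> 9 * suminf a * (Q * e')"
        using e' Q close[OF _ N[OF n]] by (intro a.norm_mult_Y_sup L2_diff fL gL) auto
      also have "\<dots> \<le> S * (Q * e')" using e' Q by (intro mult_right_mono) (auto simp: S_def)
      also have "\<dots> = e / 2" using S Q by (simp add: e'_def)
      finally show ?thesis using e by (simp add: a.mult_Y_diff fL gL)
    qed
    then show "\<exists>N. \<forall>n\<ge>N. norm (mult_Y a (f n) - mult_Y a g) < e" by blast
  qed
  have "(\<lambda>n. A (X n)) \<longlonglongrightarrow> mult_Y a w"
    unfolding A_def
  proof (rule to[OF rep_Y_L2 wL])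
    fix n and e :: real assume e: "e \<ge> 0" and d: "AE x in leb2pi. \<bar>rep_Y (X n) x - w x\<bar> \<le> e"
    have "1 * e \<le> Q * e" using Q e by (intro mult_right_mono) auto
    then show "AE x in leb2pi. \<bar>rep_Y (X n) x - w x\<bar> \<le> Q * e" using d by (auto elim: eventually_mono)
  qed
  then show "convergent (\<lambda>n. A (X n))" by (auto simp: convergent_def)
  have "(\<lambda>n. Gamma_Y K (X n)) \<longlonglongrightarrow> mult_Y a (gibbs w)"
    unfolding Gamma_Y_eq by (rule to[OF gibbs_rep_L2 gL gibbs_close])
  then show "convergent (\<lambda>n. Gamma_Y K (X n))" by (auto simp: convergent_def)
qed

text \<open>Symbol of \<open>a\<^sub>j (a\<^sub>j - A)\<^sup>-\<^sup>1 - 1\<close> away from the mode \<open>j\<close>.\<close>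

definition resolvent_symbol :: "nat \<Rightarrow> nat \<Rightarrow> real" where
  "resolvent_symbol j n = (if n = j then 0 else a n / (a j - a n))"

lemma spectral_gap: obtains g where "g > 0" "\<And>n. n \<noteq> j \<Longrightarrow> g \<le> \<bar>a j - a n\<bar>"
proof
  \<comment> \<open>By monotonicity the neighbours of \<open>j\<close> are the closest values. For
    \<open>j = 0\<close> there is no left neighbour, and since \<open>j - 1\<close> is then 0 again,
    the value 1 replaces a difference that would vanish.\<close>
  define g where "g = min (a j - a (Suc j)) (if j = 0 then 1 else a (j - 1) - a j)"
  show "g > 0" using a_less[of j "Suc j"] a_less[of "j - 1" j] by (auto simp: g_def)
  show "g \<le> \<bar>a j - a n\<bar>" if "n \<noteq> j" for n
  proof (cases "n < j")
    case True
    then have "a (j - 1) \<le> a n" by (intro a_le) auto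
    moreover have "a (j - 1) - a j \<ge> g" using True by (simp add: g_def)
    ultimately show ?thesis by linarith
  next
    case False
    then have "a n \<le> a (Suc j)" using that by (intro a_le) auto
    moreover have "a j - a (Suc j) \<ge> g" by (simp add: g_def)
    ultimately show ?thesis by linarith
  qed
qed

text \<open>Subtracting 1 is essential: a_j / (a_j - a_n) tends to 1 and does not smooth, whereas
  a_n / (a_j - a_n) inherits the decay of a_n because the gap bounds the denominator from
  below.\<close>

lemma resolvent_smoothing: "\<exists>C. smoothing (resolvent_symbol j) C"
proof -
  obtain g where g: "g > 0" "\<And>n. n \<noteq> j \<Longrightarrow> g \<le> \<bar>a j - a n\<bar>" by (rule spectral_gap[of j]) blast
  have "real (Suc n) * \<bar>resolvent_symbol j n\<bar> \<le> suminf a / g" for n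
  proof (cases "n = j")
    case True
    then show ?thesis using a.C_nonneg g(1) by (simp add: resolvent_symbol_def)
  next
    case False
    then have "real (Suc n) * \<bar>resolvent_symbol j n\<bar> = (real (Suc n) * \<bar>a n\<bar>) / \<bar>a j - a n\<bar>"
      by (simp add: resolvent_symbol_def abs_divide)
    also have "\<dots> \<le> suminf a / g"
      using a.C[of n] g(1) g(2)[OF False] a.C_nonneg by (intro frac_le) auto
    finally show ?thesis .
  qed
  then show ?thesis by (auto simp: smoothing_def)
qed

text \<open>Reduced resolvent of \<open>A\<close> at \<open>a j\<close>. Its identity part is kept
  explicit, as it is no smoothing multiplier; off mode \<open>j\<close> the total symbol is 1 / (a_j
  - a_n).\<close>

definition B :: "nat \<Rightarrow> Y \<Rightarrow> Y" where
  "B j u = (1 / a j) *\<^sub>R (u - hat j u *\<^sub>R mode j + mult_Y (resolvent_symbol j) (rep_Y u))"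

lemma bifurcation_at:
  "simple_bifurcation (Gamma_Y K) A (B j) (hat j) (mode j) (a j) (972 * exp 24 * suminf a) 1"
proof -
  let ?h = "resolvent_symbol j" and ?\<delta> = "\<lambda>n. if n = j then 1 else 0 :: real"
  obtain C where h: "smoothing ?h C" using resolvent_smoothing by blast
  interpret h: smoothing ?h C by (rule h)
  interpret A: bounded_linear A by (rule bounded_linear_A)
  let ?H = "\<lambda>u. mult_Y ?h (rep_Y u)"
  have blB: "bounded_linear (B j)"
    unfolding B_def[abs_def]
    by (intro bounded_linear_const_scaleR bounded_linear_add bounded_linear_sub bounded_linear_ident
        bounded_linear_scaleR_const bounded_linear_hat h.bounded_linear_mult_Y)
  interpret B: bounded_linear "B j" by (rule blB)
  have sd: "smoothing ?\<delta> (real (Suc j))" by unfold_locales auto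
  have sah: "smoothing (\<lambda>n. a n * ?h n) (a 0 * C)"
  proof
    fix n
    have "\<bar>a n\<bar> * (real (Suc n) * \<bar>?h n\<bar>) \<le> a 0 * C"
      using a_le[of 0 n] a_pos[of n] h.C[of n] by (intro mult_mono) auto
    then show "real (Suc n) * \<bar>a n * ?h n\<bar> \<le> a 0 * C" by (simp add: abs_mult mult_ac)
  qed
  have scaled: "smoothing (\<lambda>n. a j * b n) (a j * D)" if "smoothing b D" for b D
  proof
    fix n
    interpret b: smoothing b D by (rule that)
    show "real (Suc n) * \<bar>a j * b n\<bar> \<le> a j * D"
      using mult_left_mono[OF b.C[of n], of "a j"] a_pos[of j] by (simp add: abs_mult mult_ac)
  qed
  have AH: "A (?H u) = mult_Y (\<lambda>n. a n * ?h n) (rep_Y u)" for u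
    unfolding A_def by (rule mult_Y_eqI) (use h.hat_mult_Y[OF rep_Y_L2[of u]] in \<open>simp add: hat_def\<close>)
  have HA: "?H (A u) = mult_Y (\<lambda>n. a n * ?h n) (rep_Y u)" for u
    by (rule mult_Y_eqI) (use hat_A[of _ u] in \<open>simp add: hat_def\<close>)
  \<comment> \<open>An identity of symbols. Off mode \<open>j\<close> it reads (a_j - a_n) h_n =
    a_n; at mode \<open>j\<close>, where h_j = 0, the projection term supplies the missing
    a_j.\<close>
  have key: "a j *\<^sub>R ?H u + (a j * hat j u) *\<^sub>R mode j = A u + A (?H u)" for u
  proof -
    have "a j *\<^sub>R ?H u + (a j * hat j u) *\<^sub>R mode j
        = mult_Y (\<lambda>n. a j * ?h n) (rep_Y u) + mult_Y (\<lambda>n. a j * ?\<delta> n) (rep_Y u)"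
      using mult_Y_single[of j 1 "rep_Y u"]
      by (simp only: mult_Y_scale_symbol[OF h rep_Y_L2] mult_Y_scale_symbol[OF sd rep_Y_L2]) (simp add: hat_def)
    also have "\<dots> = mult_Y (\<lambda>n. a j * ?h n + a j * ?\<delta> n) (rep_Y u)"
      by (rule mult_Y_add_symbol[OF scaled[OF h] scaled[OF sd] rep_Y_L2, symmetric])
    also have "(\<lambda>n. a j * ?h n + a j * ?\<delta> n) = (\<lambda>n. a n + a n * ?h n)"
    proof
      fix n
      have "a j - a n \<noteq> 0" if "n \<noteq> j" using a_less[of n j] a_less[of j n] that by (cases "n < j") auto
      then show "a j * ?h n + a j * ?\<delta> n = a n + a n * ?h n"
        by (auto simp: resolvent_symbol_def field_simps)
    qed
    also have "mult_Y (\<lambda>n. a n + a n * ?h n) (rep_Y u) = A u + A (?H u)"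
      unfolding AH A_def[of u] by (rule mult_Y_add_symbol[OF a.smoothing_axioms sah rep_Y_L2])
    finally show ?thesis .
  qed
  have aj: "a j \<noteq> 0" using a_pos[of j] by simp
  have AB: "a j *\<^sub>R B j u - A (B j u) = u - hat j u *\<^sub>R mode j" for u
  proof -
    have "A (B j u) = (1 / a j) *\<^sub>R (A u - (a j * hat j u) *\<^sub>R mode j + A (?H u))"
      unfolding B_def by (simp add: A.scaleR A.add A.diff A_mode mult.commute)
    also have "A u - (a j * hat j u) *\<^sub>R mode j + A (?H u)
        = (a j *\<^sub>R ?H u + (a j * hat j u) *\<^sub>R mode j) - (a j * hat j u) *\<^sub>R mode j"
      unfolding key by simp
    \<comment> \<open>The projection terms cancel, so \<open>A\<close> after \<open>B j\<close> is
      just \<open>?H\<close>, and the claim becomes the definition of \<open>B j\<close> multiplied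
      by \<open>a j\<close>.\<close>
    finally have "A (B j u) = ?H u" using aj by simp
    then show ?thesis using aj by (simp add: B_def)
  qed
  have BA: "B j (A u) = A (B j u)" for u
    unfolding B_def by (simp add: A.scaleR A.add A.diff A_mode hat_A HA AH mult.commute)
  show ?thesis
  proof (rule simple_bifurcation.intro)
    show "B j (a j *\<^sub>R u - A u) = u - hat j u *\<^sub>R mode j" for u
      using AB[of u] by (simp add: B.diff B.scaleR BA)
    show "hat j (B j u) = 0" for u
      by (simp add: B_def hat_simps hat_mode h.hat_mult_Y rep_Y_L2 resolvent_symbol_def)
    show "0 < 972 * exp 24 * suminf a"
      using a_pos by (auto intro!: suminf_pos a_summable mult_pos_pos)
    show "norm ((Gamma_Y K u - A u) - (Gamma_Y K w - A w)) \<le> (972 * exp 24 * suminf a) * (norm u + norm w) * norm (u - w)"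
      if "norm u \<le> 1" "norm w \<le> 1" for u w using that by (rule Gamma_remainder)
  qed (use bounded_linear_A blB bounded_linear_hat hat_mode A_mode a_pos hat_A AB Gamma_Y_0 Gamma_Cauchy in auto)
qed

section \<open>Bifurcation points and linear stability\<close>

lemma linearization_eq: "linearization (Gamma_Y K) l w = w - l *\<^sub>R A w"
  unfolding linearization_def simple_bifurcation.frechet_G[OF bifurcation_at] ..

lemma bifurcation_point: "n \<ge> 1 \<Longrightarrow> two_solutions_bifurcate (Gamma_Y K) (- 2 / k n)"
  using simple_bifurcation.bifurcation[OF bifurcation_at, of "n - 1"] by (simp add: a_def)

text \<open>On coefficients, an eigenvector satisfies (1 - l a_n - \<mu>) w_n = 0. If \<mu> \<le> 0,
  the factor is positive for every n, since it is smallest at n = 0, so all coefficients vanish.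
  Completeness of the cosine system is avoided: vanishing coefficients give \<open>A w = 0\<close>,
  and then the eigenvalue equation itself forces \<mu> = 1.\<close>

lemma stable:
  assumes "0 < l" "l < - 2 / k 1" shows "trivial_stable (Gamma_Y K) l"
  unfolding trivial_stable_def eigenvalue_def linearization_eq
proof (intro allI impI)
  fix \<mu> assume "\<exists>w. w \<noteq> 0 \<and> w - l *\<^sub>R A w = \<mu> *\<^sub>R w"
  then obtain w where w: "w \<noteq> 0" "w - l *\<^sub>R A w = \<mu> *\<^sub>R w" by blast
  have la0: "l * a 0 < 1" using assms(2) k_neg[of 1] by (simp add: a_def field_simps)
  show "\<mu> > 0"
  proof (rule ccontr)
    assume \<mu>: "\<not> \<mu> > 0"
    have "hat n w = 0" for n
    proof -
      have "hat n w - l * (a n * hat n w) = \<mu> * hat n w"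
        using arg_cong[OF w(2), of "hat n"] by (simp add: hat_simps hat_A)
      then have "(1 - l * a n - \<mu>) * hat n w = 0" by (simp add: algebra_simps)
      moreover have "l * a n \<le> l * a 0" using assms(1) a_le[of 0 n] by (intro mult_left_mono) auto
      then have "1 - l * a n - \<mu> > 0" using la0 \<mu> by linarith
      ultimately show ?thesis by simp
    qed
    then have "A w = 0" unfolding A_def by (intro mult_Y_zero) (simp add: hat_def)
    then have "(1 - \<mu>) *\<^sub>R w = 0" using w(2) by (simp add: scaleR_diff_left)
    then show False using w(1) \<mu> by simp
  qed
qed

lemma unstable:
  assumes "l > - 2 / k 1" shows "trivial_unstable (Gamma_Y K) l"
  unfolding trivial_unstable_def eigenvalue_def linearization_eq
proof (intro exI conjI)
  show "mode 0 \<noteq> 0" by (rule mode_nonzero)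
  show "mode 0 - l *\<^sub>R A (mode 0) = (1 - l * a 0) *\<^sub>R mode 0" by (simp add: A_mode scaleR_diff_left)
  show "1 - l * a 0 < 0" using assms k_neg[of 1] by (simp add: a_def field_simps)
qed

text \<open>The essential supremum cannot see the single point 0, but every interval (0, d) has
  positive measure and so contains a point respecting the bound; continuity of \<open>K\<close> then
  transfers it to 0.\<close>

lemma Linf_norm_ge:
  assumes "K \<in> Linf" shows "real_of_ereal (Linf_norm K) \<ge> - K 0"
proof -
  have AE: "AE x in leb2pi. ereal \<bar>K x\<bar> \<le> Linf_norm K" unfolding Linf_norm_def by (rule esssup_AE)
  have AEl: "AE x in lebesgue. x \<in> {0..2*pi} \<longrightarrow> ereal \<bar>K x\<bar> \<le> Linf_norm K"
    using AE by (subst (asm) AE_restrict_space_iff) auto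
  have ex: "\<exists>x\<in>{0<..<d}. ereal \<bar>K x\<bar> \<le> Linf_norm K" if d: "d > 0" for d
  proof (rule ccontr)
    assume no: "\<not> ?thesis"
    define c where "c = min d pi"
    have c: "c > 0" "c \<le> d" "c \<le> 2 * pi" using d pi_gt_zero by (auto simp: c_def min_def)
    have "AE x in lebesgue. x \<notin> {0<..<c}"
      using AEl by eventually_elim (use no c in auto)
    then have "{0<..<c} \<in> null_sets lebesgue" by (subst AE_iff_null_sets) auto
    then have "emeasure lebesgue {0<..<c} = 0" by (rule null_setsD1)
    then show False using c(1) by simp
  qed
  \<comment> \<open>Both infinities must be excluded because \<open>real_of_ereal\<close> sends them
    to 0.\<close>
  from ex[of 1] have "Linf_norm K \<noteq> -\<infinity>" by auto
  moreover have "Linf_norm K \<noteq> \<infinity>" using assms by (simp add: Linf_def)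
  ultimately obtain N where N: "Linf_norm K = ereal N" by (cases "Linf_norm K") auto
  have "- K 0 \<le> N + e" if e: "e > 0" for e
  proof -
    have "isCont K 0"
      using continuous_cosseries[OF k_abs_summable, of UNIV] unfolding K_cosseries
      by (simp add: continuous_on_eq_continuous_at)
    then obtain d where d: "d > 0" "\<And>x. dist x 0 < d \<Longrightarrow> dist (K x) (K 0) < e"
      using e unfolding continuous_at_eps_delta by (metis dist_real_def)
    obtain x where x: "x \<in> {0<..<d}" "ereal \<bar>K x\<bar> \<le> Linf_norm K" using ex[OF d(1)] by blast
    have "\<bar>K x\<bar> \<le> N" using x(2) by (simp add: N)
    moreover have "\<bar>K x - K 0\<bar> < e" using d(2)[of x] x(1) by (simp add: dist_real_def)
    ultimately show ?thesis by linarith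
  qed
  then have "- K 0 \<le> N" by (rule field_le_epsilon)
  then show ?thesis by (simp add: N)
qed

text \<open>Permits subtracting a constant from exp (-u) under the convolution.\<close>

lemma LINT_K_shift: "(\<integral>t. K (\<theta> - t) \<partial>leb2pi) = 0"
proof -
  have "(\<integral>t. K (\<theta> - t) * 1 \<partial>leb2pi) = - 2 * pi * mult a (\<lambda>_. 1) \<theta>"
    by (rule K_convolution[OF L2_const]) simp
  also have "mult a (\<lambda>_. 1) \<theta> = 0" by (simp add: mult_def cosseries_def cos_coeff_def LINT_cosn)
  finally show ?thesis by simp
qed

lemma K_shift_L2: "(\<lambda>t. K (\<theta> - t)) \<in> L2"
proof (rule continuous_L2)
  have "continuous_on UNIV K" unfolding K_cosseries by (rule continuous_cosseries[OF k_abs_summable])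
  then show "continuous_on UNIV (\<lambda>t. K (\<theta> - t))"
    by (rule continuous_on_compose2) (auto intro!: continuous_intros)
qed

text \<open>Since \<open>K\<close> has mean zero, exp (-u) may be replaced by its deviation from the
  mean m. The bound 2 pi m M of that deviation cancels the normalisation 2 pi m and leaves the
  factor M.\<close>

lemma Gamma_fun_bound:
  assumes u: "u \<in> Yfun" and M: "M > 0" "AE x in leb2pi. \<bar>u x\<bar> \<le> M"
  shows "\<bar>Gamma_fun K u \<theta>\<bar> \<le> - K 0 * M"
proof -
  have um: "u \<in> borel_measurable leb2pi" "(\<integral>x. u x \<partial>leb2pi) = 0"
    using u L2_measurable[OF Yfun_L2[OF u]] by (auto simp: Yfun_def)
  define m where "m = mean_exp u"
  have m: "m \<ge> 1" unfolding m_def by (rule mean_exp_ge1[OF um(1) M(2) um(2)])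
  note eL = exp_L2[OF um(1) M(2)]
  have dL: "(\<lambda>t. exp (- u t) - m) \<in> L2" by (intro L2_diff eL L2_const)
  have "(\<integral>t. K (\<theta> - t) * (exp (- u t) - m) \<partial>leb2pi) = (\<integral>t. K (\<theta> - t) * exp (- u t) \<partial>leb2pi)"
    using L2_integrable_mult[OF K_shift_L2 eL] L2_integrable[OF K_shift_L2] LINT_K_shift
    by (simp add: right_diff_distrib)
  then have "Gamma_fun K u \<theta> = inverse (2 * pi * m) * (\<integral>t. K (\<theta> - t) * (exp (- u t) - m) \<partial>leb2pi)"
    by (simp add: Gamma_fun_def m_def mean_exp_def)
  also have "\<bar>\<dots>\<bar> \<le> inverse (2 * pi * m) * (\<integral>t. \<bar>K (\<theta> - t) * (exp (- u t) - m)\<bar> \<partial>leb2pi)"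
    using m integral_abs_bound[of leb2pi "\<lambda>t. K (\<theta> - t) * (exp (- u t) - m)"]
    unfolding abs_mult[of "inverse _"] by (intro mult_mono) auto
  also have "\<dots> \<le> inverse (2 * pi * m) * (\<integral>t. - K 0 * \<bar>exp (- u t) - m\<bar> \<partial>leb2pi)"
  proof (intro mult_left_mono LINT_le_AE AE_I2)
    show "integrable leb2pi (\<lambda>t. \<bar>K (\<theta> - t) * (exp (- u t) - m)\<bar>)"
      using L2_integrable_mult[OF K_shift_L2 dL] by simp
    show "integrable leb2pi (\<lambda>t. - K 0 * \<bar>exp (- u t) - m\<bar>)"
      by (intro L2_integrable L2_scale L2_abs dL)
    show "\<bar>K (\<theta> - t) * (exp (- u t) - m)\<bar> \<le> - K 0 * \<bar>exp (- u t) - m\<bar>" for t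
      unfolding abs_mult by (intro mult_right_mono K_le) simp
  qed (use m in simp)
  also have "\<dots> = inverse (2 * pi * m) * (- K 0 * (\<integral>t. \<bar>exp (- u t) - m\<bar> \<partial>leb2pi))" by simp
  also have "\<dots> \<le> inverse (2 * pi * m) * (- K 0 * (2 * pi * m * M))"
    using m K_le[of 0] exp_mean_deviation[OF um(1) M(2) um(2) M(1)] unfolding m_def[symmetric]
    by (intro mult_left_mono) auto
  also have "\<dots> = - K 0 * M" using m by (simp add: field_simps)
  finally show ?thesis .
qed

text \<open>With S the supremum of \<bar>\<lambda> \<Gamma>[u]\<bar>, a solution satisfies
  \<bar>u\<bar> \<le> S a.e., and the contraction bound then gives S \<le> \<lambda> (- K 0) S with
  \<lambda> (- K 0) < 1. The pointwise bound on \<Gamma>[u] allows a genuine supremum instead of an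
  essential one.\<close>

lemma unique_trivial:
  assumes KL: "K \<in> Linf" and l: "0 < l" "l < inverse (real_of_ereal (Linf_norm K))"
  shows "u - l *\<^sub>R Gamma_Y K u = 0 \<longleftrightarrow> u = 0"
proof
  assume "u - l *\<^sub>R Gamma_Y K u = 0"
  then have eq: "u = l *\<^sub>R Gamma_Y K u" by simp
  let ?u = "rep_Y u" and ?G = "\<lambda>\<theta>. l * Gamma_fun K (rep_Y u) \<theta>"
  \<comment> \<open>An inverse above the positive \<open>l\<close> is positive, which rules out the
    default inverse of 0.\<close>
  have N: "real_of_ereal (Linf_norm K) > 0" using l by (metis inverse_positive_iff_positive less_trans)
  have "l * (- K 0) \<le> l * real_of_ereal (Linf_norm K)" using Linf_norm_ge[OF KL] l(1) by (intro mult_left_mono) auto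
  also have "\<dots> < 1" using l(2) N by (simp add: field_simps)
  finally have lK: "l * (- K 0) < 1" .
  have AEu: "AE x in leb2pi. ?u x = ?G x"
  proof -
    have "AE x in leb2pi. rep_Y (l *\<^sub>R Gamma_Y K u) x = l * rep_Y (Gamma_Y K u) x" by (rule AE_rep_scale)
    moreover have "AE x in leb2pi. rep_Y (Gamma_Y K u) x = Gamma_fun K ?u x"
      unfolding Gamma_Y_def by (rule AE_rep_abs[OF Gamma_fun_Yfun[OF rep_Y_Yfun]])
    ultimately show ?thesis by eventually_elim (use eq in simp)
  qed
  have bound: "\<bar>?G \<theta>\<bar> \<le> l * (- K 0) * M" if "M > 0" "AE x in leb2pi. \<bar>?u x\<bar> \<le> M" for M \<theta>
    using mult_left_mono[OF Gamma_fun_bound[OF rep_Y_Yfun that, of \<theta>], of l] l(1)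
    by (simp add: abs_mult mult.assoc)
  define S where "S = (SUP \<theta>. \<bar>?G \<theta>\<bar>)"
  \<comment> \<open>The added 1 makes the bound strictly positive, as \<open>bound\<close>
    demands.\<close>
  have "AE x in leb2pi. \<bar>?u x\<bar> \<le> 6 * norm u + 1"
    using sup_le_norm[of u] by eventually_elim simp
  then have bdd: "bdd_above (range (\<lambda>\<theta>. \<bar>?G \<theta>\<bar>))"
    using bound[of "6 * norm u + 1"] by (intro bdd_aboveI2) (auto simp: add_nonneg_pos)
  have GS: "\<bar>?G \<theta>\<bar> \<le> S" for \<theta> unfolding S_def by (rule cSUP_upper[OF _ bdd]) simp
  have uS: "AE x in leb2pi. \<bar>?u x\<bar> \<le> S"
    using AEu by eventually_elim (use GS in simp)
  have "S \<le> 0"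
  proof (rule ccontr)
    assume "\<not> S \<le> 0"
    then have S: "S > 0" by simp
    have "S \<le> l * (- K 0) * S"
      unfolding S_def by (rule cSUP_least) (use bound[OF S uS] in \<open>auto simp: S_def\<close>)
    also have "\<dots> < 1 * S" using lK S by (intro mult_strict_right_mono)
    finally show False by simp
  qed
  then have "AE x in leb2pi. ?u x = 0" using uS by (auto elim: eventually_mono)
  then have "abs_Y ?u = abs_Y (\<lambda>_. 0)" by (intro abs_Y_eqI rep_Y_Yfun Yfun_zero)
  then show "u = 0" by (simp add: abs_rep_Y zero_Y_abs)
qed (simp add: Gamma_Y_0)

end

text \<open>The first two conjuncts give the others their meaning: \<open>Gamma_Y\<close>
  presupposes that \<open>Gamma_fun K\<close> preserves \<open>Yfun\<close>, and
  \<open>linearization\<close> presupposes differentiability at 0.\<close>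

theorem theorem4p4:
  fixes K :: "real \<Rightarrow> real" and k :: "nat \<Rightarrow> real"
  assumes "K \<in> W1inf"
    and "\<forall>\<theta>. (\<lambda>n. k (Suc n) * cos (2 * real (Suc n) * \<theta>)) sums K \<theta>"
    and "\<forall>n\<ge>1. k n < 0"
    and "strict_mono_on {1..} k"
  shows "(\<forall>u\<in>Yfun. Gamma_fun K u \<in> Yfun) \<and> Gamma_Y K differentiable (at 0) \<and>
    (\<forall>l. 0 < l \<and> l < inverse (real_of_ereal (Linf_norm K)) \<longrightarrow>
       (\<forall>u. u - l *\<^sub>R Gamma_Y K u = 0 \<longleftrightarrow> u = 0)) \<and>
    (\<forall>n\<ge>1. two_solutions_bifurcate (Gamma_Y K) (- 2 / k n)) \<and>
    (\<forall>l. 0 < l \<and> l < - 2 / k 1 \<longrightarrow> trivial_stable (Gamma_Y K) l) \<and>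
    (\<forall>l. l > - 2 / k 1 \<longrightarrow> trivial_unstable (Gamma_Y K) l)"
proof -
  interpret cosine_kernel K k using assms(2-4) by unfold_locales auto
  have Linf: "K \<in> Linf" using assms(1) by (simp add: W1inf_def)
  have diff: "Gamma_Y K differentiable (at 0)"
    using simple_bifurcation.has_derivative_G[OF bifurcation_at[of 0]] by (auto simp: differentiable_def)
  show ?thesis
    by (intro conjI ballI allI impI diff; (elim conjE)?;
        rule Gamma_fun_Yfun unique_trivial[OF Linf] bifurcation_point stable unstable; assumption)
qed

end
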